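(* Let $q$ be a prime power. Let $NU_0=1$ and, for $n\ge 1$, let $NU_n$ be the number of ordered pairs $(A,B)$ of commuting nilpotent matrices in the Lie algebra of $\mathrm{GU}(n,q)$ (both $A$ and $B$ nilpotent, $AB=BA$). Then \[ \sum_{n \geq 0} \frac{NU_n u^n}{|\mathrm{GU}(n,q)|} = \prod_{i \geq 1} \prod_{l \geq 1} \frac{1}{1+(-1)^l u^i/q^l}. \]
   Context: For a matrix $A$ over $\mathbb{F}_{q^2}$, $\bar A$ denotes the matrix obtained by applying $y\mapsto y^q$ to every entry, and $A^{\top}$ the transpose. $\mathrm{GU}(n,q)$ is the group of $n\times n$ matrices $U$ over $\mathbb{F}_{q^2}$ with $U\bar U^{\top}=I$; its Lie algebra is the set of $n\times n$ matrices $A$ over $\mathbb{F}_{q^2}$ with $\bar A^{\top}=-A$. By convention $|\mathrm{GU}(0,q)|=1$. The identity is one of power series in $u$ with real coefficients (the infinite product converging coefficientwise). *)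

theory Defs
  imports
    Complex_Main
    "HOL-Computational_Algebra.Formal_Power_Series"
    "HOL-Number_Theory.Prime_Powers"
    "Jordan_Normal_Form.Matrix"
begin

text \<open>
  In the definitions on matrices the type \<^typ>\<open>'a\<close> plays the role of the field with \<open>q\<^sup>2\<close> elements;
  the cardinality is an assumption of the theorem.
\<close>

definition conj_mat :: "nat \<Rightarrow> 'a::field mat \<Rightarrow> 'a mat" where
  "conj_mat q A = map_mat (\<lambda>y. y ^ q) A"

definition GU :: "nat \<Rightarrow> nat \<Rightarrow> 'a::field mat set" where
  "GU n q = {U \<in> carrier_mat n n. U * transpose_mat (conj_mat q U) = 1\<^sub>m n}"

definition GU_lie :: "nat \<Rightarrow> nat \<Rightarrow> 'a::field mat set" where
  "GU_lie n q = {A \<in> carrier_mat n n. transpose_mat (conj_mat q A) = - A}"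

definition nilpotent_mat :: "'a::field mat \<Rightarrow> bool" where
  "nilpotent_mat A \<longleftrightarrow> (\<exists>k. A ^\<^sub>m k = 0\<^sub>m (dim_row A) (dim_row A))"

definition NU_pairs :: "nat \<Rightarrow> nat \<Rightarrow> ('a::field mat \<times> 'a mat) set" where
  "NU_pairs n q = {(A, B). A \<in> GU_lie n q \<and> B \<in> GU_lie n q \<and>
     nilpotent_mat A \<and> nilpotent_mat B \<and> A * B = B * A}"

text \<open>
  The conventions \<open>NU\<^sub>0 = 1\<close> and \<open>|GU(0,q)| = 1\<close> are instances of the general definitions, since there
  is exactly one \<open>0 \<times> 0\<close> matrix.
\<close>

lemma mat_0_0_eq:
  assumes "A \<in> carrier_mat 0 0" and "B \<in> carrier_mat 0 0"
  shows "A = B"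
  using assms by (intro eq_matI) auto

lemma card_GU_0: "card (GU 0 q :: 'a::field mat set) = 1"
proof -
  have "(GU 0 q :: 'a mat set) = {1\<^sub>m 0}"
    by (auto simp: GU_def conj_mat_def intro!: mat_0_0_eq)
  then show ?thesis by simp
qed

lemma card_NU_pairs_0: "card (NU_pairs 0 q :: ('a::field mat \<times> 'a mat) set) = 1"
proof -
  have "nilpotent_mat (1\<^sub>m 0 :: 'a mat)"
    unfolding nilpotent_mat_def by (rule exI[of _ 0]) (auto intro!: mat_0_0_eq)
  then have "(NU_pairs 0 q :: ('a mat \<times> 'a mat) set) = {(1\<^sub>m 0, 1\<^sub>m 0)}"
    by (auto simp: NU_pairs_def GU_lie_def conj_mat_def intro!: mat_0_0_eq)
  then show ?thesis by simp
qed

text \<open>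
  Infinite products of real power series, indexed from 1, with coefficientwise convergence of the
  partial products in the usual topology of the reals. The library's topology on \<^typ>\<open>real fps\<close> is the
  \<open>u\<close>-adic one (each coefficient has to become eventually constant); in it the product over \<open>l\<close>
  below does not converge.
\<close>

definition fps_prod_convergent :: "(nat \<Rightarrow> real fps) \<Rightarrow> bool" where
  "fps_prod_convergent f \<longleftrightarrow> (\<forall>n. convergent (\<lambda>N. fps_nth (\<Prod>k=1..N. f k) n))"

definition fps_prodinf :: "(nat \<Rightarrow> real fps) \<Rightarrow> real fps" where
  "fps_prodinf f = Abs_fps (\<lambda>n. lim (\<lambda>N. fps_nth (\<Prod>k=1..N. f k) n))"

end

(* A nilpotent A in the Lie algebra, of corank k, induces the nondegenerate skew form h(A x, y) on
   V / ker A. A and B descend to a commuting nilpotent pair of skew operators for this form, and the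
   corank can only drop, say from k to c. Counting the ways to lift the smaller pair back to V shows that
   a(n, k) = #{(A, B) : corank A = k} / |GU(n, q)| satisfies a(n, k) = sum_{c <= k} a(n - k, c) w(k - c),
   where w(m) is the number of nilpotent elements in the Lie algebra of GU(m, q) divided by |GU(m, q)|.
   So F(u, z) = sum a(n, k) u^n z^k satisfies F(u, z) = W(u z) F(u, u z) for the series W of w, whence
   F(u, 1) = prod_i W(u^i). The same count with B = 0 gives a recursion for nilpotent elements by corank,
   which q-binomial identities solve: w(m) = (-t)^m / ((1 - t) ... (1 - t^m)) with t = -1/q.
   Since W(t u) = (1 + t u) W(u), W is the inner product over l. *)
theory Submission
  imports Defs "Jordan_Normal_Form.Determinant"
begin

subsection \<open>Matrices over finite fields\<close>

text \<open>The lifting count is a double count. A pair (A, B) is coded as a triple: a nondegenerate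
  Hermitian form J on the dual space, a skew form N with A = J N, and B. GL(n) acts on triples by
  change of coordinates. Moving J to the identity gives back the pairs. Moving N to a scalar
  multiple of diag(1, 0) makes ker A a coordinate subspace, and a diagonal block J1 of J becomes the
  smaller element, up to the scalar. The obstacle is that J1 is degenerate, of corank c: one has to
  count the nondegenerate Hermitian J with the block J1, and the nilpotent lifts of B for each of
  them. Both numbers depend on the smaller pair only through c. The former comes from Schur
  complements and from inverting J, which turns the corank of a diagonal block into that of the
  complementary block. In the latter the radical carries a part that is nilpotent anyway, so a lift
  is a nilpotent skew element of size k - c and free parameters; powers of q cancel and w(k - c)
  remains. With B = 0 the order of GU(n, q) enters; it comes from counting all Hermitian matrices by
  rank.\<close>

lemma card_eq_by_inverse:
  assumes "\<And>a. a \<in> A \<Longrightarrow> f a \<in> B \<and> g (f a) = a"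
    and "\<And>b. b \<in> B \<Longrightarrow> g b \<in> A \<and> f (g b) = b"
  shows "card A = card B"
  by (rule bij_betw_same_card[of f], rule bij_betw_byWitness[of A g f B]) (use assms in auto)

lemma card_by_fibres:
  assumes "finite A" "finite B" "\<And>x. x \<in> A \<Longrightarrow> f x \<in> B"
    and "\<And>y. y \<in> B \<Longrightarrow> card {x \<in> A. f x = y} = c y"
  shows "card A = (\<Sum>y\<in>B. c y)"
proof -
  have "(\<Sum>y\<in>B. sum (\<lambda>_. 1::nat) {x \<in> A. f x = y}) = sum (\<lambda>_. 1) A"
    by (rule sum.group) (use assms in auto)
  then show ?thesis using assms(4) by simp
qed

lemma card_carrier_mat: "card (carrier_mat n m :: 'a::finite mat set) = card (UNIV :: 'a set) ^ (n * m)"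
proof -
  let ?I = "{..<n} \<times> {..<m}"
  have "bij_betw (\<lambda>A. restrict (\<lambda>ij. A $$ ij) ?I) (carrier_mat n m) (PiE ?I (\<lambda>_. UNIV :: 'a set))"
  proof (rule bij_betw_byWitness[where f' = "mat n m"])
    show "\<forall>A\<in>carrier_mat n m. mat n m (restrict (\<lambda>ij. A $$ ij) ?I) = (A :: 'a mat)"
      by (intro ballI eq_matI) simp_all
    have "restrict (\<lambda>ij. mat n m f $$ ij) ?I x = f x" if "f \<in> PiE ?I (\<lambda>_. UNIV)"
      for x and f :: "nat \<times> nat \<Rightarrow> 'a"
      using PiE_arb[OF that, of x] by (cases x) simp
    then show "\<forall>f\<in>PiE ?I (\<lambda>_. UNIV :: 'a set). restrict (\<lambda>ij. mat n m f $$ ij) ?I = f" by blast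
    show "(\<lambda>A. restrict (\<lambda>ij. A $$ ij) ?I) ` carrier_mat n m \<subseteq> PiE ?I (\<lambda>_. UNIV :: 'a set)"
      by (intro image_subsetI restrict_PiE_iff[THEN iffD2]) blast
    show "mat n m ` PiE ?I (\<lambda>_. UNIV :: 'a set) \<subseteq> carrier_mat n m"
      by (intro image_subsetI mat_carrier)
  qed
  then show ?thesis by (simp add: bij_betw_same_card card_PiE)
qed

lemma card_carrier_vec: "card (carrier_vec n :: 'a::finite vec set) = card (UNIV :: 'a set) ^ n"
proof -
  let ?I = "{..<n}"
  have "bij_betw (\<lambda>v. restrict (\<lambda>i. v $ i) ?I) (carrier_vec n) (PiE ?I (\<lambda>_. UNIV :: 'a set))"
  proof (rule bij_betw_byWitness[where f' = "vec n"])
    show "\<forall>v\<in>carrier_vec n. vec n (restrict (\<lambda>i. v $ i) ?I) = (v :: 'a vec)"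
      by (intro ballI eq_vecI) simp_all
    have "restrict (\<lambda>i. vec n f $ i) ?I x = f x" if "f \<in> PiE ?I (\<lambda>_. UNIV)"
      for x and f :: "nat \<Rightarrow> 'a"
      using PiE_arb[OF that, of x] by simp
    then show "\<forall>f\<in>PiE ?I (\<lambda>_. UNIV :: 'a set). restrict (\<lambda>i. vec n f $ i) ?I = f" by blast
    show "(\<lambda>v. restrict (\<lambda>i. v $ i) ?I) ` carrier_vec n \<subseteq> PiE ?I (\<lambda>_. UNIV :: 'a set)"
      by (intro image_subsetI restrict_PiE_iff[THEN iffD2]) blast
    show "vec n ` PiE ?I (\<lambda>_. UNIV :: 'a set) \<subseteq> carrier_vec n"
      by (intro image_subsetI vec_carrier)
  qed
  then show ?thesis by (simp add: bij_betw_same_card card_PiE)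
qed

lemma finite_carrier_mat [simp]: "finite (carrier_mat n m :: 'a::finite mat set)"
  by (rule card_ge_0_finite) (simp add: card_carrier_mat finite_UNIV_card_ge_0)

lemma finite_carrier_vec [simp]: "finite (carrier_vec n :: 'a::finite vec set)"
  by (rule card_ge_0_finite) (simp add: card_carrier_vec finite_UNIV_card_ge_0)

section \<open>Matrix algebra with explicit dimensions, and block decompositions\<close>

lemma mat_assoc:
  "dim_col A = dim_row B \<Longrightarrow> dim_col B = dim_row C \<Longrightarrow> (A * B) * C = A * (B * (C :: 'a::semiring_0 mat))"
  by (rule assoc_mult_mat[of _ "dim_row A" "dim_col A" _ "dim_col B" _ "dim_col C"]) auto

lemma mat_add_distrib_left:
  "dim_col A = dim_row B \<Longrightarrow> dim_row B = dim_row C \<Longrightarrow> dim_col B = dim_col C \<Longrightarrow>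
   A * (B + C) = A * B + A * (C :: 'a::comm_semiring_0 mat)"
  by (rule mult_add_distrib_mat[of _ "dim_row A" "dim_col A" _ "dim_col B"]) auto

lemma mat_add_distrib_right:
  "dim_col A = dim_row C \<Longrightarrow> dim_row A = dim_row B \<Longrightarrow> dim_col A = dim_col B \<Longrightarrow>
   (A + B) * C = A * C + B * (C :: 'a::comm_semiring_0 mat)"
  by (rule add_mult_distrib_mat[of _ "dim_row A" "dim_col A" _ _ "dim_col C"]) auto

lemma mat_vec_assoc:
  "dim_col A = dim_row B \<Longrightarrow> dim_col B = dim_vec v \<Longrightarrow> (A * B) *\<^sub>v v = A *\<^sub>v (B *\<^sub>v (v :: 'a::semiring_0 vec))"
  by (rule assoc_mult_mat_vec[of _ "dim_row A" "dim_col A" _ "dim_col B"]) auto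

lemma mat_mult_smult_right:
  "dim_col A = dim_row B \<Longrightarrow> A * (c \<cdot>\<^sub>m B) = c \<cdot>\<^sub>m (A * (B :: 'a::comm_semiring_0 mat))"
  by (rule mult_smult_distrib[of _ "dim_row A" "dim_col A" _ "dim_col B"]) auto

lemma mat_mult_smult_left:
  "dim_col A = dim_row B \<Longrightarrow> (c \<cdot>\<^sub>m A) * B = c \<cdot>\<^sub>m (A * (B :: 'a::comm_semiring_0 mat))"
  by (rule mult_smult_assoc_mat[of _ "dim_row A" "dim_col A" _ "dim_col B"]) auto

lemma mat_smult_smult: "a \<cdot>\<^sub>m (b \<cdot>\<^sub>m A) = (a * b) \<cdot>\<^sub>m (A :: 'a::semigroup_mult mat)"
  by (rule eq_matI) (auto simp: mult.assoc)

lemma mat_smult_one [simp]: "1 \<cdot>\<^sub>m (A :: 'a::monoid_mult mat) = A"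
  by (rule eq_matI) auto

lemma four_block_cases:
  assumes "M \<in> carrier_mat (r + k) (s + l)"
  obtains A B C D where "M = four_block_mat A B C D" "A \<in> carrier_mat r s" "B \<in> carrier_mat r l"
    "C \<in> carrier_mat k s" "D \<in> carrier_mat k l"
  using split_block[of M r s _ _ _ _ k l] assms by (metis carrier_matD prod_cases4)

lemma four_block_eq_iff:
  assumes "A \<in> carrier_mat r s" "B \<in> carrier_mat r l" "C \<in> carrier_mat k s" "D \<in> carrier_mat k l"
    "A' \<in> carrier_mat r s" "B' \<in> carrier_mat r l" "C' \<in> carrier_mat k s" "D' \<in> carrier_mat k l"
  shows "four_block_mat A B C D = four_block_mat A' B' C' D' \<longleftrightarrow> A = A' \<and> B = B' \<and> C = C' \<and> D = D'"
proof
  assume *: "four_block_mat A B C D = four_block_mat A' B' C' D'"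
  have ix: "four_block_mat A B C D $$ (i, j) = four_block_mat A' B' C' D' $$ (i, j)" for i j
    using * by simp
  show "A = A' \<and> B = B' \<and> C = C' \<and> D = D'"
  proof (intro conjI eq_matI)
    fix i j
    show "i < dim_row A' \<Longrightarrow> j < dim_col A' \<Longrightarrow> A $$ (i, j) = A' $$ (i, j)"
      using ix[of i j] assms by auto
    show "i < dim_row B' \<Longrightarrow> j < dim_col B' \<Longrightarrow> B $$ (i, j) = B' $$ (i, j)"
      using ix[of i "s + j"] assms by auto
    show "i < dim_row C' \<Longrightarrow> j < dim_col C' \<Longrightarrow> C $$ (i, j) = C' $$ (i, j)"
      using ix[of "r + i" j] assms by auto
    show "i < dim_row D' \<Longrightarrow> j < dim_col D' \<Longrightarrow> D $$ (i, j) = D' $$ (i, j)"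
      using ix[of "r + i" "s + j"] assms by auto
  qed (use assms in auto)
qed simp

lemma uminus_four_block_mat:
  assumes "A \<in> carrier_mat r s" "B \<in> carrier_mat r l" "C \<in> carrier_mat k s" "D \<in> carrier_mat k l"
  shows "- four_block_mat A B C D = four_block_mat (- A) (- B) (- C) (- D)"
  by (rule eq_matI) (use assms in auto)

lemma vec_append_cases:
  assumes "v \<in> carrier_vec (r + k)"
  obtains x y where "v = x @\<^sub>v y" "x \<in> carrier_vec r" "y \<in> carrier_vec k"
  using vec_first_last_append[of v r k] assms vec_first_carrier vec_last_carrier by metis

section \<open>Invertible matrices and kernels\<close>

definition GL :: "nat \<Rightarrow> 'a::field mat set" where
  "GL n = {g \<in> carrier_mat n n. det g \<noteq> 0}"

text \<open>Coranks are recorded as cardinalities of kernels: corank k over a field with Q elements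
  means Q^k kernel vectors.\<close>

definition ker_mat :: "'a::field mat \<Rightarrow> 'a vec set" where
  "ker_mat A = {v \<in> carrier_vec (dim_col A). A *\<^sub>v v = 0\<^sub>v (dim_row A)}"

lemma GL_carrier: "g \<in> GL n \<Longrightarrow> g \<in> carrier_mat n n"
  by (simp add: GL_def)

lemma GL_iff_ker: "g \<in> carrier_mat n n \<Longrightarrow> g \<in> GL n \<longleftrightarrow> (\<forall>v \<in> carrier_vec n. g *\<^sub>v v = 0\<^sub>v n \<longrightarrow> v = 0\<^sub>v n)"
  using det_0_iff_vec_prod_zero_field[of g n] by (auto simp: GL_def)

lemma GL_D: "g \<in> GL n \<Longrightarrow> v \<in> carrier_vec n \<Longrightarrow> g *\<^sub>v v = 0\<^sub>v n \<Longrightarrow> v = 0\<^sub>v n"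
  using GL_iff_ker GL_carrier by blast

lemma GL_one [simp]: "1\<^sub>m n \<in> GL n"
  by (simp add: GL_def)

lemma GL_mult: "g \<in> GL n \<Longrightarrow> h \<in> GL n \<Longrightarrow> g * h \<in> GL n"
  by (auto simp: GL_def det_mult)

lemma GL_if_inverse: "g \<in> carrier_mat n n \<Longrightarrow> h \<in> carrier_mat n n \<Longrightarrow> g * h = 1\<^sub>m n \<Longrightarrow> g \<in> GL n"
  using det_mult[of g n h] by (auto simp: GL_def)

lemma GL_inverse:
  assumes "g \<in> GL n"
  obtains h where "h \<in> GL n" "g * h = 1\<^sub>m n" "h * g = 1\<^sub>m n"
proof -
  from assms have "g \<in> Units (ring_mat TYPE('a) n ())"
    by (intro det_non_zero_imp_unit) (auto simp: GL_def)
  then obtain h where "h \<in> carrier_mat n n" "g * h = 1\<^sub>m n" "h * g = 1\<^sub>m n"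
    by (auto simp: Units_def ring_mat_def)
  then show ?thesis using that assms GL_if_inverse[of h n g] by (auto simp: GL_def)
qed

lemma mat_cancel:
  assumes "g * h = 1\<^sub>m n" "g \<in> carrier_mat n n" "h \<in> carrier_mat n n" "dim_row X = n"
  shows "g * (h * X) = (X :: 'a::field mat)"
  using assms by (metis assoc_mult_mat carrier_matI left_mult_one_mat')

lemma vec_cancel:
  assumes "g * h = 1\<^sub>m n" "g \<in> carrier_mat n n" "h \<in> carrier_mat n n" "x \<in> carrier_vec n"
  shows "g *\<^sub>v (h *\<^sub>v x) = (x :: 'a::field vec)"
  using assms by (metis assoc_mult_mat_vec one_mult_mat_vec)

lemma finite_GL [simp]: "finite (GL n :: 'a::{finite,field} mat set)"
  by (rule finite_subset[OF _ finite_carrier_mat[of n n]]) (auto simp: GL_def)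

lemma mult_zero_vec [simp]: "A *\<^sub>v 0\<^sub>v (dim_col A) = 0\<^sub>v (dim_row A)"
  by (rule eq_vecI) (auto simp: scalar_prod_def)

lemma mult_zero_vec': "A \<in> carrier_mat r k \<Longrightarrow> A *\<^sub>v 0\<^sub>v k = 0\<^sub>v r"
  using mult_zero_vec[of A] by auto

text \<open>Since \<open>g\<close> is injective, \<open>v\<close> lies in the kernel of
  \<open>g * A * h\<close> exactly when \<open>h\<close> sends it into the kernel of
  \<open>A\<close>, so \<open>h\<close> maps one kernel bijectively onto the other.\<close>

lemma card_ker_conj:
  assumes "g \<in> GL n" "h \<in> GL n" "A \<in> carrier_mat n n"
  shows "card (ker_mat (g * A * h)) = card (ker_mat A)"
proof -
  obtain gi where gi: "gi \<in> GL n" "g * gi = 1\<^sub>m n" "gi * g = 1\<^sub>m n" using GL_inverse[OF assms(1)] .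
  obtain hi where hi: "hi \<in> GL n" "h * hi = 1\<^sub>m n" "hi * h = 1\<^sub>m n" using GL_inverse[OF assms(2)] .
  note c = assms(1,2)[THEN GL_carrier] gi(1)[THEN GL_carrier] hi(1)[THEN GL_carrier] assms(3)
  have e: "(g * A * h) *\<^sub>v v = g *\<^sub>v (A *\<^sub>v (h *\<^sub>v v))" if "v \<in> carrier_vec n" for v
    using that c by (simp add: mat_vec_assoc)
  have z: "(g * A * h) *\<^sub>v v = 0\<^sub>v n \<longleftrightarrow> A *\<^sub>v (h *\<^sub>v v) = 0\<^sub>v n" if "v \<in> carrier_vec n" for v
    unfolding e[OF that] using GL_D[OF assms(1), of "A *\<^sub>v (h *\<^sub>v v)"] that c by (auto simp: mult_zero_vec')
  have k: "v \<in> ker_mat (g * A * h) \<longleftrightarrow> v \<in> carrier_vec n \<and> A *\<^sub>v (h *\<^sub>v v) = 0\<^sub>v n" for v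
    using z[of v] c by (auto simp: ker_mat_def)
  show ?thesis
  proof (rule card_eq_by_inverse[where f = "\<lambda>v. h *\<^sub>v v" and g = "\<lambda>v. hi *\<^sub>v v"])
    fix v assume "v \<in> ker_mat (g * A * h)"
    then show "h *\<^sub>v v \<in> ker_mat A \<and> hi *\<^sub>v (h *\<^sub>v v) = v"
      unfolding k using c vec_cancel[OF hi(3)] by (auto simp: ker_mat_def)
  next
    fix v assume "v \<in> ker_mat A"
    then have v: "v \<in> carrier_vec n" "A *\<^sub>v v = 0\<^sub>v n" using c by (auto simp: ker_mat_def)
    then show "hi *\<^sub>v v \<in> ker_mat (g * A * h) \<and> h *\<^sub>v (hi *\<^sub>v v) = v"
      unfolding k using c vec_cancel[OF hi(2) _ _ v(1)] by auto
  qed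
qed

lemma in_ker_mat: "A \<in> carrier_mat r k \<Longrightarrow> v \<in> ker_mat A \<longleftrightarrow> v \<in> carrier_vec k \<and> A *\<^sub>v v = 0\<^sub>v r"
  unfolding ker_mat_def carrier_mat_def by blast

lemma zero_in_ker: "A \<in> carrier_mat r k \<Longrightarrow> 0\<^sub>v k \<in> ker_mat A"
  using in_ker_mat mult_zero_vec' zero_carrier_vec by blast

lemma ker_GL:
  assumes "g \<in> GL n"
  shows "ker_mat g = {0\<^sub>v n}"
  using in_ker_mat[OF GL_carrier[OF assms]] GL_D[OF assms] zero_in_ker[OF GL_carrier[OF assms]] by blast

lemma GL_iff_card_ker:
  assumes g: "g \<in> carrier_mat n n"
  shows "g \<in> GL n \<longleftrightarrow> card (ker_mat g) = 1"
proof
  assume "card (ker_mat g) = 1"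
  then obtain w where w: "ker_mat g = {w}" by (rule card_1_singletonE)
  have "v = 0\<^sub>v n" if "v \<in> carrier_vec n" "g *\<^sub>v v = 0\<^sub>v n" for v
    using that in_ker_mat[OF g, of v] zero_in_ker[OF g] unfolding w by blast
  then show "g \<in> GL n" unfolding GL_iff_ker[OF g] by blast
next
  assume "g \<in> GL n"
  then show "card (ker_mat g) = 1" unfolding ker_GL[OF \<open>g \<in> GL n\<close>] by simp
qed

lemma card_ker_smult:
  assumes "c \<noteq> 0"
  shows "card (ker_mat (c \<cdot>\<^sub>m A)) = card (ker_mat A)"
proof -
  have "(c \<cdot>\<^sub>m A) *\<^sub>v v = c \<cdot>\<^sub>v (A *\<^sub>v v)" if "v \<in> carrier_vec (dim_col A)" for v
    using that by (intro eq_vecI) auto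
  moreover have "c \<cdot>\<^sub>v w = 0\<^sub>v (dim_vec w) \<longleftrightarrow> w = 0\<^sub>v (dim_vec w)" for w
    using assms by (metis (no_types, lifting) eq_vecI index_smult_vec(1,2) index_zero_vec(1,2) mult_eq_0_iff)
  ultimately have "ker_mat (c \<cdot>\<^sub>m A) = ker_mat A"
    unfolding ker_mat_def by (metis (no_types, lifting) dim_mult_mat_vec index_smult_mat(2,3))
  then show ?thesis by simp
qed

text \<open>The normal form of a Hermitian matrix of rank \<open>r\<close> and corank
  \<open>k\<close> under congruence.\<close>

definition diag_one :: "nat \<Rightarrow> nat \<Rightarrow> 'a::field mat" where
  "diag_one r k = four_block_mat (1\<^sub>m r) (0\<^sub>m r k) (0\<^sub>m k r) (0\<^sub>m k k)"

lemma diag_one_carrier [simp]: "diag_one r k \<in> carrier_mat (r + k) (r + k)"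
  by (simp add: diag_one_def)

lemma diag_one_dim [simp]: "dim_row (diag_one r k) = r + k" "dim_col (diag_one r k) = r + k"
  by (simp_all add: diag_one_def)

lemma card_ker_diag_one: "card (ker_mat (diag_one r k :: 'a::{finite,field} mat)) = card (UNIV :: 'a set) ^ k"
proof -
  have e: "diag_one r k *\<^sub>v (x @\<^sub>v y) = x @\<^sub>v 0\<^sub>v k" if "x \<in> carrier_vec r" "y \<in> carrier_vec k" for x y :: "'a vec"
    unfolding diag_one_def using that
    by (subst four_block_mat_mult_vec[of _ r r _ k _ k]) auto
  have z: "(0\<^sub>v (r + k) :: 'a vec) = 0\<^sub>v r @\<^sub>v 0\<^sub>v k" by (rule eq_vecI) auto
  have "card (ker_mat (diag_one r k :: 'a mat)) = card (carrier_vec k :: 'a vec set)"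
  proof (rule card_eq_by_inverse[where f = "\<lambda>v. vec_last v k" and g = "\<lambda>y. 0\<^sub>v r @\<^sub>v y"])
    fix a :: "'a vec" assume a: "a \<in> ker_mat (diag_one r k)"
    then have "a \<in> carrier_vec (r + k)" by (simp add: ker_mat_def diag_one_def)
    then obtain x y where xy: "a = x @\<^sub>v y" "x \<in> carrier_vec r" "y \<in> carrier_vec k" by (rule vec_append_cases)
    with a have "x @\<^sub>v 0\<^sub>v k = 0\<^sub>v r @\<^sub>v 0\<^sub>v k" by (simp add: ker_mat_def e) (simp add: diag_one_def z)
    then have "x = 0\<^sub>v r" using xy by (simp add: append_vec_eq[of _ r])
    moreover have "vec_last a k = y" unfolding xy(1) using xy by (intro eq_vecI) (auto simp: vec_last_def)
    ultimately show "vec_last a k \<in> carrier_vec k \<and> 0\<^sub>v r @\<^sub>v vec_last a k = a" using xy by simp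
  next
    fix b :: "'a vec" assume b: "b \<in> carrier_vec k"
    have "vec_last (0\<^sub>v r @\<^sub>v b) k = b" using b by (intro eq_vecI) (auto simp: vec_last_def)
    then show "0\<^sub>v r @\<^sub>v b \<in> ker_mat (diag_one r k) \<and> vec_last (0\<^sub>v r @\<^sub>v b) k = b"
      using b e[of "0\<^sub>v r" b] by (simp add: ker_mat_def) (simp add: diag_one_def z)
  qed
  then show ?thesis by (simp add: card_carrier_vec)
qed

subsection \<open>Hermitian and skew-Hermitian matrices\<close>

lemma card_zeros_power_le:
  assumes "n > 0" and "\<And>x :: 'a::field. P x \<Longrightarrow> x ^ n = a * x ^ m + b" and "m < n"
  shows "card {x :: 'a. P x} \<le> n"
proof -
  let ?p = "monom 1 n - monom a m - monom b 0 :: 'a poly"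
  have "coeff ?p n = 1" using assms(1,3) by simp
  then have "?p \<noteq> 0" by (metis coeff_0 zero_neq_one)
  have "card {x :: 'a. P x} \<le> card {x. poly ?p x = 0}"
    by (rule card_mono) (use assms(2) poly_roots_finite[OF \<open>?p \<noteq> 0\<close>] in \<open>auto simp: poly_monom\<close>)
  also have "\<dots> \<le> degree ?p" by (rule card_poly_roots_bound) fact
  also have "\<dots> \<le> n"
    by (intro degree_diff_le degree_monom_le[THEN order_trans]) (use assms in auto)
  finally show ?thesis .
qed

text \<open>Multiplication by a nonzero \<open>x\<close> permutes the nonzero elements, so their
  product picks up one factor \<open>x\<close> for each of them and yet stays the same.\<close>

lemma power_card_UNIV_eq_self: "(x :: 'a::{finite,field}) ^ card (UNIV :: 'a set) = x"
proof (cases "x = 0")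
  case False
  have "(\<Prod>y\<in>UNIV-{0}. x * y) = (\<Prod>y\<in>UNIV-{0}. y)"
    by (rule prod.reindex_bij_witness[of _ "\<lambda>y. y / x" "\<lambda>y. x * y"]) (use False in auto)
  then have "x ^ (card (UNIV :: 'a set) - 1) * \<Prod>(UNIV-{0}) = \<Prod>(UNIV-{0::'a})"
    by (simp add: prod.distrib)
  then have "x ^ (card (UNIV :: 'a set) - 1) = 1" by simp
  then show ?thesis
    using finite_UNIV_card_ge_0[where ?'a = 'a] by (metis Suc_diff_1 finite_code mult_1 power_Suc2)
qed (use finite_UNIV_card_ge_0[where ?'a = 'a] in auto)

text \<open>Translation by 1 permutes the field, so the sum of all elements grows by
  \<open>card UNIV\<close> times 1 and yet stays the same.\<close>

lemma CHAR_dvd_card: "CHAR('a::{finite,field}) dvd card (UNIV :: 'a set)"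
proof -
  have "(\<Sum>x\<in>UNIV. x + 1 :: 'a) = (\<Sum>x\<in>UNIV. x)"
    by (rule sum.reindex_bij_witness[of _ "\<lambda>x. x - 1" "\<lambda>x. x + 1"]) auto
  then have "of_nat (card (UNIV :: 'a set)) = (0 :: 'a)" by (simp add: sum.distrib)
  then show ?thesis by (simp add: of_nat_eq_0_iff_char_dvd)
qed

locale unitary_field =
  fixes q :: nat and ty :: "'a::{finite,field} itself"
  assumes primepow_q: "primepow q" and card_UNIV: "card (UNIV :: 'a set) = q ^ 2"
begin

lemma q_gt_1: "q > 1"
  using primepow_gt_Suc_0[OF primepow_q] by simp

lemma q_pos [simp]: "q > 0" and q_nonzero [simp]: "q \<noteq> 0"
  using q_gt_1 by simp_all

text \<open>The characteristic divides \<open>q ^ 2\<close>, which is a power of a single prime.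
  That \<open>q\<close> is a power of the characteristic is what makes \<open>x ^ q\<close>
  additive.\<close>

lemma prime_char: "prime CHAR('a)" and q_char: "\<exists>k. q = CHAR('a) ^ k"
proof -
  obtain p k where p: "prime p" "q = p ^ k" using primepow_q by (auto simp: primepow_def)
  have c: "CHAR('a) > 0" by (rule finite_imp_CHAR_pos) simp
  then show pr: "prime CHAR('a)" by (simp add: prime_CHAR_semidom)
  have "CHAR('a) dvd p ^ (k * 2)" using CHAR_dvd_card[where ?'a = 'a] card_UNIV p by (simp add: power_mult)
  then have "CHAR('a) = p" using pr p(1) by (metis prime_dvd_power primes_dvd_imp_eq)
  then show "\<exists>k. q = CHAR('a) ^ k" using p by blast
qed

lemma conj_add: "((x :: 'a) + y) ^ q = x ^ q + y ^ q"
  using freshmans_dream'[OF prime_char] q_char by blast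

lemma conj_sum: "(sum f A :: 'a) ^ q = (\<Sum>i\<in>A. f i ^ q)"
  by (induction A rule: infinite_finite_induct) (auto simp: conj_add)

lemma conj_conj [simp]: "((x :: 'a) ^ q) ^ q = x"
  using power_card_UNIV_eq_self[of x] by (simp add: card_UNIV power2_eq_square power_mult)

lemma conj_minus [simp]: "(- x :: 'a) ^ q = - (x ^ q)"
  using conj_add[of x "- x"] by (simp add: power_0_left eq_neg_iff_add_eq_0 add.commute)

lemma conj_diff: "((x :: 'a) - y) ^ q = x ^ q - y ^ q"
  using conj_add[of x "- y"] by simp

text \<open>Each set has at most \<open>q\<close> elements by the root bound. The additive map
  \<open>x ^ q - x\<close> sends the field into the second set, and its nonempty fibres are
  translates of the first one. So \<open>q * q\<close> is at most the product of the two
  cardinalities, and both bounds are attained.\<close>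

lemma card_additive_fibres:
  shows "card {x :: 'a. x ^ q = x} = q" and "card {x :: 'a. x ^ q = - x} = q"
proof -
  let ?K = "{x :: 'a. x ^ q = x}" and ?I = "{x :: 'a. x ^ q = - x}"
  have 1: "card ?K \<le> q" by (rule card_zeros_power_le[where a = 1 and b = 0 and m = 1]) (use q_gt_1 in auto)
  have 2: "card ?I \<le> q" by (rule card_zeros_power_le[where a = "-1" and b = 0 and m = 1]) (use q_gt_1 in auto)
  have fib: "card {x \<in> UNIV. x ^ q - x = y} \<le> card ?K" for y :: 'a
  proof (cases "{x \<in> UNIV. x ^ q - x = y} = {}")
    case False
    then obtain x0 where "x0 ^ q - x0 = y" by blast
    then show ?thesis
      by (intro card_inj_on_le[of "\<lambda>x. x - x0"]) (auto simp: inj_on_def conj_diff algebra_simps)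
  qed simp
  have "q * q = card (UNIV :: 'a set)" by (simp add: card_UNIV power2_eq_square)
  also have "\<dots> = (\<Sum>y\<in>?I. card {x \<in> UNIV. x ^ q - x = y})"
    by (rule card_by_fibres) (auto simp: conj_diff)
  also have "\<dots> \<le> (\<Sum>y\<in>?I. card ?K)" by (rule sum_mono) (rule fib)
  also have "\<dots> = card ?I * card ?K" by simp
  finally have 3: "q * q \<le> card ?I * card ?K" .
  have "q * q \<le> q * card ?K" by (rule order_trans[OF 3 mult_right_mono]) (use 2 in simp_all)
  moreover have "q * q \<le> card ?I * q" by (rule order_trans[OF 3 mult_left_mono]) (use 1 in simp_all)
  ultimately have "q \<le> card ?K" "q \<le> card ?I" by simp_all
  then show "card ?K = q" "card ?I = q" using 1 2 by linarith+
qed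

text \<open>The norm maps the \<open>q ^ 2 - 1\<close> nonzero elements into the
  \<open>q - 1\<close> nonzero fixed ones, and its fibres have at most \<open>q + 1\<close> elements
  by the root bound; only a surjection leaves enough room.\<close>

lemma norm_surj:
  assumes "c ^ q = c" "(c :: 'a) \<noteq> 0"
  shows "\<exists>a. a * a ^ q = c"
proof -
  let ?F = "{x :: 'a. x ^ q = x \<and> x \<noteq> 0}"
  let ?N = "\<lambda>a :: 'a. a * a ^ q"
  have "{x :: 'a. x ^ q = x} = insert 0 ?F" by auto
  then have F: "card ?F = q - 1" using card_additive_fibres(1) card_insert_disjoint[of ?F 0] by simp
  have fib: "card {x \<in> - {0}. ?N x = y} \<le> q + 1" for y
    by (rule card_zeros_power_le[where a = 0 and b = y and m = 1]) (use q_gt_1 in auto)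
  have "(q - 1) * (q + 1) = card (- {0 :: 'a})"
    by (simp add: Compl_eq_Diff_UNIV card_Diff_subset card_UNIV power2_eq_square algebra_simps)
  also have "\<dots> = (\<Sum>y\<in>?N ` (- {0}). card {x \<in> - {0}. ?N x = y})"
    by (rule card_by_fibres) auto
  also have "\<dots> \<le> (\<Sum>y\<in>?N ` (- {0}). q + 1)" by (rule sum_mono) (rule fib)
  also have "\<dots> = card (?N ` (- {0})) * (q + 1)" by simp
  finally have "(q - 1) * (q + 1) \<le> card (?N ` (- {0})) * (q + 1)" .
  then have "card ?F \<le> card (?N ` (- {0}))" unfolding F by (simp only: mult_le_cancel2)
  moreover have "?N ` (- {0}) \<subseteq> ?F" by (auto simp: power_mult_distrib)
  ultimately have eq: "?N ` (- {0}) = ?F" by (intro card_seteq[OF finite])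
  have "c \<in> ?F" using assms by simp
  then obtain a where "c = ?N a" unfolding eq[symmetric] by (rule imageE)
  then show ?thesis by auto
qed

lemma exists_not_fixed: "\<exists>a :: 'a. a ^ q \<noteq> a"
proof (rule ccontr)
  assume "\<not> ?thesis"
  then have "{x :: 'a. x ^ q = x} = UNIV" by blast
  then show False using card_additive_fibres(1) card_UNIV q_gt_1 by (simp add: power2_eq_square)
qed

text \<open>Multiplication by such a scalar exchanges Hermitian and skew-Hermitian matrices and
  keeps kernels, so normal forms and cardinalities have to be found only for the Hermitian
  ones.\<close>

lemma exists_skew_scalar: "\<exists>\<theta> :: 'a. \<theta> \<noteq> 0 \<and> \<theta> ^ q = - \<theta>"
proof (rule ccontr)
  assume "\<not> ?thesis"
  then have "{x :: 'a. x ^ q = - x} \<subseteq> {0}" by blast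
  from card_mono[OF _ this] card_additive_fibres(2) q_gt_1 show False by simp
qed

section \<open>Conjugate transpose, Hermitian and skew-Hermitian matrices\<close>

definition adj :: "'a mat \<Rightarrow> 'a mat" where
  "adj A = transpose_mat (conj_mat q A)"

lemma adj_index [simp]: "i < dim_col A \<Longrightarrow> j < dim_row A \<Longrightarrow> adj A $$ (i, j) = (A $$ (j, i)) ^ q"
  and adj_dim [simp]: "dim_row (adj A) = dim_col A" "dim_col (adj A) = dim_row A"
  by (simp_all add: adj_def conj_mat_def)

lemma adj_carrier [simp]: "adj A \<in> carrier_mat n m \<longleftrightarrow> A \<in> carrier_mat m n"
  unfolding carrier_mat_def mem_Collect_eq adj_dim by blast

lemma adj_adj [simp]: "adj (adj A) = A"
  by (rule eq_matI) auto

lemma adj_eq_iff: "adj A = B \<longleftrightarrow> A = adj B"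
  by auto

lemma adj_one [simp]: "adj (1\<^sub>m n) = 1\<^sub>m n"
  by (rule eq_matI) auto

lemma adj_zero [simp]: "adj (0\<^sub>m n m) = 0\<^sub>m m n"
  by (rule eq_matI) auto

lemma adj_uminus [simp]: "adj (- A) = - adj A"
  by (rule eq_matI) auto

lemma adj_smult [simp]: "adj (c \<cdot>\<^sub>m A) = c ^ q \<cdot>\<^sub>m adj A"
  by (rule eq_matI) (auto simp: power_mult_distrib)

lemma adj_add: "dim_row A = dim_row B \<Longrightarrow> dim_col A = dim_col B \<Longrightarrow> adj (A + B) = adj A + adj B"
  by (rule eq_matI) (auto simp: conj_add)

lemma adj_mult: "dim_col A = dim_row B \<Longrightarrow> adj (A * B) = adj B * adj A"
  by (rule eq_matI) (auto simp: scalar_prod_def conj_sum power_mult_distrib mult.commute)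

lemma adj_four_block:
  assumes "A \<in> carrier_mat r s" "B \<in> carrier_mat r l" "C \<in> carrier_mat k s" "D \<in> carrier_mat k l"
  shows "adj (four_block_mat A B C D) = four_block_mat (adj A) (adj C) (adj B) (adj D)"
  by (rule eq_matI) (use assms in auto)

lemma adj_diag_one [simp]: "adj (diag_one r k) = diag_one r k"
  unfolding diag_one_def by (subst adj_four_block) auto

lemma adj_GL: 
  assumes "g \<in> GL n"
  shows "adj g \<in> GL n"
proof -
  obtain h where h: "h \<in> GL n" "g * h = 1\<^sub>m n" "h * g = 1\<^sub>m n" using GL_inverse[OF assms] .
  then have "adj g * adj h = 1\<^sub>m n" 
    using assms adj_mult[of h g] by (auto simp: GL_def)
  then show ?thesis using GL_carrier[OF assms] GL_carrier[OF h(1)] by (intro GL_if_inverse[of _ _ "adj h"]) auto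
qed

definition Herm :: "nat \<Rightarrow> 'a mat set" where
  "Herm n = {A \<in> carrier_mat n n. adj A = A}"

abbreviation Skew :: "nat \<Rightarrow> 'a mat set" where
  "Skew n \<equiv> GU_lie n q"

lemma Skew_iff: "A \<in> Skew n \<longleftrightarrow> A \<in> carrier_mat n n \<and> adj A = - A"
  by (simp add: GU_lie_def adj_def)

lemma Herm_carrier: "A \<in> Herm n \<Longrightarrow> A \<in> carrier_mat n n"
  by (simp add: Herm_def)

lemma Skew_carrier: "A \<in> Skew n \<Longrightarrow> A \<in> carrier_mat n n"
  by (simp add: Skew_iff)

lemma Herm_four_block:
  assumes "A \<in> carrier_mat r r" "B \<in> carrier_mat r k" "C \<in> carrier_mat k r" "D \<in> carrier_mat k k"
  shows "four_block_mat A B C D \<in> Herm (r + k) \<longleftrightarrow> A \<in> Herm r \<and> D \<in> Herm k \<and> C = adj B"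
  using assms by (auto simp: Herm_def adj_four_block[OF assms] four_block_eq_iff[of _ r r _ k _ k])

lemma Skew_four_block:
  assumes "A \<in> carrier_mat r r" "B \<in> carrier_mat r k" "C \<in> carrier_mat k r" "D \<in> carrier_mat k k"
  shows "four_block_mat A B C D \<in> Skew (r + k) \<longleftrightarrow> A \<in> Skew r \<and> D \<in> Skew k \<and> C = - adj B"
proof -
  have "- adj B = C \<longleftrightarrow> adj C = - B" by (metis adj_adj adj_uminus uminus_uminus_mat)
  then show ?thesis
    using assms by (auto simp: Skew_iff adj_four_block[OF assms] four_block_eq_iff[of _ r r _ k _ k]
        uminus_four_block_mat[OF assms]) 
qed

lemma finite_Herm [simp]: "finite (Herm n)"
  by (rule finite_subset[OF _ finite_carrier_mat[of n n]]) (auto simp: Herm_def)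

lemma finite_Skew [simp]: "finite (Skew n)"
  by (rule finite_subset[OF _ finite_carrier_mat[of n n]]) (auto simp: Skew_iff)

lemma Skew_smult_iff:
  assumes "\<theta> \<noteq> 0" "\<theta> ^ q = - \<theta>"
  shows "\<theta> \<cdot>\<^sub>m A \<in> Skew n \<longleftrightarrow> A \<in> Herm n" and "\<theta> \<cdot>\<^sub>m A \<in> Herm n \<longleftrightarrow> A \<in> Skew n"
proof -
  have u: "(- \<theta>) \<cdot>\<^sub>m X = - (\<theta> \<cdot>\<^sub>m X)" "\<theta> \<cdot>\<^sub>m (- X) = - (\<theta> \<cdot>\<^sub>m X)" for X :: "'a mat"
    by (auto intro!: eq_matI)
  have i: "\<theta> \<cdot>\<^sub>m X = \<theta> \<cdot>\<^sub>m Y \<longleftrightarrow> X = Y" for X Y :: "'a mat"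
    using assms(1) by (metis left_inverse mat_smult_one mat_smult_smult)
  have n: "- X = - Y \<longleftrightarrow> X = Y" for X Y :: "'a mat"
    by (metis uminus_uminus_mat)
  have c: "\<theta> \<cdot>\<^sub>m X \<in> carrier_mat n n \<longleftrightarrow> X \<in> carrier_mat n n" for X
    unfolding carrier_mat_def by simp
  show "\<theta> \<cdot>\<^sub>m A \<in> Skew n \<longleftrightarrow> A \<in> Herm n"
    unfolding Skew_iff Herm_def c by (simp add: assms(2) u n i)
  have "- (\<theta> \<cdot>\<^sub>m adj A) = \<theta> \<cdot>\<^sub>m A \<longleftrightarrow> adj A = - A"
    using i[of "adj A" "- A"] n[of "\<theta> \<cdot>\<^sub>m adj A" "- (\<theta> \<cdot>\<^sub>m A)"] by (simp add: u)
  then show "\<theta> \<cdot>\<^sub>m A \<in> Herm n \<longleftrightarrow> A \<in> Skew n"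
    unfolding Skew_iff Herm_def by (auto simp: c assms(2) u)
qed

lemma card_Skew_eq_Herm: "card (Skew n) = card (Herm n)"
proof -
  obtain \<theta> :: 'a where t: "\<theta> \<noteq> 0" "\<theta> ^ q = - \<theta>" using exists_skew_scalar by blast
  show ?thesis
    by (rule card_eq_by_inverse[where f = "\<lambda>A. \<theta> \<cdot>\<^sub>m A" and g = "\<lambda>A. inverse \<theta> \<cdot>\<^sub>m A"])
      (use t Skew_smult_iff[OF t] in \<open>auto simp: mat_smult_smult Skew_smult_iff(1)[OF t, of "inverse \<theta> \<cdot>\<^sub>m _", symmetric]
        simp flip: Skew_smult_iff(2)[OF t, of "inverse \<theta> \<cdot>\<^sub>m _"]\<close>)
qed

lemma card_Herm_1: "card (Herm 1) = q"
proof -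
  have "card (Herm 1) = card {x :: 'a. x ^ q = x}"
  proof (rule card_eq_by_inverse[where f = "\<lambda>A. A $$ (0, 0)" and g = "\<lambda>x. mat 1 1 (\<lambda>_. x)"])
    fix A assume "A \<in> Herm 1"
    then have d: "dim_row A = 1" "dim_col A = 1" and e: "adj A = A" by (auto simp: Herm_def)
    have "A $$ (0, 0) = adj A $$ (0, 0)" using e by simp
    then have "(A $$ (0, 0)) ^ q = A $$ (0, 0)" using d by simp
    moreover have "mat 1 1 (\<lambda>_. A $$ (0, 0)) = A" by (rule eq_matI) (use d in auto)
    ultimately show "A $$ (0, 0) \<in> {x. x ^ q = x} \<and> mat 1 1 (\<lambda>_. A $$ (0, 0)) = A" by blast
  next
    fix x :: 'a assume x: "x \<in> {x. x ^ q = x}"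
    have "adj (mat 1 1 (\<lambda>_. x)) = mat 1 1 (\<lambda>_. x)" by (rule eq_matI) (use x in auto)
    then show "mat 1 1 (\<lambda>_. x) \<in> Herm 1 \<and> mat 1 1 (\<lambda>_. x) $$ (0, 0) = x" by (simp add: Herm_def)
  qed
  then show ?thesis by (simp add: card_additive_fibres)
qed

text \<open>The factors are the two Hermitian diagonal blocks and one free off-diagonal block; the
  other off-diagonal block is its adjoint.\<close>

lemma card_Herm_add: "card (Herm (r + k)) = card (Herm r) * (q ^ 2) ^ (r * k) * card (Herm k)"
proof -
  let ?f = "\<lambda>(A, B, D). four_block_mat A B (adj B) D"
  have "bij_betw ?f (Herm r \<times> carrier_mat r k \<times> Herm k) (Herm (r + k))"
  proof (rule bij_betw_imageI)
    show "inj_on ?f (Herm r \<times> carrier_mat r k \<times> Herm k)"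
    proof (rule inj_onI)
      fix x y assume "x \<in> Herm r \<times> carrier_mat r k \<times> Herm k" "y \<in> Herm r \<times> carrier_mat r k \<times> Herm k" "?f x = ?f y"
      then show "x = y"
        using four_block_eq_iff[of "fst x" r r "fst (snd x)" k "adj (fst (snd x))" k "snd (snd x)"
            "fst y" "fst (snd y)" "adj (fst (snd y))" "snd (snd y)"]
        by (auto simp: Herm_carrier)
    qed
    show "?f ` (Herm r \<times> carrier_mat r k \<times> Herm k) = Herm (r + k)"
    proof (intro equalityI subsetI)
      fix M assume "M \<in> ?f ` (Herm r \<times> carrier_mat r k \<times> Herm k)"
      then show "M \<in> Herm (r + k)" by (auto simp: Herm_four_block Herm_carrier)
    next
      fix M assume M: "M \<in> Herm (r + k)"
      obtain A B C D where *: "M = four_block_mat A B C D" "A \<in> carrier_mat r r" "B \<in> carrier_mat r k"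
        "C \<in> carrier_mat k r" "D \<in> carrier_mat k k"
        using four_block_cases[OF Herm_carrier[OF M]] by metis
      then have "A \<in> Herm r \<and> D \<in> Herm k \<and> C = adj B" using M Herm_four_block[OF *(2-5)] by simp
      then show "M \<in> ?f ` (Herm r \<times> carrier_mat r k \<times> Herm k)"
        by (intro image_eqI[of _ _ "(A, B, D)"]) (use * in auto)
    qed
  qed
  from bij_betw_same_card[OF this] show ?thesis
    by (simp add: card_cartesian_product card_carrier_mat card_UNIV)
qed

lemma card_Herm: "card (Herm n) = q ^ (n ^ 2)"
proof (induction n)
  case 0
  have "Herm 0 = {0\<^sub>m 0 0}" by (auto simp: Herm_def intro!: mat_0_0_eq)
  then show ?case by simp
next
  case (Suc n)
  have "card (Herm (Suc n)) = q * (q ^ 2) ^ n * q ^ (n ^ 2)"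
    using card_Herm_add[of 1 n] by (simp add: card_Herm_1[simplified] Suc)
  also have "\<dots> = q ^ (1 + 2 * n + n ^ 2)" by (simp add: power_add power_mult)
  also have "1 + 2 * n + n ^ 2 = (Suc n) ^ 2" by (simp add: power2_eq_square)
  finally show ?case .
qed

lemma card_Skew: "card (Skew n) = q ^ (n ^ 2)"
  by (simp add: card_Skew_eq_Herm card_Herm)

end

subsection \<open>Normal form of Hermitian matrices\<close>

text \<open>In the standard basis, \<open>v\<close> replaces a unit vector at a coordinate where
  \<open>v\<close> does not vanish.\<close>

lemma exists_GL_first_row:
  assumes v: "v \<in> carrier_vec (Suc n)" "v \<noteq> 0\<^sub>v (Suc n)"
  shows "\<exists>g \<in> GL (Suc n). row g 0 = (v :: 'a::field vec)"
proof -
  obtain i where i: "i < Suc n" "v $ i \<noteq> 0"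
    using v by (metis eq_vecI carrier_vecD index_zero_vec)
  \<comment> \<open>Below row 0 stand the unit vectors of all indices except \<open>i\<close>: row
    \<open>i\<close> would repeat it and receives index 0 instead, which row 0 has given up.\<close>
  define idx where "idx j = (if j = i then 0 else j)" for j
  define g where "g = mat\<^sub>r (Suc n) (Suc n) (\<lambda>j. if j = 0 then v else unit_vec (Suc n) (idx j))"
  have gc: "g \<in> carrier_mat (Suc n) (Suc n)" by (simp add: g_def)
  have r0: "row g 0 = v" using v by (simp add: g_def)
  have rj: "row g j = unit_vec (Suc n) (idx j)" if "j < Suc n" "j \<noteq> 0" for j using that by (simp add: g_def)
  have "x = 0\<^sub>v (Suc n)" if x: "x \<in> carrier_vec (Suc n)" "g *\<^sub>v x = 0\<^sub>v (Suc n)" for x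
  proof -
    have e: "row g j \<bullet> x = 0" if "j < Suc n" for j
      using arg_cong[OF x(2), of "\<lambda>w. w $ j"] that gc by simp
    have z: "x $ k = 0" if k: "k < Suc n" "k \<noteq> i" for k
    proof -
      \<comment> \<open>The row that carries the unit vector of index \<open>k\<close>; by the
        choice of \<open>idx\<close>, index 0 sits in row \<open>i\<close>.\<close>
      define j where "j = (if k = 0 then i else k)"
      have j: "j < Suc n" "j \<noteq> 0" "idx j = k" using k i by (auto simp: j_def idx_def)
      show ?thesis using e[OF j(1)] rj[OF j(1,2)] x k j(3) by (simp add: scalar_prod_left_unit)
    qed
    have "0 = v \<bullet> x" using e[of 0] r0 by simp
    also have "\<dots> = (\<Sum>k\<in>{0..<Suc n}. v $ k * x $ k)" using x by (simp add: scalar_prod_def)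
    also have "\<dots> = (\<Sum>k\<in>{i}. v $ k * x $ k)"
      by (rule sum.mono_neutral_right) (use i z in auto)
    finally have "x $ i = 0" using i by simp
    then have "x $ k = 0" if "k < Suc n" for k using z that by (cases "k = i") simp_all
    then show ?thesis by (intro eq_vecI) (use x in simp_all)
  qed
  then show ?thesis using r0 gc GL_iff_ker[OF gc] by blast
qed

lemma uminus_zero_mat [simp]: "- 0\<^sub>m n m = (0\<^sub>m n m :: 'a::group_add mat)"
  by (rule eq_matI) auto

context unitary_field
begin

section \<open>Sesquilinear forms and vectors of nonzero length\<close>

definition conj_vec :: "'a vec \<Rightarrow> 'a vec" where
  "conj_vec v = map_vec (\<lambda>x. x ^ q) v"

definition sesq :: "'a mat \<Rightarrow> 'a vec \<Rightarrow> 'a vec \<Rightarrow> 'a" where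
  "sesq H v w = v \<bullet> (H *\<^sub>v conj_vec w)"

lemma conj_vec_dim [simp]: "dim_vec (conj_vec v) = dim_vec v"
  by (simp add: conj_vec_def)

lemma conj_vec_carrier [simp]: "conj_vec v \<in> carrier_vec n \<longleftrightarrow> v \<in> carrier_vec n"
  unfolding carrier_vec_def mem_Collect_eq conj_vec_dim ..

lemma conj_vec_add: "v \<in> carrier_vec n \<Longrightarrow> w \<in> carrier_vec n \<Longrightarrow> conj_vec (v + w) = conj_vec v + conj_vec w"
  by (rule eq_vecI) (auto simp: conj_vec_def conj_add)

lemma conj_vec_smult: "conj_vec (c \<cdot>\<^sub>v v) = c ^ q \<cdot>\<^sub>v conj_vec v"
  by (rule eq_vecI) (auto simp: conj_vec_def power_mult_distrib)

lemma sesq_smult: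
  assumes "H \<in> carrier_mat n n" "v \<in> carrier_vec n" "w \<in> carrier_vec n"
  shows "sesq H (a \<cdot>\<^sub>v v) w = a * sesq H v w" "sesq H v (a \<cdot>\<^sub>v w) = a ^ q * sesq H v w"
  using assms by (simp_all add: sesq_def conj_vec_smult mult_mat_vec[of H n n])

lemma sesq_add:
  assumes "H \<in> carrier_mat n n" "v \<in> carrier_vec n" "w \<in> carrier_vec n" "x \<in> carrier_vec n"
  shows "sesq H (v + w) x = sesq H v x + sesq H w x" "sesq H x (v + w) = sesq H x v + sesq H x w"
proof -
  have c: "H *\<^sub>v conj_vec u \<in> carrier_vec n" if "u \<in> carrier_vec n" for u
    by (rule mult_mat_vec_carrier[OF assms(1)]) (use that in simp)
  show "sesq H (v + w) x = sesq H v x + sesq H w x"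
    unfolding sesq_def by (rule add_scalar_prod_distrib[of _ n]) (use assms c in auto)
  have "H *\<^sub>v conj_vec (v + w) = H *\<^sub>v conj_vec v + H *\<^sub>v conj_vec w"
    unfolding conj_vec_add[OF assms(2,3)] by (rule mult_add_distrib_mat_vec[OF assms(1)]) (use assms in auto)
  then show "sesq H x (v + w) = sesq H x v + sesq H x w"
    unfolding sesq_def using scalar_prod_add_distrib[OF assms(4) c c] assms by simp
qed

text \<open>If all values on the diagonal vanish, polarisation makes the form alternate in sign
  under exchange of arguments. Scaling one argument by \<open>a\<close> multiplies the two terms by
  \<open>a\<close> and by \<open>a ^ q\<close>, so a scalar with \<open>a ^ q \<noteq> a\<close>
  forces the form to be zero. This avoids dividing by 2 and covers characteristic 2.\<close>

lemma exists_anisotropic: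
  assumes H: "H \<in> carrier_mat n n" and nz: "H \<noteq> 0\<^sub>m n n"
  shows "\<exists>v \<in> carrier_vec n. sesq H v v \<noteq> 0"
proof (rule ccontr)
  assume "\<not> ?thesis"
  then have z: "sesq H v v = 0" if "v \<in> carrier_vec n" for v using that by blast
  have anti: "sesq H v w + sesq H w v = 0" if "v \<in> carrier_vec n" "w \<in> carrier_vec n" for v w
    using z[of "v + w"] z[of v] z[of w] that by (simp add: sesq_add[OF H] add.commute)
  obtain a :: 'a where a: "a ^ q \<noteq> a" using exists_not_fixed by blast
  have s0: "sesq H v w = 0" if vw: "v \<in> carrier_vec n" "w \<in> carrier_vec n" for v w
  proof -
    have "a * sesq H v w + a ^ q * sesq H w v = 0"
      using anti[of "a \<cdot>\<^sub>v v" w] vw by (simp add: sesq_smult[OF H])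
    moreover have "sesq H w v = - sesq H v w" using anti[OF vw] by (simp add: eq_neg_iff_add_eq_0 add.commute)
    ultimately have "(a - a ^ q) * sesq H v w = 0" by (simp add: algebra_simps)
    then show ?thesis using a by simp
  qed
  have "H = 0\<^sub>m n n"
  proof (rule eq_matI)
    fix i j assume "i < dim_row (0\<^sub>m n n)" "j < dim_col (0\<^sub>m n n)"
    then have ij: "i < n" "j < n" by auto
    have "conj_vec (unit_vec n j) = unit_vec n j"
      by (rule eq_vecI) (auto simp: conj_vec_def unit_vec_def)
    moreover have "H *\<^sub>v unit_vec n j = col H j" by (rule eq_vecI) (use H ij in simp_all)
    ultimately have "sesq H (unit_vec n i) (unit_vec n j) = H $$ (i, j)"
      using H ij by (simp add: sesq_def scalar_prod_left_unit[of _ n] col_carrier_vec[of _ n _ n])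
    then show "H $$ (i, j) = 0\<^sub>m n n $$ (i, j)" using s0 ij by simp
  qed (use H in auto)
  then show False using nz by blast
qed

lemma row_form_entry:
  assumes "H \<in> carrier_mat n n" "g \<in> carrier_mat n n" "i < n"
  shows "(g * H * adj g) $$ (i, i) = sesq H (row g i) (row g i)"
proof -
  have "col (adj g) i = conj_vec (row g i)"
    by (rule eq_vecI) (use assms in \<open>auto simp: conj_vec_def\<close>)
  then have "col (H * adj g) i = H *\<^sub>v conj_vec (row g i)"
    using assms by (subst col_mult2[of _ n n _ n]) auto
  then show ?thesis using assms unfolding sesq_def by (subst assoc_mult_mat[of _ n n _ n _ n]) auto
qed

lemma Herm_conj: "H \<in> Herm n \<Longrightarrow> g \<in> carrier_mat n n \<Longrightarrow> g * H * adj g \<in> Herm n"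
  by (auto simp: Herm_def adj_mult mat_assoc)

lemma Skew_conj: "H \<in> Skew n \<Longrightarrow> g \<in> carrier_mat n n \<Longrightarrow> g * H * adj g \<in> Skew n"
  by (auto simp: Skew_iff adj_mult mat_assoc)

text \<open>The length of an anisotropic vector is a nonzero element of the fixed field, so its
  inverse is a norm \<open>a * a ^ q\<close>; scaling the vector by \<open>a\<close> makes its
  length 1, and the scaled vector becomes the first row of \<open>g\<close>.\<close>

lemma exists_unit_vector_conj:
  assumes H: "H \<in> Herm (Suc n)" and nz: "H \<noteq> 0\<^sub>m (Suc n) (Suc n)"
  shows "\<exists>g \<in> GL (Suc n). (g * H * adj g) $$ (0, 0) = 1"
proof -
  note Hc = Herm_carrier[OF H]
  obtain v where v: "v \<in> carrier_vec (Suc n)" "sesq H v v \<noteq> 0" using exists_anisotropic[OF Hc nz] by blast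
  have vnz: "w \<noteq> 0\<^sub>v (Suc n)" if "sesq H w w \<noteq> 0" for w
  proof
    assume "w = 0\<^sub>v (Suc n)"
    then have "sesq H w w = 0" unfolding sesq_def
      by (simp only:) (rule scalar_prod_left_zero, rule mult_mat_vec_carrier[OF Hc], simp)
    then show False using that by simp
  qed
  let ?c = "sesq H v v"
  \<comment> \<open>This first \<open>g\<close> serves only to exhibit the length of
    \<open>v\<close> as a diagonal entry of a Hermitian matrix, hence as a fixed element.\<close>
  obtain g where g: "g \<in> GL (Suc n)" "row g 0 = v" using exists_GL_first_row[OF v(1) vnz[OF v(2)]] by blast
  have H1: "g * H * adj g \<in> Herm (Suc n)" by (rule Herm_conj[OF H GL_carrier[OF g(1)]])
  have c0: "?c = (g * H * adj g) $$ (0, 0)" using row_form_entry[OF Hc GL_carrier[OF g(1)], of 0] g(2) by simp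
  have "adj (g * H * adj g) $$ (0, 0) = ((g * H * adj g) $$ (0, 0)) ^ q"
    by (rule adj_index) (use Herm_carrier[OF H1] in auto)
  then have "?c ^ q = ?c" using H1 unfolding c0 Herm_def by simp
  then have "(inverse ?c) ^ q = inverse ?c" by (simp add: power_inverse)
  then obtain a where a: "a * a ^ q = inverse ?c" using norm_surj[of "inverse ?c"] v(2) by auto
  have s: "sesq H (a \<cdot>\<^sub>v v) (a \<cdot>\<^sub>v v) = 1"
  proof -
    have "sesq H (a \<cdot>\<^sub>v v) (a \<cdot>\<^sub>v v) = (a * a ^ q) * ?c" using v(1) by (simp add: sesq_smult[OF Hc] mult.assoc)
    then show ?thesis using a v(2) by simp
  qed
  obtain g where g: "g \<in> GL (Suc n)" "row g 0 = a \<cdot>\<^sub>v v"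
    using exists_GL_first_row[of "a \<cdot>\<^sub>v v" n] vnz[of "a \<cdot>\<^sub>v v"] s
    unfolding smult_carrier_vec using v(1) by (metis zero_neq_one)
  have "(g * H * adj g) $$ (0, 0) = 1" using row_form_entry[OF Hc GL_carrier[OF g(1)], of 0] g(2) s by simp
  then show ?thesis using g(1) by blast
qed

lemma diag_one_Suc:
  "four_block_mat (1\<^sub>m 1) (0\<^sub>m 1 (r + k)) (0\<^sub>m (r + k) 1) (diag_one r k) = (diag_one (Suc r) k :: 'a mat)"
  by (rule eq_matI) (auto simp: diag_one_def)

lemma GL_four_block_lower:
  assumes "A \<in> GL r" "D \<in> GL k" "C \<in> carrier_mat k r"
  shows "four_block_mat A (0\<^sub>m r k) C D \<in> GL (r + k)"
  using assms det_four_block_mat_upper_right_zero[of A r "0\<^sub>m r k" k C D]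
  by (auto simp: GL_def)

lemma conj_GL_inverse:
  assumes "g \<in> GL n" "H \<in> carrier_mat n n" "K \<in> carrier_mat n n" "g * H * adj g = K"
  shows "\<exists>h \<in> GL n. H = h * K * adj h"
proof -
  obtain h where h: "h \<in> GL n" "g * h = 1\<^sub>m n" "h * g = 1\<^sub>m n" using GL_inverse[OF assms(1)] .
  have d: "dim_row g = n" "dim_col g = n" "dim_row h = n" "dim_col h = n" "dim_row H = n" "dim_col H = n"
    using assms(1,2) h(1) by (auto simp: GL_def)
  have "adj g * adj h = 1\<^sub>m n" using h(3) d by (metis adj_mult adj_one)
  then have "h * K * adj h = H"
    unfolding assms(4)[symmetric] using d mat_cancel[OF h(3) GL_carrier[OF h(1)] GL_carrier[OF assms(1)]]
    by (simp add: mat_assoc)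
  then show ?thesis using h(1) by blast
qed

text \<open>A vector of length 1 is split off, its orthogonal complement is handled by induction
  through the Schur complement, and the process stops when the remaining form is zero.\<close>

theorem hermitian_normal_form:
  assumes "H \<in> Herm n"
  shows "\<exists>r k g. n = r + k \<and> g \<in> GL n \<and> H = g * diag_one r k * adj g"
  using assms
proof (induction n arbitrary: H)
  case 0
  have "H = 1\<^sub>m 0 * diag_one 0 0 * adj (1\<^sub>m 0)"
    by (rule mat_0_0_eq) (use 0 in \<open>auto simp: Herm_def diag_one_def\<close>)
  then show ?case by (intro exI[of _ 0] exI[of _ "1\<^sub>m 0"]) auto
next
  case (Suc n)
  show ?case
  proof (cases "H = 0\<^sub>m (Suc n) (Suc n)")
    case True
    have "(diag_one 0 (Suc n) :: 'a mat) = 0\<^sub>m (Suc n) (Suc n)" by (rule eq_matI) (auto simp: diag_one_def)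
    then have "H = 1\<^sub>m (Suc n) * diag_one 0 (Suc n) * adj (1\<^sub>m (Suc n))" using True by simp
    then show ?thesis by (intro exI[of _ 0] exI[of _ "Suc n"] exI[of _ "1\<^sub>m (Suc n)"]) auto
  next
    case False
    obtain g1 where g1: "g1 \<in> GL (Suc n)" "(g1 * H * adj g1) $$ (0, 0) = 1"
      using exists_unit_vector_conj[OF Suc.prems False] by blast
    define H1 where "H1 = g1 * H * adj g1"
    have H1: "H1 \<in> Herm (1 + n)" unfolding H1_def using Herm_conj[OF Suc.prems GL_carrier[OF g1(1)]] by simp
    obtain A B C D where bl: "H1 = four_block_mat A B C D" "A \<in> carrier_mat 1 1" "B \<in> carrier_mat 1 n"
        "C \<in> carrier_mat n 1" "D \<in> carrier_mat n n"
      using four_block_cases[OF Herm_carrier[OF H1]] by metis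
    have H1': "B = adj C" "D \<in> Herm n" using H1 bl(1) Herm_four_block[OF bl(2-5)] by auto
    have "A $$ (0, 0) = H1 $$ (0, 0)" using bl by auto
    then have A: "A = 1\<^sub>m 1" using g1(2) bl(2) by (intro eq_matI) (auto simp: H1_def)
    \<comment> \<open>Row operations that clear the first column below the unit entry; applied on
      both sides they leave the Schur complement \<open>H2\<close> of that entry.\<close>
    define L where "L = four_block_mat (1\<^sub>m 1) (0\<^sub>m 1 n) (- C) (1\<^sub>m n)"
    have L: "L \<in> GL (1 + n)" unfolding L_def by (rule GL_four_block_lower) (use bl in auto)
    define H2 where "H2 = - (C * adj C) + D"
    have H2: "H2 \<in> Herm n" using H1'(2) bl(4) by (auto simp: H2_def Herm_def adj_add adj_mult)
    obtain r k g2 where IH: "n = r + k" "g2 \<in> GL n" "H2 = g2 * diag_one r k * adj g2"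
      using Suc.IH[OF H2] by blast
    have adjL: "adj L = four_block_mat (1\<^sub>m 1) (- adj C) (0\<^sub>m n 1) (1\<^sub>m n)"
      unfolding L_def by (subst adj_four_block[of _ 1 1 _ n _ n]) (use bl in auto)
    have "L * H1 = four_block_mat (1\<^sub>m 1) (adj C) (0\<^sub>m n 1) H2"
      unfolding L_def bl(1) A H1'(1)
      by (subst mult_four_block_mat[of _ 1 1 _ n _ n _ _ 1 _ n]) (use bl in \<open>auto simp: H2_def\<close>)
    then have e1: "L * H1 * adj L = four_block_mat (1\<^sub>m 1) (0\<^sub>m 1 n) (0\<^sub>m n 1) H2"
      unfolding adjL using bl(4) Herm_carrier[OF H2]
      by (simp add: mult_four_block_mat[of _ 1 1 _ n _ n _ _ 1 _ n])
    define G where "G = four_block_mat (1\<^sub>m 1) (0\<^sub>m 1 n) (0\<^sub>m n 1) g2"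
    have G: "G \<in> GL (1 + n)" unfolding G_def by (rule GL_four_block_lower) (use IH in auto)
    have "(diag_one (Suc r) k :: 'a mat) = four_block_mat (1\<^sub>m 1) (0\<^sub>m 1 n) (0\<^sub>m n 1) (diag_one r k)"
      unfolding IH(1) by (rule diag_one_Suc[symmetric])
    then have "G * diag_one (Suc r) k = four_block_mat (1\<^sub>m 1) (0\<^sub>m 1 n) (0\<^sub>m n 1) (g2 * diag_one r k)"
      unfolding G_def using GL_carrier[OF IH(2)] diag_one_carrier[of r k, folded IH(1)]
      by (simp only:) (subst mult_four_block_mat[of _ 1 1 _ n _ n _ _ 1 _ n], auto)
    moreover have "adj G = four_block_mat (1\<^sub>m 1) (0\<^sub>m 1 n) (0\<^sub>m n 1) (adj g2)"
      unfolding G_def by (subst adj_four_block[of _ 1 1 _ n _ n]) (use GL_carrier[OF IH(2)] in auto)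
    ultimately have e2: "G * diag_one (Suc r) k * adj G = four_block_mat (1\<^sub>m 1) (0\<^sub>m 1 n) (0\<^sub>m n 1) H2"
      unfolding IH(3) using GL_carrier[OF IH(2)] mult_carrier_mat[OF GL_carrier[OF IH(2)] diag_one_carrier[of r k, folded IH(1)]]
      by (simp only:) (subst mult_four_block_mat[of _ 1 1 _ n _ n _ _ 1 _ n], auto)
    have K: "four_block_mat (1\<^sub>m 1) (0\<^sub>m 1 n) (0\<^sub>m n 1) H2 \<in> carrier_mat (Suc n) (Suc n)"
      using Herm_carrier[OF H2] by auto
    obtain h where h: "h \<in> GL (Suc n)" "H = h * H1 * adj h"
      using conj_GL_inverse[OF g1(1) Herm_carrier[OF Suc.prems] _ H1_def[symmetric]] Herm_carrier[OF H1] by auto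
    obtain l where l: "l \<in> GL (Suc n)" "H1 = l * (G * diag_one (Suc r) k * adj G) * adj l"
      using conj_GL_inverse[OF L[unfolded plus_1_eq_Suc] Herm_carrier[OF H1, unfolded plus_1_eq_Suc] K e1]
      unfolding e2 by blast
    have d: "dim_row h = Suc n" "dim_col h = Suc n" "dim_row l = Suc n" "dim_col l = Suc n"
       "dim_row G = Suc n" "dim_col G = Suc n" "dim_row (diag_one (Suc r) k :: 'a mat) = Suc n" "dim_col (diag_one (Suc r) k :: 'a mat) = Suc n"
      using h(1) l(1) G IH(1) by (auto simp: GL_def diag_one_def)
    have "H = (h * l * G) * diag_one (Suc r) k * adj (h * l * G)"
      unfolding h(2) l(2) using d by (simp add: mat_assoc adj_mult)
    moreover have "h * l * G \<in> GL (Suc n)" using h(1) l(1) G by (intro GL_mult) auto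
    ultimately show ?thesis using IH(1) by (intro exI[of _ "Suc r"] exI[of _ k] exI[of _ "h * l * G"]) simp
  qed
qed

end

subsection \<open>Orbit counting\<close>

lemma GL_cancel_left:
  assumes "g \<in> GL n" "X \<in> carrier_mat n m" "Y \<in> carrier_mat n m" "g * X = g * Y"
  shows "X = (Y :: 'a::field mat)"
proof -
  obtain h where h: "h \<in> GL n" "g * h = 1\<^sub>m n" "h * g = 1\<^sub>m n" using GL_inverse[OF assms(1)] .
  note c = GL_carrier[OF h(1)] GL_carrier[OF assms(1)]
  have "X = h * (g * X)" by (rule mat_cancel[OF h(3) c carrier_matD(1)[OF assms(2)], symmetric])
  also have "\<dots> = Y" unfolding assms(4) by (rule mat_cancel[OF h(3) c carrier_matD(1)[OF assms(3)]])
  finally show ?thesis .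
qed

lemma det_block_lower_zero:
  assumes "A \<in> carrier_mat r r" "B \<in> carrier_mat r k" "D \<in> carrier_mat k k"
  shows "four_block_mat A B (0\<^sub>m k r) D \<in> GL (r + k) \<longleftrightarrow> A \<in> GL r \<and> (D :: 'a::field mat) \<in> GL k"
  using assms det_four_block_mat_lower_left_zero[OF assms(1,2) refl assms(3)] by (simp add: GL_def)

lemma det_block_upper_zero:
  assumes "A \<in> carrier_mat r r" "C \<in> carrier_mat k r" "D \<in> carrier_mat k k"
  shows "four_block_mat A (0\<^sub>m r k) C D \<in> GL (r + k) \<longleftrightarrow> A \<in> GL r \<and> (D :: 'a::field mat) \<in> GL k"
  using assms det_four_block_mat_upper_right_zero[OF assms(1) refl assms(2,3)] by (simp add: GL_def)

lemma zero_vec_append: "(0\<^sub>v (r + k) :: 'a::zero vec) = 0\<^sub>v r @\<^sub>v 0\<^sub>v k"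
  by (rule eq_vecI) auto

lemma GL_four_block_iff:
  assumes c: "A \<in> carrier_mat r r" "B \<in> carrier_mat r k" "C \<in> carrier_mat k r" "D \<in> carrier_mat k k"
  shows "four_block_mat A B C D \<in> GL (r + k) \<longleftrightarrow>
    (\<forall>x \<in> carrier_vec r. \<forall>y \<in> carrier_vec k. A *\<^sub>v x + B *\<^sub>v y = 0\<^sub>v r \<and> C *\<^sub>v x + D *\<^sub>v y = 0\<^sub>v k \<longrightarrow>
      x = 0\<^sub>v r \<and> y = (0\<^sub>v k :: 'a::field vec))"
proof -
  have fc: "four_block_mat A B C D \<in> carrier_mat (r + k) (r + k)" using c by simp
  have m: "four_block_mat A B C D *\<^sub>v (x @\<^sub>v y) = 0\<^sub>v (r + k) \<longleftrightarrow>
      A *\<^sub>v x + B *\<^sub>v y = 0\<^sub>v r \<and> C *\<^sub>v x + D *\<^sub>v y = 0\<^sub>v k"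
    if "x \<in> carrier_vec r" "y \<in> carrier_vec k" for x y
    unfolding four_block_mat_mult_vec[OF c that] zero_vec_append
    by (rule append_vec_eq[of _ r]) (use c that in auto)
  have z: "x @\<^sub>v y = 0\<^sub>v (r + k) \<longleftrightarrow> x = 0\<^sub>v r \<and> y = 0\<^sub>v k" if "x \<in> carrier_vec r" for x y :: "'a vec"
    unfolding zero_vec_append using that by (rule append_vec_eq) simp
  show ?thesis
    unfolding GL_iff_ker[OF fc] all_vec_append[of r k, unfolded Ball_def[symmetric]] using m z by simp
qed

text \<open>Both sides say that the same linear system in two groups of unknowns has only the
  trivial solution; only the order of unknowns and equations differs.\<close>

lemma GL_four_block_swap:
  assumes c: "A \<in> carrier_mat r r" "B \<in> carrier_mat r k" "C \<in> carrier_mat k r" "D \<in> carrier_mat k k"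
  shows "four_block_mat A B C D \<in> GL (r + k) \<longleftrightarrow> four_block_mat D C B (A :: 'a::field mat) \<in> GL (k + r)"
proof -
  have cm: "A *\<^sub>v x + B *\<^sub>v y = B *\<^sub>v y + A *\<^sub>v x" "C *\<^sub>v x + D *\<^sub>v y = D *\<^sub>v y + C *\<^sub>v x"
    if "x \<in> carrier_vec r" "y \<in> carrier_vec k" for x y
    using c that comm_add_vec[of "A *\<^sub>v x" r "B *\<^sub>v y"] comm_add_vec[of "C *\<^sub>v x" k "D *\<^sub>v y"] by simp_all
  show ?thesis unfolding GL_four_block_iff[OF c] GL_four_block_iff[OF c(4,3,2,1)]
    using cm by (smt (verit, best))
qed

lemma four_block_eqD:
  assumes "four_block_mat A B C D = four_block_mat A' B' C' D'"
    "A \<in> carrier_mat r s" "B \<in> carrier_mat r l" "C \<in> carrier_mat k s" "D \<in> carrier_mat k l"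
    "A' \<in> carrier_mat r s" "B' \<in> carrier_mat r l" "C' \<in> carrier_mat k s" "D' \<in> carrier_mat k l"
  shows "A = A'" "B = B'" "C = C'" "D = D'"
  using four_block_eq_iff[OF assms(2-9)] assms(1) by blast+

lemma zero_mult_vec: "x \<in> carrier_vec k \<Longrightarrow> 0\<^sub>m r k *\<^sub>v x = (0\<^sub>v r :: 'a::field vec)"
  by (rule eq_vecI) (simp_all add: scalar_prod_def)

lemma four_block_mult_eq_one:
  assumes "A \<in> carrier_mat r r" "B \<in> carrier_mat r k" "C \<in> carrier_mat k r" "D \<in> carrier_mat k k"
    "A' \<in> carrier_mat r r" "B' \<in> carrier_mat r k" "C' \<in> carrier_mat k r" "D' \<in> carrier_mat k k"
    "four_block_mat A B C D * four_block_mat A' B' C' D' = (1\<^sub>m (r + k) :: 'a::field mat)"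
  shows "A * A' + B * C' = 1\<^sub>m r" "A * B' + B * D' = 0\<^sub>m r k" "C * A' + D * C' = 0\<^sub>m k r" "C * B' + D * D' = 1\<^sub>m k"
proof -
  have "four_block_mat (A * A' + B * C') (A * B' + B * D') (C * A' + D * C') (C * B' + D * D') =
    four_block_mat (1\<^sub>m r) (0\<^sub>m r k) (0\<^sub>m k r) (1\<^sub>m k)"
    using assms(9) mult_four_block_mat[OF assms(1-8)] by simp
  from four_block_eqD[OF this, of r r k k] show
    "A * A' + B * C' = 1\<^sub>m r" "A * B' + B * D' = 0\<^sub>m r k" "C * A' + D * C' = 0\<^sub>m k r" "C * B' + D * D' = 1\<^sub>m k"
    using assms(1-8) by simp_all
qed

lemma mult_add_mult_vec:
  "A \<in> carrier_mat r s \<Longrightarrow> A' \<in> carrier_mat s l \<Longrightarrow> B \<in> carrier_mat r t \<Longrightarrow> B' \<in> carrier_mat t l \<Longrightarrow>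
   x \<in> carrier_vec l \<Longrightarrow> (A * A' + B * B') *\<^sub>v x = A *\<^sub>v (A' *\<^sub>v x) + B *\<^sub>v (B' *\<^sub>v (x :: 'a::field vec))"
  by (subst add_mult_distrib_mat_vec[of _ r l]) auto

text \<open>The nullity theorem for complementary blocks of inverse matrices. The lower left block
  \<open>C\<close> maps the kernel of \<open>A\<close> to that of \<open>D'\<close>, and the upper
  right block \<open>B'\<close> of the inverse maps back; the block equations of the two products
  show that these maps are inverse to each other.\<close>

lemma card_ker_inverse_block:
  assumes J: "A \<in> carrier_mat r r" "B \<in> carrier_mat r k" "C \<in> carrier_mat k r" "D \<in> carrier_mat k k"
    and H: "A' \<in> carrier_mat r r" "B' \<in> carrier_mat r k" "C' \<in> carrier_mat k r" "D' \<in> carrier_mat k k"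
    and JH: "four_block_mat A B C D * four_block_mat A' B' C' D' = (1\<^sub>m (r + k) :: 'a::field mat)"
    and HJ: "four_block_mat A' B' C' D' * four_block_mat A B C D = (1\<^sub>m (r + k) :: 'a::field mat)"
  shows "card (ker_mat A) = card (ker_mat D')"
proof -
  note 1 = four_block_mult_eq_one[OF J H JH] and 2 = four_block_mult_eq_one[OF H J HJ]
  have aux: "C' *\<^sub>v (A *\<^sub>v x) + D' *\<^sub>v (C *\<^sub>v x) = 0\<^sub>v k" "A' *\<^sub>v (A *\<^sub>v x) + B' *\<^sub>v (C *\<^sub>v x) = x"
    if "x \<in> carrier_vec r" for x
    using mult_add_mult_vec[OF H(3) J(1) H(4) J(3) that] mult_add_mult_vec[OF H(1) J(1) H(2) J(3) that] that
    unfolding 2 by (simp_all add: zero_mult_vec)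
  have aux': "A *\<^sub>v (B' *\<^sub>v y) + B *\<^sub>v (D' *\<^sub>v y) = 0\<^sub>v r" "C *\<^sub>v (B' *\<^sub>v y) + D *\<^sub>v (D' *\<^sub>v y) = y"
    if "y \<in> carrier_vec k" for y
    using mult_add_mult_vec[OF J(1) H(2) J(2) H(4) that] mult_add_mult_vec[OF J(3) H(2) J(4) H(4) that] that
    unfolding 1 by (simp_all add: zero_mult_vec)
  show ?thesis
  proof (rule card_eq_by_inverse[where f = "\<lambda>x. C *\<^sub>v x" and g = "\<lambda>y. B' *\<^sub>v y"])
    fix x assume "x \<in> ker_mat A"
    then have x: "x \<in> carrier_vec r" "A *\<^sub>v x = 0\<^sub>v r" unfolding in_ker_mat[OF J(1)] by blast+
    have cx: "C *\<^sub>v x \<in> carrier_vec k" "D' *\<^sub>v (C *\<^sub>v x) \<in> carrier_vec k" "B' *\<^sub>v (C *\<^sub>v x) \<in> carrier_vec r"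
      using J H x by auto
    have "D' *\<^sub>v (C *\<^sub>v x) = 0\<^sub>v k" "B' *\<^sub>v (C *\<^sub>v x) = x"
      using aux[OF x(1)] cx(2,3) unfolding x(2) mult_zero_vec'[OF H(3)] mult_zero_vec'[OF H(1)] by simp_all
    then show "C *\<^sub>v x \<in> ker_mat D' \<and> B' *\<^sub>v (C *\<^sub>v x) = x" unfolding in_ker_mat[OF H(4)] using cx by blast
  next
    fix y assume "y \<in> ker_mat D'"
    then have y: "y \<in> carrier_vec k" "D' *\<^sub>v y = 0\<^sub>v k" unfolding in_ker_mat[OF H(4)] by blast+
    have cy: "B' *\<^sub>v y \<in> carrier_vec r" "A *\<^sub>v (B' *\<^sub>v y) \<in> carrier_vec r" "C *\<^sub>v (B' *\<^sub>v y) \<in> carrier_vec k"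
      using J H y by auto
    have "A *\<^sub>v (B' *\<^sub>v y) = 0\<^sub>v r" "C *\<^sub>v (B' *\<^sub>v y) = y"
      using aux'[OF y(1)] cy(2,3) unfolding y(2) mult_zero_vec'[OF J(2)] mult_zero_vec'[OF J(4)] by simp_all
    then show "B' *\<^sub>v y \<in> ker_mat A \<and> C *\<^sub>v (B' *\<^sub>v y) = y" unfolding in_ker_mat[OF J(1)] using cy by blast
  qed
qed

text \<open>The matrices are sorted by their first row. Right multiplication moves any nonzero first
  row to the first unit vector, and the matrices with that row are block triangular with a free
  column and an invertible block of size \<open>n\<close>.\<close>

lemma card_GL_Suc:
  "card (GL (Suc n) :: 'a::{finite,field} mat set) =
    (card (UNIV :: 'a set) ^ Suc n - 1) * (card (UNIV :: 'a set) ^ n * card (GL n :: 'a mat set))"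
proof -
  let ?Q = "card (UNIV :: 'a set)"
  let ?V = "carrier_vec (Suc n) - {0\<^sub>v (Suc n)} :: 'a vec set"
  let ?F = "{g \<in> GL (Suc n). row g 0 = unit_vec (Suc n) 0} :: 'a mat set"
  have F: "card ?F = ?Q ^ n * card (GL n :: 'a mat set)"
  proof -
    have "bij_betw (\<lambda>(c, d). four_block_mat (1\<^sub>m 1) (0\<^sub>m 1 n) c d) (carrier_mat n 1 \<times> GL n) ?F"
    proof (rule bij_betw_imageI)
      show "inj_on (\<lambda>(c, d). four_block_mat (1\<^sub>m 1) (0\<^sub>m 1 n) c d) (carrier_mat n 1 \<times> GL n :: ('a mat \<times> 'a mat) set)"
      proof (rule inj_onI, clarify)
        fix c d c' d' :: "'a mat"
        assume *: "c \<in> carrier_mat n 1" "d \<in> GL n" "c' \<in> carrier_mat n 1" "d' \<in> GL n"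
          "four_block_mat (1\<^sub>m 1) (0\<^sub>m 1 n) c d = four_block_mat (1\<^sub>m 1) (0\<^sub>m 1 n) c' d'"
        show "c = c' \<and> d = d'"
          using four_block_eqD(3,4)[OF *(5) one_carrier_mat zero_carrier_mat *(1) GL_carrier[OF *(2)]
            one_carrier_mat zero_carrier_mat *(3) GL_carrier[OF *(4)]] by blast
      qed
      show "(\<lambda>(c, d). four_block_mat (1\<^sub>m 1) (0\<^sub>m 1 n) c d) ` (carrier_mat n 1 \<times> GL n) = ?F"
      proof (intro equalityI subsetI)
        fix g assume "g \<in> (\<lambda>(c, d). four_block_mat (1\<^sub>m 1) (0\<^sub>m 1 n) c d) ` (carrier_mat n 1 \<times> GL n :: ('a mat \<times> 'a mat) set)"
        then obtain c d where g: "g = four_block_mat (1\<^sub>m 1) (0\<^sub>m 1 n) c d" "c \<in> carrier_mat n 1" "d \<in> GL n" by auto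
        have "g \<in> GL (1 + n)" unfolding g(1) using det_block_upper_zero[of "1\<^sub>m 1" 1 c n d] g GL_carrier[OF g(3)] by simp
        moreover have "row g 0 = unit_vec (Suc n) 0"
          unfolding g(1) using g(2) GL_carrier[OF g(3)] by (intro eq_vecI) (auto simp: unit_vec_def)
        ultimately show "g \<in> ?F" by simp
      next
        fix g assume "g \<in> ?F"
        then have g: "g \<in> GL (1 + n)" "row g 0 = unit_vec (Suc n) 0" by auto
        obtain A B C D where bl: "g = four_block_mat A B C D" "A \<in> carrier_mat 1 1" "B \<in> carrier_mat 1 n"
          "C \<in> carrier_mat n 1" "D \<in> carrier_mat n n" using four_block_cases[OF GL_carrier[OF g(1)]] by metis
        have e: "row g 0 $ j = unit_vec (Suc n) 0 $ j" for j using g(2) by simp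
        have A: "A = 1\<^sub>m 1" using e[of 0] bl by (intro eq_matI) auto
        have B: "B = 0\<^sub>m 1 n"
        proof (rule eq_matI)
          fix i j assume "i < dim_row (0\<^sub>m 1 n)" "j < dim_col (0\<^sub>m 1 n)"
          then show "B $$ (i, j) = 0\<^sub>m 1 n $$ (i, j)" using e[of "Suc j"] bl by auto
        qed (use bl in auto)
        have "D \<in> GL n" using g(1) det_block_upper_zero[of "1\<^sub>m 1" 1 C n D] bl unfolding bl(1) A B by simp
        then show "g \<in> (\<lambda>(c, d). four_block_mat (1\<^sub>m 1) (0\<^sub>m 1 n) c d) ` (carrier_mat n 1 \<times> GL n)"
          unfolding bl(1) A B by (intro image_eqI[of _ _ "(C, D)"]) (use bl in auto)
      qed
    qed
    from bij_betw_same_card[OF this] show ?thesis by (simp add: card_cartesian_product card_carrier_mat)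
  qed
  have fib: "card {g \<in> GL (Suc n). row g 0 = v} = card ?F" if v: "v \<in> ?V" for v
  proof -
    obtain g0 where g0: "g0 \<in> GL (Suc n)" "row g0 0 = v" using exists_GL_first_row[of v n] v by blast
    obtain h where h: "h \<in> GL (Suc n)" "g0 * h = 1\<^sub>m (Suc n)" "h * g0 = 1\<^sub>m (Suc n)" using GL_inverse[OF g0(1)] .
    note c = GL_carrier[OF g0(1)] GL_carrier[OF h(1)]
    have row_cong: "row (a * x) 0 = row (b * x) 0" if "row a 0 = row b 0" "x \<in> GL (Suc n)"
      "a \<in> GL (Suc n)" "b \<in> GL (Suc n)" for a b x :: "'a mat"
      using that(1) GL_carrier[OF that(2)] GL_carrier[OF that(3)] GL_carrier[OF that(4)]
      by (intro eq_vecI) auto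
    have assoc: "(g * a) * b = g" if "g \<in> GL (Suc n)" "a * b = 1\<^sub>m (Suc n)" "a \<in> GL (Suc n)" "b \<in> GL (Suc n)" for g a b :: "'a mat"
      using that(2) GL_carrier[OF that(1)] GL_carrier[OF that(3)] GL_carrier[OF that(4)]
      by (subst mat_assoc) auto
    show ?thesis
    proof (rule card_eq_by_inverse[where f = "\<lambda>g. g * h" and g = "\<lambda>g. g * g0"])
      fix g assume "g \<in> {g \<in> GL (Suc n). row g 0 = v}"
      then have g: "g \<in> GL (Suc n)" "row g 0 = row g0 0" using g0(2) by auto
      have "row (g * h) 0 = unit_vec (Suc n) 0" using row_cong[OF g(2) h(1) g(1) g0(1)] h(2) by simp
      then show "g * h \<in> ?F \<and> (g * h) * g0 = g" using GL_mult[OF g(1) h(1)] assoc[OF g(1) h(3,1) g0(1)] by simp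
    next
      fix g assume "g \<in> ?F"
      then have g: "g \<in> GL (Suc n)" "row g 0 = row (1\<^sub>m (Suc n)) 0" by auto
      have "row (g * g0) 0 = v" using row_cong[OF g(2) g0(1) g(1) GL_one] g0(2) c(1) by (simp add: left_mult_one_mat'[of g0 "Suc n"])
      then show "g * g0 \<in> {g \<in> GL (Suc n). row g 0 = v} \<and> (g * g0) * h = g"
        using GL_mult[OF g(1) g0(1)] assoc[OF g(1) h(2) g0(1) h(1)] by simp
    qed
  qed
  have "card (GL (Suc n) :: 'a mat set) = (\<Sum>v\<in>?V. card ?F)"
  proof (rule card_by_fibres[where f = "\<lambda>g. row g 0"])
    fix g :: "'a mat" assume g: "g \<in> GL (Suc n)"
    note c = GL_carrier[OF g]
    have "row g 0 \<noteq> 0\<^sub>v (Suc n)"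
    proof
      assume z: "row g 0 = 0\<^sub>v (Suc n)"
      obtain h where h: "h \<in> GL (Suc n)" "g * h = 1\<^sub>m (Suc n)" "h * g = 1\<^sub>m (Suc n)" using GL_inverse[OF g] .
      have "(g * h) $$ (0, 0) = row g 0 \<bullet> col h 0" using c GL_carrier[OF h(1)] by (intro index_mult_mat(1)) auto
      also have "\<dots> = 0" unfolding z using col_carrier_vec[OF _ GL_carrier[OF h(1)], of 0] by (intro scalar_prod_left_zero) simp
      finally show False unfolding h(2) by simp
    qed
    then show "row g 0 \<in> ?V" using row_carrier_vec[OF _ c, of 0] by simp
  next
    show "card {g \<in> GL (Suc n). row g 0 = v} = card ?F" if "v \<in> ?V" for v by (rule fib[OF that])
  qed simp_all
  also have "\<dots> = card ?V * card ?F" by simp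
  also have "card ?V = ?Q ^ Suc n - 1" by (simp add: card_carrier_vec)
  finally show ?thesis unfolding F .
qed

context unitary_field
begin

section \<open>Orbits and stabilisers of Hermitian forms\<close>

lemma GU_iff: "(U :: 'a mat) \<in> GU n q \<longleftrightarrow> U \<in> carrier_mat n n \<and> U * adj U = 1\<^sub>m n"
  by (simp add: GU_def adj_def)

lemma GU_GL: "(U :: 'a mat) \<in> GU n q \<Longrightarrow> U \<in> GL n"
  unfolding GU_iff using GL_if_inverse[of U n "adj U"] by auto

definition Herm_rank :: "nat \<Rightarrow> nat \<Rightarrow> 'a mat set" where
  "Herm_rank r k = {H \<in> Herm (r + k). card (ker_mat H) = (q ^ 2) ^ k}"

lemma card_ker_diag_one': "card (ker_mat (diag_one r k :: 'a mat)) = (q ^ 2) ^ k"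
  by (simp add: card_ker_diag_one card_UNIV)

lemma card_ker_conj_adj:
  "g \<in> GL n \<Longrightarrow> A \<in> carrier_mat n n \<Longrightarrow> card (ker_mat (g * A * adj g)) = card (ker_mat A)"
  by (rule card_ker_conj[OF _ adj_GL])

lemma q2_power_inject: "(q ^ 2) ^ m = (q ^ 2) ^ n \<longleftrightarrow> m = n"
  using one_less_power[OF q_gt_1, of 2] power_inject_exp[of "q ^ 2" m n] by simp

lemma Herm_cases_rank:
  assumes "H \<in> Herm n"
  obtains r k g where "n = r + k" "g \<in> GL n" "H = g * diag_one r k * adj g" "card (ker_mat H) = (q ^ 2) ^ k"
proof -
  obtain r k g where *: "n = r + k" "g \<in> GL n" "H = g * diag_one r k * adj g"
    using hermitian_normal_form[OF assms] by blast
  have "card (ker_mat H) = (q ^ 2) ^ k"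
    unfolding *(3) using card_ker_conj_adj[OF *(2), of "diag_one r k"] *(1) card_ker_diag_one' by simp
  then show ?thesis using that * by blast
qed

text \<open>The number of kernel vectors determines \<open>k\<close>, hence the whole normal form,
  so the Hermitian matrices of a given rank form a single orbit under congruence.\<close>

lemma Herm_rankE:
  assumes "H \<in> Herm_rank r k"
  obtains g where "g \<in> GL (r + k)" "H = g * diag_one r k * adj g"
proof -
  have H: "H \<in> Herm (r + k)" "card (ker_mat H) = (q ^ 2) ^ k" using assms by (auto simp: Herm_rank_def)
  obtain r' k' g where *: "r + k = r' + k'" "g \<in> GL (r + k)" "H = g * diag_one r' k' * adj g" "card (ker_mat H) = (q ^ 2) ^ k'"
    using Herm_cases_rank[OF H(1)] by metis
  then have "k' = k" using H(2) q2_power_inject by simp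
  then show ?thesis using that * by simp
qed

lemma diag_one_Herm [simp]: "diag_one r k \<in> Herm (r + k)"
  by (simp add: Herm_def)

lemma conj_diag_one_Herm_rank: "g \<in> GL (r + k) \<Longrightarrow> g * diag_one r k * adj g \<in> Herm_rank r k"
  unfolding Herm_rank_def
  using Herm_conj[OF diag_one_Herm GL_carrier] card_ker_conj_adj[OF _ diag_one_carrier] card_ker_diag_one' by auto

lemma finite_Herm_rank [simp]: "finite (Herm_rank r k)"
  by (rule finite_subset[OF _ finite_Herm[of "r + k"]]) (auto simp: Herm_rank_def)

text \<open>Only the first block column of \<open>s\<close> enters the product. Its upper block has
  to be unitary, hence invertible, which forces the lower block to vanish; the second block column
  is restricted only by invertibility.\<close>

lemma diag_one_stabiliser:
  assumes s: "s \<in> carrier_mat (r + k) (r + k)"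
  shows "s \<in> GL (r + k) \<and> s * diag_one r k * adj s = diag_one r k \<longleftrightarrow>
    (\<exists>U b d. U \<in> GU r q \<and> b \<in> carrier_mat r k \<and> d \<in> GL k \<and> s = four_block_mat U b (0\<^sub>m k r) d)"
proof -
  have key: "four_block_mat A B C D * diag_one r k * adj (four_block_mat A B C D) =
      four_block_mat (A * adj A) (A * adj C) (C * adj A) (C * adj C)"
    if c: "A \<in> carrier_mat r r" "B \<in> carrier_mat r k" "C \<in> carrier_mat k r" "D \<in> carrier_mat k k" for A B C D
  proof -
    have "four_block_mat A B C D * diag_one r k = four_block_mat A (0\<^sub>m r k) C (0\<^sub>m k k)"
      unfolding diag_one_def by (subst mult_four_block_mat[of _ r r _ k _ k _ _ r _ k]) (use c in auto)
    then show ?thesis unfolding adj_four_block[OF c]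
      by (simp only:) (subst mult_four_block_mat[of _ r r _ k _ k _ _ r _ k], use c in auto)
  qed
  show ?thesis
  proof
    assume s': "s \<in> GL (r + k) \<and> s * diag_one r k * adj s = diag_one r k"
    obtain A B C D where bl: "s = four_block_mat A B C D" "A \<in> carrier_mat r r" "B \<in> carrier_mat r k"
      "C \<in> carrier_mat k r" "D \<in> carrier_mat k k" using four_block_cases[OF s] by metis
    have "four_block_mat (A * adj A) (A * adj C) (C * adj A) (C * adj C) = diag_one r k"
      using s' key[OF bl(2-5)] unfolding bl(1) by simp
    from this[unfolded diag_one_def] have e: "A * adj A = 1\<^sub>m r" "A * adj C = 0\<^sub>m r k"
      using four_block_eqD(1,2)[of "A * adj A" "A * adj C" "C * adj A" "C * adj C" "1\<^sub>m r" "0\<^sub>m r k" "0\<^sub>m k r" "0\<^sub>m k k" r r k k] bl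
      by simp_all
    have A: "A \<in> GU r q" using bl e by (simp add: GU_iff)
    have "adj C = 0\<^sub>m r k"
      by (rule GL_cancel_left[OF GU_GL[OF A], of _ k]) (use bl e in auto)
    then have C: "C = 0\<^sub>m k r" by (simp add: adj_eq_iff)
    have "D \<in> GL k" using s' det_block_lower_zero[OF bl(2,3,5)] unfolding bl(1) C by blast
    then show "\<exists>U b d. U \<in> GU r q \<and> b \<in> carrier_mat r k \<and> d \<in> GL k \<and> s = four_block_mat U b (0\<^sub>m k r) d"
      using A bl(3) bl(1) C by blast
  next
    assume "\<exists>U b d. U \<in> GU r q \<and> b \<in> carrier_mat r k \<and> d \<in> GL k \<and> s = four_block_mat U b (0\<^sub>m k r) d"
    then obtain U b d where *: "U \<in> GU r q" "b \<in> carrier_mat r k" "d \<in> GL k" "s = four_block_mat U b (0\<^sub>m k r) d" by blast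
    have c: "U \<in> carrier_mat r r" "U * adj U = 1\<^sub>m r" using *(1) by (auto simp: GU_iff)
    have "s * diag_one r k * adj s = diag_one r k"
      unfolding *(4) key[OF c(1) *(2) zero_carrier_mat GL_carrier[OF *(3)]] using c by (simp add: diag_one_def)
    then show "s \<in> GL (r + k) \<and> s * diag_one r k * adj s = diag_one r k"
      unfolding *(4) using det_block_lower_zero[OF c(1) *(2) GL_carrier[OF *(3)]] GU_GL[OF *(1)] *(3) by blast
  qed
qed

text \<open>Orbit and stabiliser: every fibre of the map from \<open>g\<close> to
  \<open>g * diag_one r k * adj g\<close> is a translate of the stabiliser.\<close>

lemma card_GL_rank:
  "card (GL (r + k) :: 'a mat set) = card (Herm_rank r k) * (card (GU r q :: 'a mat set) * (q ^ 2) ^ (r * k) * card (GL k :: 'a mat set))"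
proof -
  let ?n = "r + k" and ?D = "diag_one r k :: 'a mat"
  let ?S = "{s \<in> GL ?n. s * ?D * adj s = ?D}"
  have "bij_betw (\<lambda>(U, b, d). four_block_mat U b (0\<^sub>m k r) d) (GU r q \<times> carrier_mat r k \<times> GL k) ?S"
  proof (rule bij_betw_imageI)
    show "inj_on (\<lambda>(U, b, d). four_block_mat U b (0\<^sub>m k r) d) (GU r q \<times> carrier_mat r k \<times> GL k :: ('a mat \<times> 'a mat \<times> 'a mat) set)"
    proof (rule inj_onI)
      fix x y :: "'a mat \<times> 'a mat \<times> 'a mat"
      assume xy: "x \<in> GU r q \<times> carrier_mat r k \<times> GL k" "y \<in> GU r q \<times> carrier_mat r k \<times> GL k"
        "(\<lambda>(U, b, d). four_block_mat U b (0\<^sub>m k r) d) x = (\<lambda>(U, b, d). four_block_mat U b (0\<^sub>m k r) d) y"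
      obtain U b d where x: "x = (U, b, d)" by (cases x)
      obtain U' b' d' where y: "y = (U', b', d')" by (cases y)
      have *: "U \<in> GU r q" "b \<in> carrier_mat r k" "d \<in> GL k" "U' \<in> GU r q" "b' \<in> carrier_mat r k" "d' \<in> GL k"
        "four_block_mat U b (0\<^sub>m k r) d = four_block_mat U' b' (0\<^sub>m k r) d'" using xy unfolding x y by auto
      show "x = y" unfolding x y
        using four_block_eqD[OF *(7) GL_carrier[OF GU_GL[OF *(1)]] *(2) zero_carrier_mat GL_carrier[OF *(3)]
           GL_carrier[OF GU_GL[OF *(4)]] *(5) zero_carrier_mat GL_carrier[OF *(6)]] by blast
    qed
    show "(\<lambda>(U, b, d). four_block_mat U b (0\<^sub>m k r) d) ` (GU r q \<times> carrier_mat r k \<times> GL k) = ?S"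
    proof (intro equalityI subsetI)
      fix s :: "'a mat" assume "s \<in> (\<lambda>(U, b, d). four_block_mat U b (0\<^sub>m k r) d) ` (GU r q \<times> carrier_mat r k \<times> GL k)"
      then obtain U b d where *: "U \<in> GU r q" "b \<in> carrier_mat r k" "d \<in> GL k" "s = four_block_mat U b (0\<^sub>m k r) d" by auto
      have "s \<in> carrier_mat ?n ?n" unfolding *(4) using GL_carrier[OF GU_GL[OF *(1)]] GL_carrier[OF *(3)] by simp
      then show "s \<in> ?S" using diag_one_stabiliser[of s r k] * by blast
    next
      fix s :: "'a mat" assume s: "s \<in> ?S"
      then obtain U b d where "U \<in> GU r q" "b \<in> carrier_mat r k" "d \<in> GL k" "s = four_block_mat U b (0\<^sub>m k r) d"
        using diag_one_stabiliser[of s r k] GL_carrier[of s ?n] by blast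
      then show "s \<in> (\<lambda>(U, b, d). four_block_mat U b (0\<^sub>m k r) d) ` (GU r q \<times> carrier_mat r k \<times> GL k)"
        by (intro image_eqI[of _ _ "(U, b, d)"]) auto
    qed
  qed
  from bij_betw_same_card[OF this]
  have S: "card ?S = card (GU r q :: 'a mat set) * (q ^ 2) ^ (r * k) * card (GL k :: 'a mat set)"
    by (simp add: card_cartesian_product card_carrier_mat card_UNIV)
  have fib: "card {g \<in> GL ?n. g * ?D * adj g = H} = card ?S" if H: "H \<in> Herm_rank r k" for H
  proof -
    obtain g0 where g0: "g0 \<in> GL ?n" "H = g0 * ?D * adj g0" using Herm_rankE[OF H] .
    obtain h where h: "h \<in> GL ?n" "g0 * h = 1\<^sub>m ?n" "h * g0 = 1\<^sub>m ?n" using GL_inverse[OF g0(1)] .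
    note c = GL_carrier[OF g0(1)] GL_carrier[OF h(1)]
    have conj: "(x * g) * ?D * adj (x * g) = x * (g * ?D * adj g) * adj x" if "x \<in> GL ?n" "g \<in> GL ?n" for x g
      using GL_carrier[OF that(1)] GL_carrier[OF that(2)] diag_one_carrier[of r k] by (simp add: adj_mult mat_assoc)
    have "adj g0 * adj h = 1\<^sub>m ?n" using h(3) c by (metis adj_mult adj_one carrier_matD)
    then have hH: "h * H * adj h = ?D"
      unfolding g0(2) using c diag_one_carrier[of r k] mat_cancel[OF h(3) c(2,1)] by (simp add: mat_assoc)
    show ?thesis
    proof (rule card_eq_by_inverse[where f = "\<lambda>g. h * g" and g = "\<lambda>g. g0 * g"])
      fix g assume "g \<in> {g \<in> GL ?n. g * ?D * adj g = H}"
      then have g: "g \<in> GL ?n" "g * ?D * adj g = H" by auto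
      then show "h * g \<in> ?S \<and> g0 * (h * g) = g"
        using conj[OF h(1) g(1)] hH GL_mult[OF h(1) g(1)] mat_cancel[OF h(2) c, of g] GL_carrier[OF g(1)] by auto
    next
      fix g assume "g \<in> ?S"
      then have g: "g \<in> GL ?n" "g * ?D * adj g = ?D" by auto
      then show "g0 * g \<in> {g \<in> GL ?n. g * ?D * adj g = H} \<and> h * (g0 * g) = g"
        using conj[OF g0(1) g(1)] g0(2) GL_mult[OF g0(1) g(1)] mat_cancel[OF h(3) c(2,1), of g] GL_carrier[OF g(1)] by auto
    qed
  qed
  have "card (GL ?n :: 'a mat set) = (\<Sum>H\<in>Herm_rank r k. card ?S)"
    by (rule card_by_fibres[where f = "\<lambda>g. g * ?D * adj g"]) (simp_all add: conj_diag_one_Herm_rank fib)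
  then show ?thesis using S by simp
qed

end

subsection \<open>Completions of a degenerate Hermitian form\<close>

lemma append_rows_cases:
  assumes "v \<in> carrier_mat (r + k) n"
  obtains a b where "v = a @\<^sub>r b" "a \<in> carrier_mat r n" "b \<in> carrier_mat k (n :: nat)"
proof -
  have "v \<in> carrier_mat (r + k) (n + 0)" using assms by simp
  then obtain A B C D where bl: "v = four_block_mat A B C D" "A \<in> carrier_mat r n" "B \<in> carrier_mat r 0"
    "C \<in> carrier_mat k n" "D \<in> carrier_mat k 0" by (rule four_block_cases)
  have "B = 0\<^sub>m r 0" "D = 0\<^sub>m k 0" using bl by (auto intro!: eq_matI)
  then have "v = A @\<^sub>r C" using bl by (simp add: append_rows_def)
  then show ?thesis using that bl by blast
qed

lemma append_rows_eqD:
  assumes "a @\<^sub>r b = a' @\<^sub>r b'" "a \<in> carrier_mat r n" "b \<in> carrier_mat k n" "a' \<in> carrier_mat r n" "b' \<in> carrier_mat k n"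
  shows "a = a'" "b = b'"
  using four_block_eqD(1,3)[of a "0\<^sub>m r 0" b "0\<^sub>m k 0" a' "0\<^sub>m r 0" b' "0\<^sub>m k 0" r n 0 k] assms
  by (simp_all add: append_rows_def)

context unitary_field
begin

lemma adj_append_rows_mult:
  assumes "a \<in> carrier_mat r n" "b \<in> carrier_mat k n" "x \<in> carrier_vec r" "y \<in> carrier_vec k"
  shows "adj (a @\<^sub>r b) *\<^sub>v (x @\<^sub>v y) = adj a *\<^sub>v x + adj b *\<^sub>v y"
proof -
  have "adj (a @\<^sub>r b) = four_block_mat (adj a) (adj b) (0\<^sub>m 0 r) (0\<^sub>m 0 k)"
    unfolding append_rows_def using assms by (subst adj_four_block[of _ r n _ 0 _ k]) auto
  then have "adj (a @\<^sub>r b) *\<^sub>v (x @\<^sub>v y) = (adj a *\<^sub>v x + adj b *\<^sub>v y) @\<^sub>v (0\<^sub>m 0 r *\<^sub>v x + 0\<^sub>m 0 k *\<^sub>v y)"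
    using assms by (simp add: four_block_mat_mult_vec[of _ n r _ k _ 0])
  also have "\<dots> = adj a *\<^sub>v x + adj b *\<^sub>v y" by (rule eq_vecI) auto
  finally show ?thesis .
qed

text \<open>\<open>J1\<close> is the block that the smaller pair prescribes; \<open>(v, d)\<close>
  supplies the rest of a nondegenerate Hermitian form with \<open>k\<close> further
  coordinates.\<close>

definition completions :: "nat \<Rightarrow> 'a mat \<Rightarrow> ('a mat \<times> 'a mat) set" where
  "completions k J1 = {(v, d). v \<in> carrier_mat (dim_row J1) k \<and> d \<in> Herm k \<and>
     four_block_mat J1 v (adj v) d \<in> GL (dim_row J1 + k)}"

lemma in_completions:
  "J1 \<in> carrier_mat r r \<Longrightarrow> (v, d) \<in> completions k J1 \<longleftrightarrow>
    v \<in> carrier_mat r k \<and> d \<in> Herm k \<and> four_block_mat J1 v (adj v) d \<in> GL (r + k)"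
  by (simp add: completions_def)

lemma finite_completions [simp]: "finite (completions k J1)"
  by (rule finite_subset[of _ "carrier_mat (dim_row J1) k \<times> carrier_mat k k"])
    (auto simp: completions_def Herm_def)

text \<open>The completed form is transformed by the block diagonal matrix with blocks
  \<open>g\<close> and the identity, which leaves the corner \<open>d\<close> alone.\<close>

lemma completions_conj:
  assumes g: "g \<in> GL r" and J: "J1 \<in> carrier_mat r r" and vd: "(v, d) \<in> completions k J1"
  shows "(g * v, d) \<in> completions k (g * J1 * adj g)"
proof -
  note gc = GL_carrier[OF g]
  have v: "v \<in> carrier_mat r k" and d: "d \<in> Herm k" and J2: "four_block_mat J1 v (adj v) d \<in> GL (r + k)"
    using vd in_completions[OF J] by auto
  note dc = Herm_carrier[OF d]
  let ?G = "four_block_mat g (0\<^sub>m r k) (0\<^sub>m k r) (1\<^sub>m k)"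
  have G: "?G \<in> GL (r + k)" by (rule GL_four_block_lower) (use g in auto)
  have "?G * four_block_mat J1 v (adj v) d = four_block_mat (g * J1) (g * v) (adj v) d"
    by (subst mult_four_block_mat[of _ r r _ k _ k _ _ r _ k]) (use gc J v dc in auto)
  moreover have "adj ?G = four_block_mat (adj g) (0\<^sub>m r k) (0\<^sub>m k r) (1\<^sub>m k)"
    by (subst adj_four_block[of _ r r _ k _ k]) (use gc in auto)
  moreover have "four_block_mat (g * J1) (g * v) (adj v) d * four_block_mat (adj g) (0\<^sub>m r k) (0\<^sub>m k r) (1\<^sub>m k) =
      four_block_mat (g * J1 * adj g) (g * v) (adj (g * v)) d"
    by (subst mult_four_block_mat[of _ r r _ k _ k _ _ r _ k]) (use gc J v dc in \<open>auto simp: adj_mult\<close>)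
  ultimately have "four_block_mat (g * J1 * adj g) (g * v) (adj (g * v)) d = ?G * four_block_mat J1 v (adj v) d * adj ?G"
    by simp
  then have "four_block_mat (g * J1 * adj g) (g * v) (adj (g * v)) d \<in> GL (r + k)"
    using GL_mult[OF GL_mult[OF G J2] adj_GL[OF G]] by simp
  then show ?thesis
    using gc J v d by (subst in_completions[of _ r]) auto
qed

lemma card_completions_conj:
  assumes g: "g \<in> GL r" and J: "J1 \<in> carrier_mat r r"
  shows "card (completions k (g * J1 * adj g)) = card (completions k J1)"
proof -
  obtain h where h: "h \<in> GL r" "g * h = 1\<^sub>m r" "h * g = 1\<^sub>m r" using GL_inverse[OF g] .
  note c = GL_carrier[OF g] GL_carrier[OF h(1)]
  have "adj g * adj h = 1\<^sub>m r" using h(3) c by (metis adj_mult adj_one carrier_matD)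
  then have hJ: "h * (g * J1 * adj g) * adj h = J1"
    using c J mat_cancel[OF h(3) c(2,1)] by (simp add: mat_assoc)
  show ?thesis
  proof (rule card_eq_by_inverse[where f = "\<lambda>(v, d). (h * v, d)" and g = "\<lambda>(v, d). (g * v, d)"])
    fix x assume x: "x \<in> completions k (g * J1 * adj g)"
    obtain v d where xv: "x = (v, d)" by (cases x)
    have gJ: "g * J1 * adj g \<in> carrier_mat r r" using c J by auto
    have "(h * v, d) \<in> completions k J1" using completions_conj[OF h(1) gJ x[unfolded xv]] unfolding hJ .
    moreover have "g * (h * v) = v" using x in_completions[OF gJ] unfolding xv by (intro mat_cancel[OF h(2) c]) auto
    ultimately show "(\<lambda>(v, d). (h * v, d)) x \<in> completions k J1 \<and> (\<lambda>(v, d). (g * v, d)) ((\<lambda>(v, d). (h * v, d)) x) = x"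
      unfolding xv by simp
  next
    fix x assume x: "x \<in> completions k J1"
    obtain v d where xv: "x = (v, d)" by (cases x)
    have "(g * v, d) \<in> completions k (g * J1 * adj g)" using completions_conj[OF g J x[unfolded xv]] .
    moreover have "h * (g * v) = v" using x in_completions[OF J] unfolding xv by (intro mat_cancel[OF h(3) c(2,1)]) auto
    ultimately show "(\<lambda>(v, d). (g * v, d)) x \<in> completions k (g * J1 * adj g) \<and> (\<lambda>(v, d). (h * v, d)) ((\<lambda>(v, d). (g * v, d)) x) = x"
      unfolding xv by simp
  qed
qed

text \<open>Schur complement of the identity block.\<close>

lemma completion_diag_one_iff:
  assumes a: "a \<in> carrier_mat r k" and b: "b \<in> carrier_mat c k" and d: "d \<in> carrier_mat k k"
  shows "four_block_mat (diag_one r c) (a @\<^sub>r b) (adj (a @\<^sub>r b)) d \<in> GL (r + c + k) \<longleftrightarrow>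
    four_block_mat (0\<^sub>m c c) b (adj b) (- (adj a * a) + d) \<in> GL (c + k)"
proof -
  have ab: "a @\<^sub>r b \<in> carrier_mat (r + c) k" using a b by simp
  have 0: "- (adj a * a) + d \<in> carrier_mat k k" using a d by simp
  have D: "diag_one r c *\<^sub>v (x @\<^sub>v y) = x @\<^sub>v 0\<^sub>v c" if "x \<in> carrier_vec r" "y \<in> carrier_vec c" for x y :: "'a vec"
    unfolding diag_one_def using that by (subst four_block_mat_mult_vec[of _ r r _ c _ c]) auto
  have top: "diag_one r c *\<^sub>v (x @\<^sub>v y) + (a @\<^sub>r b) *\<^sub>v z = 0\<^sub>v (r + c) \<longleftrightarrow> x + a *\<^sub>v z = 0\<^sub>v r \<and> b *\<^sub>v z = 0\<^sub>v c"
    if "x \<in> carrier_vec r" "y \<in> carrier_vec c" "z \<in> carrier_vec k" for x y z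
  proof -
    have "diag_one r c *\<^sub>v (x @\<^sub>v y) + (a @\<^sub>r b) *\<^sub>v z = (x + a *\<^sub>v z) @\<^sub>v (b *\<^sub>v z)"
      unfolding D[OF that(1,2)] mat_mult_append[OF a b that(3)]
      using that a b by (subst append_vec_add[of _ r _ _ c]) auto
    then show ?thesis unfolding zero_vec_append using that a by (simp add: append_vec_eq[of _ r])
  qed
  have xeq: "x + a *\<^sub>v z = 0\<^sub>v r \<longleftrightarrow> x = - (a *\<^sub>v z)" if "x \<in> carrier_vec r" "z \<in> carrier_vec k" for x z
  proof
    have az: "a *\<^sub>v z \<in> carrier_vec r" using a that by simp
    assume e: "x + a *\<^sub>v z = 0\<^sub>v r"
    show "x = - (a *\<^sub>v z)"
    proof (rule eq_vecI)
      fix i assume i: "i < dim_vec (- (a *\<^sub>v z))"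
      have "(x + a *\<^sub>v z) $ i = 0" unfolding e using i a by simp
      then show "x $ i = (- (a *\<^sub>v z)) $ i" using i az that by (simp add: eq_neg_iff_add_eq_0)
    qed (use that a in auto)
  qed (use that a in \<open>auto intro!: eq_vecI\<close>)
  have bot: "adj (a @\<^sub>r b) *\<^sub>v (- (a *\<^sub>v z) @\<^sub>v y) + d *\<^sub>v z = adj b *\<^sub>v y + (- (adj a * a) + d) *\<^sub>v z"
    if "y \<in> carrier_vec c" "z \<in> carrier_vec k" for y z
  proof -
    have az: "a *\<^sub>v z \<in> carrier_vec r" using a that by simp
    have 1: "adj (a @\<^sub>r b) *\<^sub>v (- (a *\<^sub>v z) @\<^sub>v y) = adj a *\<^sub>v (- (a *\<^sub>v z)) + adj b *\<^sub>v y"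
      by (rule adj_append_rows_mult[OF a b]) (use that az in auto)
    have 2: "(- (adj a * a) + d) *\<^sub>v z = - (adj a *\<^sub>v (a *\<^sub>v z)) + d *\<^sub>v z"
      using a d that by (subst add_mult_distrib_mat_vec[of _ k k]) (auto simp: mat_vec_assoc)
    have 3: "adj a *\<^sub>v (- (a *\<^sub>v z)) = - (adj a *\<^sub>v (a *\<^sub>v z))"
      using a by (intro eq_vecI) (auto simp: scalar_prod_def sum_negf)
    show ?thesis unfolding 1 2 3
      by (rule eq_vecI) (use a b d that in \<open>auto simp: algebra_simps\<close>)
  qed
  have z0: "x @\<^sub>v y = 0\<^sub>v (r + c) \<longleftrightarrow> x = 0\<^sub>v r \<and> y = 0\<^sub>v c" if "x \<in> carrier_vec r" for x y :: "'a vec"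
    unfolding zero_vec_append using that by (rule append_vec_eq) simp
  let ?X = "- (adj a * a) + d"
  have L: "four_block_mat (diag_one r c) (a @\<^sub>r b) (adj (a @\<^sub>r b)) d \<in> GL (r + c + k) \<longleftrightarrow>
    (\<forall>y \<in> carrier_vec c. \<forall>z \<in> carrier_vec k. b *\<^sub>v z = 0\<^sub>v c \<and> adj b *\<^sub>v y + ?X *\<^sub>v z = 0\<^sub>v k \<longrightarrow>
      - (a *\<^sub>v z) = 0\<^sub>v r \<and> y = 0\<^sub>v c \<and> z = 0\<^sub>v k)" (is "?L \<longleftrightarrow> ?R")
  proof -
    have "?L \<longleftrightarrow> (\<forall>x \<in> carrier_vec r. \<forall>y \<in> carrier_vec c. \<forall>z \<in> carrier_vec k.
        diag_one r c *\<^sub>v (x @\<^sub>v y) + (a @\<^sub>r b) *\<^sub>v z = 0\<^sub>v (r + c) \<and> adj (a @\<^sub>r b) *\<^sub>v (x @\<^sub>v y) + d *\<^sub>v z = 0\<^sub>v k \<longrightarrow>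
        x @\<^sub>v y = 0\<^sub>v (r + c) \<and> z = 0\<^sub>v k)"
      unfolding GL_four_block_iff[OF diag_one_carrier ab adj_carrier[THEN iffD2, OF ab] d]
      by (rule all_vec_append[unfolded Ball_def[symmetric]])
    also have "\<dots> \<longleftrightarrow> (\<forall>x \<in> carrier_vec r. \<forall>y \<in> carrier_vec c. \<forall>z \<in> carrier_vec k.
        x = - (a *\<^sub>v z) \<and> b *\<^sub>v z = 0\<^sub>v c \<and> adj (a @\<^sub>r b) *\<^sub>v (x @\<^sub>v y) + d *\<^sub>v z = 0\<^sub>v k \<longrightarrow>
        x = 0\<^sub>v r \<and> y = 0\<^sub>v c \<and> z = 0\<^sub>v k)"
      by (intro ball_cong refl) (simp only: top xeq z0 conj_assoc)
    also have "\<dots> \<longleftrightarrow> ?R"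
    proof (intro iffI ballI impI)
      fix y z assume *: "\<forall>x \<in> carrier_vec r. \<forall>y \<in> carrier_vec c. \<forall>z \<in> carrier_vec k.
        x = - (a *\<^sub>v z) \<and> b *\<^sub>v z = 0\<^sub>v c \<and> adj (a @\<^sub>r b) *\<^sub>v (x @\<^sub>v y) + d *\<^sub>v z = 0\<^sub>v k \<longrightarrow>
        x = 0\<^sub>v r \<and> y = 0\<^sub>v c \<and> z = 0\<^sub>v k" and yz: "y \<in> carrier_vec c" "z \<in> carrier_vec k"
        "b *\<^sub>v z = 0\<^sub>v c \<and> adj b *\<^sub>v y + ?X *\<^sub>v z = 0\<^sub>v k"
      have "- (a *\<^sub>v z) \<in> carrier_vec r" using a yz by simp
      moreover have "adj (a @\<^sub>r b) *\<^sub>v (- (a *\<^sub>v z) @\<^sub>v y) + d *\<^sub>v z = 0\<^sub>v k"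
        unfolding bot[OF yz(1,2)] using yz(3) by blast
      ultimately show "- (a *\<^sub>v z) = 0\<^sub>v r \<and> y = 0\<^sub>v c \<and> z = 0\<^sub>v k" using * yz by blast
    next
      fix x y z assume *: ?R and xyz: "x \<in> carrier_vec r" "y \<in> carrier_vec c" "z \<in> carrier_vec k"
        "x = - (a *\<^sub>v z) \<and> b *\<^sub>v z = 0\<^sub>v c \<and> adj (a @\<^sub>r b) *\<^sub>v (x @\<^sub>v y) + d *\<^sub>v z = 0\<^sub>v k"
      then have x: "x = - (a *\<^sub>v z)" and "adj (a @\<^sub>r b) *\<^sub>v (- (a *\<^sub>v z) @\<^sub>v y) + d *\<^sub>v z = 0\<^sub>v k" by blast+
      then have "adj b *\<^sub>v y + ?X *\<^sub>v z = 0\<^sub>v k" unfolding bot[OF xyz(2,3)] by blast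
      then show "x = 0\<^sub>v r \<and> y = 0\<^sub>v c \<and> z = 0\<^sub>v k" unfolding x using * xyz(2-4) by blast
    qed
    finally show ?thesis .
  qed
  have R: "four_block_mat (0\<^sub>m c c) b (adj b) ?X \<in> GL (c + k) \<longleftrightarrow>
    (\<forall>y \<in> carrier_vec c. \<forall>z \<in> carrier_vec k. b *\<^sub>v z = 0\<^sub>v c \<and> adj b *\<^sub>v y + ?X *\<^sub>v z = 0\<^sub>v k \<longrightarrow>
      y = 0\<^sub>v c \<and> z = 0\<^sub>v k)"
    by (subst GL_four_block_iff) (use b 0 in \<open>simp_all add: zero_mult_vec\<close>)
  \<comment> \<open>The condition on \<open>a\<close> in \<open>L\<close> holds as soon as
    \<open>z = 0\<close>, so the two triviality statements \<open>L\<close> and \<open>R\<close>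
    agree.\<close>
  have a0: "- (a *\<^sub>v 0\<^sub>v k) = 0\<^sub>v r" using mult_zero_vec'[OF a] by simp
  show ?thesis unfolding L R using a0 by blast
qed

text \<open>The rows \<open>a\<close> next to the identity block are arbitrary. Subtracting
  \<open>adj a * a\<close> from the corner leaves a completion of the radical, on which the form is
  zero.\<close>

lemma card_completions_diag_one:
  "card (completions k (diag_one r c)) = (q ^ 2) ^ (r * k) * card (completions k (0\<^sub>m c c))"
proof -
  let ?f = "\<lambda>(a, b, d). (a @\<^sub>r b, adj a * a + d)"
  have dc: "- X + (X + d) = d" "X + (- X + d) = d" if "X \<in> carrier_mat k k" "d \<in> carrier_mat k k" for X d :: "'a mat"
    using that by (auto intro!: eq_matI)
  have Hd: "adj a * a + d \<in> Herm k" "- (adj a * a) + d \<in> Herm k" if "d \<in> Herm k" "a \<in> carrier_mat r k" for a d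
    using that by (auto simp: Herm_def adj_add adj_mult)
  have "bij_betw ?f (carrier_mat r k \<times> completions k (0\<^sub>m c c)) (completions k (diag_one r c))"
  proof (rule bij_betw_imageI)
    show "inj_on ?f (carrier_mat r k \<times> completions k (0\<^sub>m c c))"
    proof (rule inj_onI)
      fix x y assume xy: "x \<in> carrier_mat r k \<times> completions k (0\<^sub>m c c)" "y \<in> carrier_mat r k \<times> completions k (0\<^sub>m c c)"
        "?f x = ?f y"
      obtain a b d where x: "x = (a, b, d)" by (cases x)
      obtain a' b' d' where y: "y = (a', b', d')" by (cases y)
      have c: "a \<in> carrier_mat r k" "b \<in> carrier_mat c k" "d \<in> carrier_mat k k"
        "a' \<in> carrier_mat r k" "b' \<in> carrier_mat c k" "d' \<in> carrier_mat k k"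
        using xy(1,2) in_completions[of "0\<^sub>m c c" c] unfolding x y by (auto simp: Herm_def)
      have e: "a @\<^sub>r b = a' @\<^sub>r b'" "adj a * a + d = adj a' * a' + d'" using xy(3) unfolding x y by auto
      note ab = append_rows_eqD[OF e(1) c(1,2,4,5)]
      have X: "adj a' * a' \<in> carrier_mat k k" using c by simp
      have "d = - (adj a' * a') + (adj a' * a' + d)" using dc(1)[OF X c(3)] by simp
      also have "\<dots> = d'" using e(2) dc(1)[OF X c(6)] unfolding ab(1) by simp
      finally show "x = y" unfolding x y ab by simp
    qed
    show "?f ` (carrier_mat r k \<times> completions k (0\<^sub>m c c)) = completions k (diag_one r c)"
    proof (intro equalityI subsetI)
      fix w assume "w \<in> ?f ` (carrier_mat r k \<times> completions k (0\<^sub>m c c))"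
      then obtain a b d where w: "w = (a @\<^sub>r b, adj a * a + d)" "a \<in> carrier_mat r k" "(b, d) \<in> completions k (0\<^sub>m c c)" by auto
      have bd: "b \<in> carrier_mat c k" "d \<in> Herm k" "four_block_mat (0\<^sub>m c c) b (adj b) d \<in> GL (c + k)"
        using w(3) in_completions[of "0\<^sub>m c c" c] by auto
      have "four_block_mat (diag_one r c) (a @\<^sub>r b) (adj (a @\<^sub>r b)) (adj a * a + d) \<in> GL (r + c + k)"
        by (subst completion_diag_one_iff[OF w(2) bd(1)])
          (use w(2) bd Herm_carrier[OF bd(2)] dc(1)[of "adj a * a" d] in auto)
      then show "w \<in> completions k (diag_one r c)"
        unfolding w(1) using in_completions[OF diag_one_carrier] Hd(1)[OF bd(2) w(2)] w(2) bd(1) by auto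
    next
      fix w assume w: "w \<in> completions k (diag_one r c)"
      obtain v d where wv: "w = (v, d)" by (cases w)
      have vd: "v \<in> carrier_mat (r + c) k" "d \<in> Herm k" "four_block_mat (diag_one r c) v (adj v) d \<in> GL (r + c + k)"
        using w in_completions[OF diag_one_carrier] unfolding wv by auto
      obtain a b where ab: "v = a @\<^sub>r b" "a \<in> carrier_mat r k" "b \<in> carrier_mat c k"
        using append_rows_cases[OF vd(1)] .
      have "four_block_mat (0\<^sub>m c c) b (adj b) (- (adj a * a) + d) \<in> GL (c + k)"
        using vd(3) completion_diag_one_iff[OF ab(2,3) Herm_carrier[OF vd(2)]] unfolding ab(1) by blast
      then have m: "(b, - (adj a * a) + d) \<in> completions k (0\<^sub>m c c)"
        using in_completions[of "0\<^sub>m c c" c] Hd(2)[OF vd(2) ab(2)] ab(3) by auto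
      have "w = ?f (a, b, - (adj a * a) + d)"
        unfolding wv ab(1) using dc(2)[of "adj a * a" d] ab(2) Herm_carrier[OF vd(2)] by simp
      then show "w \<in> ?f ` (carrier_mat r k \<times> completions k (0\<^sub>m c c))" using m ab(2) by blast
    qed
  qed
  from bij_betw_same_card[OF this] show ?thesis
    by (simp add: card_cartesian_product card_carrier_mat card_UNIV)
qed

text \<open>A kernel vector \<open>x\<close> of \<open>adj v\<close> would give the kernel vector
  \<open>(x, 0)\<close> of the whole form, so \<open>v\<close> is invertible. Conversely an
  invertible \<open>v\<close> forces \<open>y = 0\<close> and thereby \<open>x = 0\<close>, whatever
  the corner \<open>d\<close> is.\<close>

lemma card_completions_zero_square:
  "card (completions c (0\<^sub>m c c)) = card (GL c :: 'a mat set) * q ^ (c ^ 2)"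
proof -
  have "completions c (0\<^sub>m c c) = GL c \<times> Herm c"
  proof (intro equalityI subsetI)
    fix w assume w: "w \<in> completions c (0\<^sub>m c c)"
    obtain v d where wv: "w = (v, d)" by (cases w)
    have vd: "v \<in> carrier_mat c c" "d \<in> Herm c" "four_block_mat (0\<^sub>m c c) v (adj v) d \<in> GL (c + c)"
      using w in_completions[of "0\<^sub>m c c" c] unfolding wv by auto
    have ac: "adj v \<in> carrier_mat c c" using vd by simp
    have "x = 0\<^sub>v c" if x: "x \<in> carrier_vec c" "adj v *\<^sub>v x = 0\<^sub>v c" for x
    proof -
      have "0\<^sub>m c c *\<^sub>v x + v *\<^sub>v 0\<^sub>v c = 0\<^sub>v c" "adj v *\<^sub>v x + d *\<^sub>v 0\<^sub>v c = 0\<^sub>v c"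
        using x vd mult_zero_vec'[OF vd(1)] mult_zero_vec'[OF Herm_carrier[OF vd(2)]] by (simp_all add: zero_mult_vec)
      then show ?thesis
        using vd(3) x(1) GL_four_block_iff[OF zero_carrier_mat vd(1) ac Herm_carrier[OF vd(2)]] zero_carrier_vec by blast
    qed
    then have "adj v \<in> GL c" using GL_iff_ker[OF ac] by blast
    then have "v \<in> GL c" using adj_GL[of "adj v" c] by simp
    then show "w \<in> GL c \<times> Herm c" unfolding wv using vd(2) by blast
  next
    fix w :: "'a mat \<times> 'a mat" assume w: "w \<in> GL c \<times> Herm c"
    obtain v d where wv: "w = (v, d)" by (cases w)
    have vd: "v \<in> GL c" "d \<in> Herm c" using w unfolding wv by auto
    note vc = GL_carrier[OF vd(1)] and dc = Herm_carrier[OF vd(2)]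
    have ac: "adj v \<in> carrier_mat c c" using vc by simp
    have "four_block_mat (0\<^sub>m c c) v (adj v) d \<in> GL (c + c)"
      unfolding GL_four_block_iff[OF zero_carrier_mat vc ac dc]
    proof (intro ballI impI)
      fix x y :: "'a vec" assume xy: "x \<in> carrier_vec c" "y \<in> carrier_vec c"
        "0\<^sub>m c c *\<^sub>v x + v *\<^sub>v y = 0\<^sub>v c \<and> adj v *\<^sub>v x + d *\<^sub>v y = 0\<^sub>v c"
      have vy: "v *\<^sub>v y \<in> carrier_vec c" "adj v *\<^sub>v x \<in> carrier_vec c" using vc ac xy by auto
      have "v *\<^sub>v y = 0\<^sub>v c" using xy(3) vy by (simp add: zero_mult_vec[OF xy(1)])
      then have y: "y = 0\<^sub>v c" by (rule GL_D[OF vd(1) xy(2)])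
      then have "adj v *\<^sub>v x = 0\<^sub>v c" using xy(3) vy mult_zero_vec'[OF dc] by simp
      then show "x = 0\<^sub>v c \<and> y = 0\<^sub>v c" using GL_D[OF adj_GL[OF vd(1)] xy(1)] y by blast
    qed
    then show "w \<in> completions c (0\<^sub>m c c)" unfolding wv using in_completions[of "0\<^sub>m c c" c] vc vd(2) by auto
  qed
  then show ?thesis by (simp add: card_cartesian_product card_Herm)
qed

end

section \<open>Nilpotent matrices in block form\<close>

lemma nilpotent_mat_iff: "A \<in> carrier_mat n n \<Longrightarrow> nilpotent_mat A \<longleftrightarrow> (\<exists>k. A ^\<^sub>m k = 0\<^sub>m n n)"
  by (simp add: nilpotent_mat_def)

lemma pow_mat_add:
  assumes "A \<in> carrier_mat n n"
  shows "A ^\<^sub>m (i + j) = A ^\<^sub>m i * (A ^\<^sub>m j :: 'a::semiring_1 mat)"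
proof (induction j)
  case (Suc j)
  then show ?case
    using assms pow_carrier_mat[OF assms, of i] pow_carrier_mat[OF assms, of j] by (simp add: assoc_mult_mat[of _ n n _ n _ n])
qed (use assms in simp)

lemma pow_mat_conj:
  assumes "g * h = 1\<^sub>m n" "h * g = 1\<^sub>m n" "g \<in> carrier_mat n n" "h \<in> carrier_mat n n" "A \<in> carrier_mat n n"
  shows "(g * A * h) ^\<^sub>m k = g * A ^\<^sub>m k * (h :: 'a::field mat)"
proof (induction k)
  case 0
  show ?case using assms by simp
next
  case (Suc k)
  have p: "A ^\<^sub>m k \<in> carrier_mat n n" using assms by simp
  have "(g * A * h) ^\<^sub>m Suc k = (g * A ^\<^sub>m k * h) * (g * A * h)" using Suc by simp
  also have "\<dots> = g * (A ^\<^sub>m k * (h * (g * (A * h))))"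
    using assms p by (simp add: mat_assoc)
  also have "h * (g * (A * h)) = A * h" by (rule mat_cancel[OF assms(2,4,3)]) (use assms in simp)
  also have "g * (A ^\<^sub>m k * (A * h)) = g * A ^\<^sub>m Suc k * h" using assms p by (simp add: mat_assoc)
  finally show ?case .
qed

lemma nilpotent_conj:
  assumes "g * h = 1\<^sub>m n" "h * g = 1\<^sub>m n" "g \<in> carrier_mat n n" "h \<in> carrier_mat n n" "A \<in> carrier_mat n n"
  shows "nilpotent_mat (g * A * h) \<longleftrightarrow> nilpotent_mat (A :: 'a::field mat)"
proof -
  have e: "g * X * h = 0\<^sub>m n n \<longleftrightarrow> X = 0\<^sub>m n n" if X: "X \<in> carrier_mat n n" for X
  proof
    assume "g * X * h = 0\<^sub>m n n"
    then have "h * (g * X * h) * g = 0\<^sub>m n n" using assms by simp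
    moreover have "h * (g * X * h) * g = h * (g * (X * (h * g)))" using assms X by (simp add: mat_assoc)
    moreover have "\<dots> = X" unfolding assms(2) using mat_cancel[OF assms(2,4,3), of X] X by simp
    ultimately show "X = 0\<^sub>m n n" by simp
  qed (use assms in simp)
  have c: "g * A * h \<in> carrier_mat n n" using assms by simp
  show ?thesis
    unfolding nilpotent_mat_iff[OF c] nilpotent_mat_iff[OF assms(5)] pow_mat_conj[OF assms]
    using e pow_carrier_mat[OF assms(5)] by blast
qed

lemma nilpotent_smult_iff:
  assumes "c \<noteq> 0" and A: "A \<in> carrier_mat n n"
  shows "nilpotent_mat (c \<cdot>\<^sub>m A) \<longleftrightarrow> nilpotent_mat (A :: 'a::field mat)"
proof -
  have p: "(c \<cdot>\<^sub>m A) ^\<^sub>m k = c ^ k \<cdot>\<^sub>m (A ^\<^sub>m k)" for k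
  proof (induction k)
    case (Suc k)
    then show ?case using A by (simp add: mat_mult_smult_left mat_mult_smult_right mat_smult_smult mult.commute)
  qed simp
  have z: "a \<cdot>\<^sub>m X = 0\<^sub>m n n \<longleftrightarrow> X = 0\<^sub>m n n" if "a \<noteq> 0" for a and X :: "'a mat"
  proof
    assume "a \<cdot>\<^sub>m X = 0\<^sub>m n n"
    then have "inverse a \<cdot>\<^sub>m (a \<cdot>\<^sub>m X) = inverse a \<cdot>\<^sub>m 0\<^sub>m n n" by simp
    also have "\<dots> = 0\<^sub>m n n" by (rule eq_matI) simp_all
    finally show "X = 0\<^sub>m n n" using that by (simp add: mat_smult_smult)
  next
    assume "X = 0\<^sub>m n n"
    then show "a \<cdot>\<^sub>m X = 0\<^sub>m n n" by (intro eq_matI) simp_all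
  qed
  have "c ^ k \<noteq> 0" for k using assms(1) by simp
  then show ?thesis
    unfolding nilpotent_mat_iff[OF A] nilpotent_mat_iff[OF smult_carrier_mat[OF A]] p using z by blast
qed

lemma pow_four_block_lower:
  assumes "A \<in> carrier_mat r r" "C \<in> carrier_mat k r" "D \<in> carrier_mat k k"
  shows "\<exists>X \<in> carrier_mat k r. four_block_mat A (0\<^sub>m r k) C D ^\<^sub>m j = four_block_mat (A ^\<^sub>m j) (0\<^sub>m r k) X (D ^\<^sub>m j :: 'a::field mat)"
proof (induction j)
  case 0
  then show ?case using assms by (intro bexI[of _ "0\<^sub>m k r"]) auto
next
  case (Suc j)
  then obtain X where X: "X \<in> carrier_mat k r"
    "four_block_mat A (0\<^sub>m r k) C D ^\<^sub>m j = four_block_mat (A ^\<^sub>m j) (0\<^sub>m r k) X (D ^\<^sub>m j)" by blast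
  have p: "A ^\<^sub>m j \<in> carrier_mat r r" "D ^\<^sub>m j \<in> carrier_mat k k" using assms by auto
  have "four_block_mat A (0\<^sub>m r k) C D ^\<^sub>m Suc j =
      four_block_mat (A ^\<^sub>m j * A) (0\<^sub>m r k) (X * A + D ^\<^sub>m j * C) (D ^\<^sub>m j * D)"
    unfolding pow_mat.simps(2) X(2)
    by (subst mult_four_block_mat[of _ r r _ k _ k _ _ r _ k]) (use assms X(1) p in auto)
  moreover have "X * A + D ^\<^sub>m j * C \<in> carrier_mat k r"
    by (rule add_carrier_mat, rule mult_carrier_mat[OF p(2) assms(2)])
  ultimately show ?case by auto
qed

lemma nilpotent_four_block_lower:
  assumes "A \<in> carrier_mat r r" "C \<in> carrier_mat k r" "D \<in> carrier_mat k k"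
  shows "nilpotent_mat (four_block_mat A (0\<^sub>m r k) C D) \<longleftrightarrow> nilpotent_mat A \<and> nilpotent_mat (D :: 'a::field mat)"
proof -
  let ?M = "four_block_mat A (0\<^sub>m r k) C D"
  have M: "?M \<in> carrier_mat (r + k) (r + k)" using assms by simp
  have z: "(0\<^sub>m (r + k) (r + k) :: 'a mat) = four_block_mat (0\<^sub>m r r) (0\<^sub>m r k) (0\<^sub>m k r) (0\<^sub>m k k)" by simp
  show ?thesis
  proof
    assume "nilpotent_mat ?M"
    then obtain j where j: "?M ^\<^sub>m j = 0\<^sub>m (r + k) (r + k)" using nilpotent_mat_iff[OF M] by blast
    obtain X where X: "X \<in> carrier_mat k r" "?M ^\<^sub>m j = four_block_mat (A ^\<^sub>m j) (0\<^sub>m r k) X (D ^\<^sub>m j)"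
      using pow_four_block_lower[OF assms] by blast
    have "A ^\<^sub>m j = 0\<^sub>m r r" "D ^\<^sub>m j = 0\<^sub>m k k"
      using four_block_eqD(1,4)[of "A ^\<^sub>m j" "0\<^sub>m r k" X "D ^\<^sub>m j" "0\<^sub>m r r" "0\<^sub>m r k" "0\<^sub>m k r" "0\<^sub>m k k" r r k k]
        X j assms by simp_all
    then show "nilpotent_mat A \<and> nilpotent_mat D" using nilpotent_mat_iff assms by blast
  next
    assume "nilpotent_mat A \<and> nilpotent_mat D"
    then obtain i j where ij: "A ^\<^sub>m i = 0\<^sub>m r r" "D ^\<^sub>m j = 0\<^sub>m k k" using nilpotent_mat_iff assms by blast
    have "A ^\<^sub>m (i + j) = 0\<^sub>m r r" "D ^\<^sub>m (i + j) = 0\<^sub>m k k"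
      using pow_mat_add[OF assms(1)] pow_mat_add[OF assms(3)] ij assms by (auto simp: pow_carrier_mat)
    then obtain X where X: "X \<in> carrier_mat k r" "?M ^\<^sub>m (i + j) = four_block_mat (0\<^sub>m r r) (0\<^sub>m r k) X (0\<^sub>m k k)"
      using pow_four_block_lower[OF assms, of "i + j"] by auto
    \<comment> \<open>At exponent \<open>i + j\<close> both diagonal blocks have vanished, and a
      matrix with nothing but a lower left block squares to zero.\<close>
    have "?M ^\<^sub>m ((i + j) + (i + j)) = 0\<^sub>m (r + k) (r + k)"
      unfolding pow_mat_add[OF M, of "i + j"] X(2)
      by (subst mult_four_block_mat[of _ r r _ k _ k _ _ r _ k]) (use X(1) in auto)
    then show "nilpotent_mat ?M" using nilpotent_mat_iff[OF M] by blast
  qed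
qed

section \<open>Inversion of Hermitian forms and completions of the zero form\<close>

definition mat_inv :: "'a::field mat \<Rightarrow> 'a mat" where
  "mat_inv g = (SOME h. h \<in> GL (dim_row g) \<and> g * h = 1\<^sub>m (dim_row g) \<and> h * g = 1\<^sub>m (dim_row g))"

lemma mat_inv:
  assumes "g \<in> GL n"
  shows "mat_inv g \<in> GL n" "g * mat_inv g = 1\<^sub>m n" "mat_inv g * g = 1\<^sub>m n"
proof -
  have d: "dim_row g = n" using GL_carrier[OF assms] by simp
  obtain h where "h \<in> GL n" "g * h = 1\<^sub>m n" "h * g = 1\<^sub>m n" using GL_inverse[OF assms] .
  then have "\<exists>h. h \<in> GL n \<and> g * h = 1\<^sub>m n \<and> h * g = 1\<^sub>m n" by blast
  from someI_ex[OF this] show "mat_inv g \<in> GL n" "g * mat_inv g = 1\<^sub>m n" "mat_inv g * g = 1\<^sub>m n"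
    unfolding mat_inv_def d by blast+
qed

lemma mat_inv_unique:
  assumes "g \<in> GL n" "h \<in> carrier_mat n n" "g * h = 1\<^sub>m n"
  shows "mat_inv g = h"
  by (rule GL_cancel_left[OF assms(1) GL_carrier[OF mat_inv(1)[OF assms(1)]] assms(2)])
    (simp add: mat_inv(2)[OF assms(1)] assms(3))

lemma mat_inv_inv: "g \<in> GL n \<Longrightarrow> mat_inv (mat_inv g) = g"
  by (rule mat_inv_unique[OF mat_inv(1) GL_carrier mat_inv(3)])

context unitary_field
begin

lemma mat_inv_Herm:
  assumes "g \<in> GL n" "g \<in> Herm n"
  shows "mat_inv g \<in> Herm n"
proof -
  note i = mat_inv[OF assms(1)]
  have c: "mat_inv g \<in> carrier_mat n n" "g \<in> carrier_mat n n" using GL_carrier i(1) assms(1) by blast+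
  have "g * adj (mat_inv g) = adj (mat_inv g * g)" using assms(2) c by (simp add: adj_mult Herm_def)
  then have "g * adj (mat_inv g) = 1\<^sub>m n" unfolding i(3) by simp
  then have "mat_inv g = adj (mat_inv g)" by (intro mat_inv_unique[OF assms(1)]) (use c in auto)
  then show ?thesis using c by (simp add: Herm_def)
qed

lemma adj_pow: "A \<in> carrier_mat n n \<Longrightarrow> adj (A ^\<^sub>m k) = adj A ^\<^sub>m k"
proof (induction k)
  case (Suc k)
  have p: "adj A ^\<^sub>m k \<in> carrier_mat n n" using Suc.prems by simp
  have "adj (A ^\<^sub>m Suc k) = adj A * adj A ^\<^sub>m k" using Suc by (simp add: adj_mult)
  also have "\<dots> = adj A ^\<^sub>m (1 + k)" using Suc.prems p pow_mat_add[of "adj A" n 1 k] by simp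
  finally show ?case by simp
qed simp

lemma nilpotent_adj: "A \<in> carrier_mat n n \<Longrightarrow> nilpotent_mat A \<Longrightarrow> nilpotent_mat (adj A)"
  using nilpotent_mat_iff[of A n] nilpotent_mat_iff[of "adj A" n] adj_pow[of A n] by (metis adj_carrier adj_zero)

text \<open>A completion is read as one nonsingular Hermitian matrix with the block
  \<open>J1\<close>, in the upper left or, after exchanging the two groups of coordinates, in the
  lower right corner. Both readings are needed because inversion moves attention from one corner to
  the other.\<close>

lemma card_completions_matrices:
  assumes J: "J1 \<in> Herm r"
  shows "card (completions k J1) = card {J \<in> GL (r + k) \<inter> Herm (r + k). \<exists>v \<in> carrier_mat r k. \<exists>d \<in> carrier_mat k k.
    J = four_block_mat J1 v (adj v) d}" (is "_ = card ?X")
    and "card (completions k J1) = card {J \<in> GL (k + r) \<inter> Herm (k + r). \<exists>v \<in> carrier_mat k r. \<exists>d \<in> carrier_mat k k.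
    J = four_block_mat d v (adj v) J1}" (is "_ = card ?Y")
proof -
  note Jc = Herm_carrier[OF J]
  have m: "(v, d) \<in> completions k J1 \<longleftrightarrow> v \<in> carrier_mat r k \<and> d \<in> Herm k \<and> four_block_mat J1 v (adj v) d \<in> GL (r + k)" for v d
    by (rule in_completions[OF Jc])
  have inj1: "inj_on (\<lambda>(v, d). four_block_mat J1 v (adj v) d) (completions k J1)"
  proof (rule inj_onI)
    fix x y assume xy: "x \<in> completions k J1" "y \<in> completions k J1"
      "(\<lambda>(v, d). four_block_mat J1 v (adj v) d) x = (\<lambda>(v, d). four_block_mat J1 v (adj v) d) y"
    obtain v d where x: "x = (v, d)" by (cases x)
    obtain v' d' where y: "y = (v', d')" by (cases y)
    have "v \<in> carrier_mat r k" "d \<in> carrier_mat k k" "v' \<in> carrier_mat r k" "d' \<in> carrier_mat k k"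
      "four_block_mat J1 v (adj v) d = four_block_mat J1 v' (adj v') d'"
      using xy m unfolding x y by (auto simp: Herm_carrier)
    then show "x = y" unfolding x y using four_block_eqD(2,4)[of J1 v "adj v" d J1 v' "adj v'" d' r r k k] Jc by simp
  qed
  have im1: "(\<lambda>(v, d). four_block_mat J1 v (adj v) d) ` completions k J1 = ?X"
  proof (intro equalityI subsetI)
    fix M assume "M \<in> (\<lambda>(v, d). four_block_mat J1 v (adj v) d) ` completions k J1"
    then obtain v d where *: "M = four_block_mat J1 v (adj v) d" "(v, d) \<in> completions k J1" by auto
    then have vd: "v \<in> carrier_mat r k" "d \<in> Herm k" "M \<in> GL (r + k)" using m by auto
    have "M \<in> Herm (r + k)"
      unfolding *(1) using Herm_four_block[OF Jc vd(1) _ Herm_carrier[OF vd(2)]] J vd by simp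
    then show "M \<in> ?X" using vd Herm_carrier[OF vd(2)] *(1) by blast
  next
    fix M assume "M \<in> ?X"
    then obtain v d where *: "M \<in> GL (r + k)" "M \<in> Herm (r + k)" "v \<in> carrier_mat r k" "d \<in> carrier_mat k k"
      "M = four_block_mat J1 v (adj v) d" by blast
    have va: "adj v \<in> carrier_mat k r" using * by simp
    have "d \<in> Herm k" using *(2) Herm_four_block[OF Jc *(3) va *(4)] unfolding *(5) by simp
    then have "(v, d) \<in> completions k J1" using m *(1,3) unfolding *(5) by blast
    then show "M \<in> (\<lambda>(v, d). four_block_mat J1 v (adj v) d) ` completions k J1" using *(5) by force
  qed
  show "card (completions k J1) = card ?X" unfolding im1[symmetric] by (rule card_image[OF inj1, symmetric])
  have inj2: "inj_on (\<lambda>(v, d). four_block_mat d (adj v) v J1) (completions k J1)"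
  proof (rule inj_onI)
    fix x y assume xy: "x \<in> completions k J1" "y \<in> completions k J1"
      "(\<lambda>(v, d). four_block_mat d (adj v) v J1) x = (\<lambda>(v, d). four_block_mat d (adj v) v J1) y"
    obtain v d where x: "x = (v, d)" by (cases x)
    obtain v' d' where y: "y = (v', d')" by (cases y)
    have "v \<in> carrier_mat r k" "d \<in> carrier_mat k k" "v' \<in> carrier_mat r k" "d' \<in> carrier_mat k k"
      "four_block_mat d (adj v) v J1 = four_block_mat d' (adj v') v' J1"
      using xy m unfolding x y by (auto simp: Herm_carrier)
    then show "x = y" unfolding x y using four_block_eqD(1,3)[of d "adj v" v J1 d' "adj v'" v' J1 k k r r] Jc by simp
  qed
  have im2: "(\<lambda>(v, d). four_block_mat d (adj v) v J1) ` completions k J1 = ?Y"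
  proof (intro equalityI subsetI)
    fix M assume "M \<in> (\<lambda>(v, d). four_block_mat d (adj v) v J1) ` completions k J1"
    then obtain v d where *: "M = four_block_mat d (adj v) v J1" "(v, d) \<in> completions k J1" by auto
    then have vd: "v \<in> carrier_mat r k" "d \<in> Herm k" "four_block_mat J1 v (adj v) d \<in> GL (r + k)" using m by auto
    have va: "adj v \<in> carrier_mat k r" using vd by simp
    note dc = Herm_carrier[OF vd(2)]
    have 1: "M \<in> Herm (k + r)" unfolding *(1) using Herm_four_block[OF dc va vd(1) Jc] J vd by simp
    have 2: "M \<in> GL (k + r)" unfolding *(1) using GL_four_block_swap[OF Jc vd(1) va dc] vd(3) by simp
    have 3: "M = four_block_mat d (adj v) (adj (adj v)) J1" unfolding *(1) by simp
    show "M \<in> ?Y" using 1 2 3 va dc by blast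
  next
    fix M assume "M \<in> ?Y"
    then obtain v d where *: "M \<in> GL (k + r)" "M \<in> Herm (k + r)" "v \<in> carrier_mat k r" "d \<in> carrier_mat k k"
      "M = four_block_mat d v (adj v) J1" by blast
    have va: "adj v \<in> carrier_mat r k" using * by simp
    have d: "d \<in> Herm k" using *(2) Herm_four_block[OF *(4,3) va Jc] unfolding *(5) by simp
    have "four_block_mat J1 (adj v) v d \<in> GL (r + k)" using *(1) GL_four_block_swap[OF *(4,3) va Jc] unfolding *(5) by simp
    then have "(adj v, d) \<in> completions k J1" using m d va by simp
    then show "M \<in> (\<lambda>(v, d). four_block_mat d (adj v) v J1) ` completions k J1" using *(5) by force
  qed
  show "card (completions k J1) = card ?Y" unfolding im2[symmetric] by (rule card_image[OF inj2, symmetric])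
qed

lemma card_completions_Herm_rank:
  assumes "J1 \<in> Herm_rank r c"
  shows "card (completions k J1) = (q ^ 2) ^ (r * k) * card (completions k (0\<^sub>m c c))"
proof -
  obtain g where g: "g \<in> GL (r + c)" "J1 = g * diag_one r c * adj g" using Herm_rankE[OF assms] .
  show ?thesis unfolding g(2) card_completions_conj[OF g(1) diag_one_carrier] by (rule card_completions_diag_one)
qed

text \<open>Inversion permutes the nonsingular Hermitian matrices, and the upper left block of size
  \<open>c\<close> vanishes exactly when the complementary block \<open>f\<close> of the inverse has
  corank \<open>c\<close>. The degenerate block has thereby been traded for an \<open>f\<close>
  whose radical has the same dimension as the border, which leads back to the square case.\<close>

lemma card_completions_zero_sum:
  "card (completions k (0\<^sub>m c c)) = (\<Sum>f\<in>{f \<in> Herm k. card (ker_mat f) = (q ^ 2) ^ c}. card (completions c f))"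
proof -
  let ?X = "{J \<in> GL (c + k) \<inter> Herm (c + k). \<exists>v \<in> carrier_mat c k. \<exists>d \<in> carrier_mat k k.
    J = four_block_mat (0\<^sub>m c c) v (adj v) d}"
  let ?S = "{f \<in> Herm k. card (ker_mat f) = (q ^ 2) ^ c}"
  let ?Y = "{H \<in> GL (c + k) \<inter> Herm (c + k). \<exists>e \<in> carrier_mat c c. \<exists>u \<in> carrier_mat c k. \<exists>f \<in> carrier_mat k k.
    H = four_block_mat e u (adj u) f \<and> card (ker_mat f) = (q ^ 2) ^ c}"
  have k0: "card (ker_mat (0\<^sub>m c c :: 'a mat)) = (q ^ 2) ^ c"
  proof -
    have "ker_mat (0\<^sub>m c c :: 'a mat) = carrier_vec c"
      using in_ker_mat[OF zero_carrier_mat[of c c]] zero_mult_vec[of _ c c] by blast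
    then show ?thesis by (simp add: card_carrier_vec card_UNIV)
  qed
  \<comment> \<open>For the way back: the comparison of kernels yields only the corank of the block,
    but corank \<open>c\<close> in size \<open>c\<close> means that the block is zero.\<close>
  have ker0: "A = 0\<^sub>m c c" if A: "A \<in> carrier_mat c c" "card (ker_mat A) = (q ^ 2) ^ c" for A :: "'a mat"
  proof -
    have "ker_mat A = carrier_vec c"
      using A by (intro card_seteq) (auto simp: ker_mat_def card_carrier_vec card_UNIV)
    then have z: "A *\<^sub>v x = 0\<^sub>v c" if "x \<in> carrier_vec c" for x using in_ker_mat[OF A(1)] that by blast
    show ?thesis
    proof (rule eq_matI)
      fix i j assume "i < dim_row (0\<^sub>m c c)" "j < dim_col (0\<^sub>m c c)"
      then have ij: "i < c" "j < c" by auto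
      have "A $$ (i, j) = (A *\<^sub>v unit_vec c j) $ i" using A ij by simp
      also have "\<dots> = 0" unfolding z[OF unit_vec_carrier] using ij by simp
      finally show "A $$ (i, j) = 0\<^sub>m c c $$ (i, j)" using ij by simp
    qed (use A in auto)
  qed
  have blocks: "\<exists>A \<in> carrier_mat c c. \<exists>B \<in> carrier_mat c k. \<exists>D \<in> carrier_mat k k. M = four_block_mat A B (adj B) D"
    if M: "M \<in> Herm (c + k)" for M
  proof -
    obtain A B C D where bl: "M = four_block_mat A B C D" "A \<in> carrier_mat c c" "B \<in> carrier_mat c k"
      "C \<in> carrier_mat k c" "D \<in> carrier_mat k k" using four_block_cases[OF Herm_carrier[OF M]] by metis
    then have "C = adj B" using M Herm_four_block[OF bl(2-5)] by simp
    then show ?thesis using bl by blast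
  qed
  have ker_eq: "card (ker_mat A) = card (ker_mat D')"
    if "four_block_mat A B (adj B) D \<in> GL (c + k)" "A \<in> carrier_mat c c" "B \<in> carrier_mat c k" "D \<in> carrier_mat k k"
      "mat_inv (four_block_mat A B (adj B) D) = four_block_mat A' B' (adj B') D'"
      "A' \<in> carrier_mat c c" "B' \<in> carrier_mat c k" "D' \<in> carrier_mat k k" for A B D A' B' D'
    by (rule card_ker_inverse_block[of A c B k "adj B" D A' B' "adj B'" D'])
      (use that mat_inv(2,3)[OF that(1)] in auto)
  have "card ?X = card ?Y"
  proof (rule card_eq_by_inverse[where f = mat_inv and g = mat_inv])
    fix J assume "J \<in> ?X"
    then obtain v d where J: "J \<in> GL (c + k)" "J \<in> Herm (c + k)" "v \<in> carrier_mat c k" "d \<in> carrier_mat k k"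
      "J = four_block_mat (0\<^sub>m c c) v (adj v) d" by blast
    have H: "mat_inv J \<in> Herm (c + k)" "mat_inv J \<in> GL (c + k)" using mat_inv_Herm[OF J(1,2)] mat_inv(1)[OF J(1)] by auto
    obtain e u f where b: "e \<in> carrier_mat c c" "u \<in> carrier_mat c k" "f \<in> carrier_mat k k"
      "mat_inv J = four_block_mat e u (adj u) f" using blocks[OF H(1)] by blast
    have "card (ker_mat f) = (q ^ 2) ^ c"
      using ker_eq[OF J(1)[unfolded J(5)] zero_carrier_mat J(3,4) b(4)[unfolded J(5)] b(1-3)] k0 by simp
    then show "mat_inv J \<in> ?Y \<and> mat_inv (mat_inv J) = J" using H b mat_inv_inv[OF J(1)] by blast
  next
    fix H assume "H \<in> ?Y"
    then obtain e u f where H: "H \<in> GL (c + k)" "H \<in> Herm (c + k)" "e \<in> carrier_mat c c" "u \<in> carrier_mat c k" "f \<in> carrier_mat k k"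
      "H = four_block_mat e u (adj u) f" "card (ker_mat f) = (q ^ 2) ^ c" by blast
    have J: "mat_inv H \<in> Herm (c + k)" "mat_inv H \<in> GL (c + k)" using mat_inv_Herm[OF H(1,2)] mat_inv(1)[OF H(1)] by auto
    obtain A v d where b: "A \<in> carrier_mat c c" "v \<in> carrier_mat c k" "d \<in> carrier_mat k k"
      "mat_inv H = four_block_mat A v (adj v) d" using blocks[OF J(1)] by blast
    have "mat_inv (four_block_mat A v (adj v) d) = four_block_mat e u (adj u) f"
      unfolding b(4)[symmetric] H(6)[symmetric] by (rule mat_inv_inv[OF H(1)])
    from ker_eq[OF J(2)[unfolded b(4)] b(1-3) this H(3-5)]
    have A: "A = 0\<^sub>m c c" using ker0[OF b(1)] H(7) by simp
    show "mat_inv H \<in> ?X \<and> mat_inv (mat_inv H) = H"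
      using J b(2,3) b(4)[unfolded A] mat_inv_inv[OF H(1)] by blast
  qed
  moreover have "card (completions k (0\<^sub>m c c)) = card ?X"
    by (rule card_completions_matrices(1)) (simp add: Herm_def)
  moreover have "card ?Y = (\<Sum>f\<in>?S. card (completions c f))"
  proof (rule card_by_fibres[where f = "\<lambda>H. mat k k (\<lambda>(i, j). H $$ (c + i, c + j))"])
    have proj: "mat k k (\<lambda>(i, j). four_block_mat e u w f $$ (c + i, c + j)) = f"
      if "e \<in> carrier_mat c c" "f \<in> carrier_mat k k" for e u w f :: "'a mat"
      by (rule eq_matI) (use that in auto)
    show "finite ?Y" by simp
    show "finite ?S" by simp
    show "mat k k (\<lambda>(i, j). H $$ (c + i, c + j)) \<in> ?S" if HY: "H \<in> ?Y" for H
    proof -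
      obtain e u f where H: "H \<in> Herm (c + k)" "e \<in> carrier_mat c c" "u \<in> carrier_mat c k" "f \<in> carrier_mat k k"
        "H = four_block_mat e u (adj u) f" "card (ker_mat f) = (q ^ 2) ^ c" using HY by blast
      have "f \<in> Herm k" using H(1) Herm_four_block[OF H(2,3) _ H(4)] H(3) unfolding H(5) by simp
      then show ?thesis unfolding H(5) proj[OF H(2,4)] using H(6) by simp
    qed
    show "card {H \<in> ?Y. mat k k (\<lambda>(i, j). H $$ (c + i, c + j)) = f} = card (completions c f)" if f: "f \<in> ?S" for f
    proof -
      have fc: "f \<in> carrier_mat k k" "f \<in> Herm k" "card (ker_mat f) = (q ^ 2) ^ c" using f by (auto simp: Herm_carrier)
      have "{H \<in> ?Y. mat k k (\<lambda>(i, j). H $$ (c + i, c + j)) = f} =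
        {J \<in> GL (c + k) \<inter> Herm (c + k). \<exists>v \<in> carrier_mat c k. \<exists>d \<in> carrier_mat c c. J = four_block_mat d v (adj v) f}"
        (is "?L = ?R")
      proof (intro equalityI subsetI)
        fix H assume "H \<in> ?L"
        then obtain e u f' where H: "H \<in> GL (c + k)" "H \<in> Herm (c + k)" "e \<in> carrier_mat c c" "u \<in> carrier_mat c k" "f' \<in> carrier_mat k k"
          "H = four_block_mat e u (adj u) f'" "mat k k (\<lambda>(i, j). H $$ (c + i, c + j)) = f" by blast
        have "f' = f" using H(7) proj[OF H(3,5)] unfolding H(6) by simp
        then show "H \<in> ?R" using H by blast
      next
        fix H assume "H \<in> ?R"
        then obtain u e where H: "H \<in> GL (c + k)" "H \<in> Herm (c + k)" "e \<in> carrier_mat c c" "u \<in> carrier_mat c k"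
          "H = four_block_mat e u (adj u) f" by blast
        then show "H \<in> ?L" using proj[OF H(3) fc(1)] fc by blast
      qed
      then show ?thesis using card_completions_matrices(2)[OF fc(2), of c] by simp
    qed
  qed
  ultimately show ?thesis by simp
qed

text \<open>By congruence and Schur complement, every \<open>f\<close> of corank \<open>c\<close>
  has the same number of completions as the zero form of size \<open>c\<close>, up to the factor for
  the free rows; the number of such \<open>f\<close> is an orbit size, and there are none when
  \<open>c\<close> exceeds \<open>k\<close>.\<close>

lemma card_completions_zero:
  "card (completions k (0\<^sub>m c c)) =
    (if c \<le> k then card (Herm_rank (k - c) c) * ((q ^ 2) ^ ((k - c) * c) * (card (GL c :: 'a mat set) * q ^ (c ^ 2))) else 0)"
proof (cases "c \<le> k")
  case True
  have e: "{f \<in> Herm k. card (ker_mat f) = (q ^ 2) ^ c} = Herm_rank (k - c) c"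
    using True by (simp add: Herm_rank_def)
  show ?thesis
    unfolding card_completions_zero_sum e
    using True by (simp add: card_completions_Herm_rank card_completions_zero_square)
next
  case False
  have e: "{f \<in> Herm k. card (ker_mat f) = (q ^ 2) ^ c} = {}"
  proof (intro equals0I)
    fix f assume "f \<in> {f \<in> Herm k. card (ker_mat f) = (q ^ 2) ^ c}"
    then have f: "f \<in> Herm k" "card (ker_mat f) = (q ^ 2) ^ c" by auto
    obtain r' k' g where *: "k = r' + k'" "card (ker_mat f) = (q ^ 2) ^ k'" using Herm_cases_rank[OF f(1)] by metis
    then have "k' = c" using f(2) q2_power_inject by simp
    then show False using False *(1) by simp
  qed
  show ?thesis unfolding card_completions_zero_sum e using False by simp
qed

end

subsection \<open>Extensions of nilpotent skew operators\<close>

lemma uminus_eq_smult: "- A = (- 1) \<cdot>\<^sub>m (A :: 'a::ring_1 mat)"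
  by (rule eq_matI) auto

lemma mat_add_zero_cancel: 
  assumes "A + B = C" "B = 0\<^sub>m r k" "A \<in> carrier_mat r k"
  shows "A = (C :: 'a::field mat)"
  using assms by simp

lemma nilpotent_intertwine:
  assumes "w * Z = B * w" "w \<in> carrier_mat r n" "Z \<in> carrier_mat n n" "B \<in> carrier_mat r r"
  shows "w * Z ^\<^sub>m j = B ^\<^sub>m j * (w :: 'a::field mat)"
proof (induction j)
  case (Suc j)
  have p: "Z ^\<^sub>m j \<in> carrier_mat n n" "B ^\<^sub>m j \<in> carrier_mat r r" using assms by auto
  have "w * Z ^\<^sub>m Suc j = (w * Z ^\<^sub>m j) * Z" using assms p by (simp add: mat_assoc)
  also have "\<dots> = B ^\<^sub>m j * (w * Z)" unfolding Suc using assms p by (simp add: mat_assoc)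
  also have "\<dots> = B ^\<^sub>m Suc j * w" unfolding assms(1) using assms(2-4) p by (simp add: mat_assoc)
  finally show ?case .
qed (use assms in simp)

lemma lower_row_block_mult:
  assumes "C \<in> carrier_mat k r" "G \<in> carrier_mat k k" "A' \<in> carrier_mat r r" "B' \<in> carrier_mat r k"
    "C' \<in> carrier_mat k r" "D' \<in> carrier_mat k k"
  shows "four_block_mat (0\<^sub>m r r) (0\<^sub>m r k) C G * four_block_mat A' B' C' D' =
    four_block_mat (0\<^sub>m r r) (0\<^sub>m r k) (C * A' + G * C') (C * B' + G * (D' :: 'a::field mat))"
  by (subst mult_four_block_mat[of _ r r _ k _ k _ _ r _ k]) (use assms in auto)

context unitary_field
begin

definition nil_skew :: "nat \<Rightarrow> 'a mat set" where
  "nil_skew n = {A \<in> Skew n. nilpotent_mat A}"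

text \<open>Only the upper left block is restricted; the off-diagonal block \<open>b\<close> and the
  skew corner \<open>t\<close> are free and give the two powers.\<close>

lemma card_Skew_top_left:
  "card {S \<in> Skew (m + c). \<exists>s \<in> carrier_mat m m. \<exists>b \<in> carrier_mat m c. \<exists>t \<in> carrier_mat c c.
      S = four_block_mat s b (- adj b) t \<and> P s} =
    card {s \<in> Skew m. P s} * ((q ^ 2) ^ (m * c) * q ^ (c ^ 2))" (is "card ?X = _")
proof -
  let ?f = "\<lambda>(s, b, t). four_block_mat s b (- adj b) t"
  have "bij_betw ?f ({s \<in> Skew m. P s} \<times> carrier_mat m c \<times> Skew c) ?X"
  proof (rule bij_betw_imageI)
    show "inj_on ?f ({s \<in> Skew m. P s} \<times> carrier_mat m c \<times> Skew c)"
    proof (rule inj_onI)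
      fix x y assume xy: "x \<in> {s \<in> Skew m. P s} \<times> carrier_mat m c \<times> Skew c"
        "y \<in> {s \<in> Skew m. P s} \<times> carrier_mat m c \<times> Skew c" "?f x = ?f y"
      obtain s b t where x: "x = (s, b, t)" by (cases x)
      obtain s' b' t' where y: "y = (s', b', t')" by (cases y)
      have "s \<in> carrier_mat m m" "b \<in> carrier_mat m c" "t \<in> carrier_mat c c"
        "s' \<in> carrier_mat m m" "b' \<in> carrier_mat m c" "t' \<in> carrier_mat c c"
        "four_block_mat s b (- adj b) t = four_block_mat s' b' (- adj b') t'"
        using xy unfolding x y by (auto simp: Skew_iff)
      then show "x = y" unfolding x y
        using four_block_eqD[of s b "- adj b" t s' b' "- adj b'" t' m m c c] by simp
    qed
    show "?f ` ({s \<in> Skew m. P s} \<times> carrier_mat m c \<times> Skew c) = ?X"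
    proof (intro equalityI subsetI)
      fix S assume "S \<in> ?f ` ({s \<in> Skew m. P s} \<times> carrier_mat m c \<times> Skew c)"
      then obtain s b t where S: "S = four_block_mat s b (- adj b) t" "s \<in> Skew m" "P s" "b \<in> carrier_mat m c" "t \<in> Skew c" by auto
      have "S \<in> Skew (m + c)" unfolding S(1) using S Skew_four_block[OF Skew_carrier[OF S(2)] S(4) _ Skew_carrier[OF S(5)]] by simp
      then show "S \<in> ?X" using S Skew_carrier[OF S(2)] Skew_carrier[OF S(5)] by blast
    next
      fix S assume "S \<in> ?X"
      then obtain s b t where S: "S \<in> Skew (m + c)" "s \<in> carrier_mat m m" "b \<in> carrier_mat m c" "t \<in> carrier_mat c c"
        "S = four_block_mat s b (- adj b) t" "P s" by blast
      have "- adj b \<in> carrier_mat c m" using S(3) by simp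
      then have "s \<in> Skew m" "t \<in> Skew c" using S(1) Skew_four_block[OF S(2,3) _ S(4)] unfolding S(5) by auto
      then show "S \<in> ?f ` ({s \<in> Skew m. P s} \<times> carrier_mat m c \<times> Skew c)"
        by (intro image_eqI[of _ _ "(s, b, t)"]) (use S in auto)
    qed
  qed
  from bij_betw_same_card[OF this] show ?thesis
    by (simp add: card_cartesian_product card_carrier_mat card_UNIV card_Skew)
qed

text \<open>Adding \<open>K\<close> permutes the skew matrices. This removes the skew block by which
  the nilpotency condition on lifts is shifted.\<close>

lemma card_translate_skew:
  assumes K: "K \<in> Skew m"
  shows "card {s \<in> Skew m. P (K + s)} = card {s \<in> Skew m. P s}"
proof (rule card_eq_by_inverse[where f = "\<lambda>s. K + s" and g = "\<lambda>s. - K + s"])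
  have Kc: "K \<in> carrier_mat m m" "adj K = - K" using K by (auto simp: Skew_iff)
  have add: "X + s \<in> Skew m" if "X \<in> Skew m" "s \<in> Skew m" for X s
    using that unfolding Skew_iff by (auto simp: adj_add intro!: eq_matI)
  have mK: "- K \<in> Skew m" using Kc by (simp add: Skew_iff)
  have c: "- K + (K + s) = s" "K + (- K + s) = s" if "s \<in> carrier_mat m m" for s
    using that Kc(1) by (auto intro!: eq_matI)
  fix s
  show "s \<in> {s \<in> Skew m. P (K + s)} \<Longrightarrow> K + s \<in> {s \<in> Skew m. P s} \<and> - K + (K + s) = s"
    using add[OF K] c(1) Skew_carrier by blast
  show "s \<in> {s \<in> Skew m. P s} \<Longrightarrow> - K + s \<in> {s \<in> Skew m. P (K + s)} \<and> K + (- K + s) = s"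
    using add[OF mK] c(2) Skew_carrier by force
qed

text \<open>A skew operator is determined by its form; prescribing it on the first block leaves an arbitrary
  skew form \<open>S\<close> on the second.\<close>

lemma skew_extension_param:
  assumes J1: "J1 \<in> Herm r" and v: "v \<in> carrier_mat r n" and d: "d \<in> Herm n"
    and H: "H1 \<in> carrier_mat r r" "u \<in> carrier_mat r n" "w \<in> carrier_mat n r" "f \<in> carrier_mat n n"
    and JH: "four_block_mat J1 v (adj v) d * four_block_mat H1 u w f = 1\<^sub>m (r + n)"
    and HJ: "four_block_mat H1 u w f * four_block_mat J1 v (adj v) d = 1\<^sub>m (r + n)"
    and B1: "B1 \<in> carrier_mat r r" "B1 * J1 \<in> Skew r"
  defines "P0 \<equiv> adj (B1 * v)"
  defines "Cof \<equiv> \<lambda>S. - P0 * H1 + S * w" and "Gof \<equiv> \<lambda>S. - P0 * u + S * f"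
  shows "card {(C, G). C \<in> carrier_mat n r \<and> G \<in> carrier_mat n n \<and>
      four_block_mat B1 (0\<^sub>m r n) C G * four_block_mat J1 v (adj v) d \<in> Skew (r + n) \<and> \<Phi> G} =
      card {S \<in> Skew n. \<Phi> (Gof S)}" (is "card ?E = card ?S")
    and "S \<in> Skew n \<Longrightarrow> four_block_mat B1 (0\<^sub>m r n) (Cof S) (Gof S) * four_block_mat J1 v (adj v) d \<in> Skew (r + n)"
proof -
  let ?J = "four_block_mat J1 v (adj v) d" and ?H = "four_block_mat H1 u w f"
  let ?low = "\<lambda>C G. four_block_mat (0\<^sub>m r r) (0\<^sub>m r n) C G"
  note J1c = Herm_carrier[OF J1] and dc = Herm_carrier[OF d]
  have vc: "adj v \<in> carrier_mat n r" using v by simp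
  have P0: "P0 \<in> carrier_mat n r" unfolding P0_def using v B1 by simp
  \<comment> \<open>The upper row of the product is already determined by \<open>B1\<close>.
    Skewness then prescribes the lower left block as \<open>- P0\<close> and requires of the lower
    right block only that it is skew itself.\<close>
  have mem: "four_block_mat B1 (0\<^sub>m r n) C G * ?J \<in> Skew (r + n) \<longleftrightarrow>
      C * J1 + G * adj v = - P0 \<and> C * v + G * d \<in> Skew n"
    if c: "C \<in> carrier_mat n r" "G \<in> carrier_mat n n" for C G
  proof -
    have "four_block_mat B1 (0\<^sub>m r n) C G * ?J =
        four_block_mat (B1 * J1) (B1 * v) (C * J1 + G * adj v) (C * v + G * d)"
      by (subst mult_four_block_mat[of _ r r _ n _ n _ _ r _ n]) (use c J1c dc v B1 in auto)
    moreover have "B1 * J1 \<in> carrier_mat r r" "B1 * v \<in> carrier_mat r n" "C * J1 + G * adj v \<in> carrier_mat n r"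
      "C * v + G * d \<in> carrier_mat n n"
      using c J1c dc v vc B1 by (auto intro!: add_carrier_mat mult_carrier_mat[of G n n])
    ultimately show ?thesis using B1(2) by (auto simp: Skew_four_block P0_def)
  qed
  have Cof: "Cof S \<in> carrier_mat n r" and Gof: "Gof S \<in> carrier_mat n n" if "S \<in> carrier_mat n n" for S
    unfolding Cof_def Gof_def using that H P0 by (auto intro!: add_carrier_mat mult_carrier_mat[of S n n])
  \<comment> \<open>The lower row \<open>(C, G)\<close> is \<open>(- P0, S)\<close> times the
    inverse of the form. Zero rows are added above so that only square matrices are
    multiplied.\<close>
  have lowH: "?low (- P0) S * ?H = ?low (Cof S) (Gof S)" if "S \<in> carrier_mat n n" for S
    unfolding Cof_def Gof_def by (rule lower_row_block_mult) (use that H P0 in auto)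
  have lowJ: "?low C G * ?J = ?low (C * J1 + G * adj v) (C * v + G * d)" if "C \<in> carrier_mat n r" "G \<in> carrier_mat n n" for C G
    by (rule lower_row_block_mult) (use that J1c dc v in auto)
  have lc: "?low C G \<in> carrier_mat (r + n) (r + n)" if "G \<in> carrier_mat n n" for C G using that by simp
  have Jc: "?J \<in> carrier_mat (r + n) (r + n)" "?H \<in> carrier_mat (r + n) (r + n)" using J1c dc H by simp_all
  have recover: "Cof S * J1 + Gof S * adj v = - P0" "Cof S * v + Gof S * d = S" if S: "S \<in> carrier_mat n n" for S
  proof -
    have "?low (Cof S * J1 + Gof S * adj v) (Cof S * v + Gof S * d) = ?low (- P0) S * ?H * ?J"
      unfolding lowH[OF S] by (rule lowJ[OF Cof[OF S] Gof[OF S], symmetric])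
    also have "\<dots> = ?low (- P0) S * (?H * ?J)" by (rule assoc_mult_mat[OF lc[OF S] Jc(2,1)])
    also have "\<dots> = ?low (- P0) S" unfolding HJ by (rule right_mult_one_mat[OF lc[OF S]])
    finally have e: "?low (Cof S * J1 + Gof S * adj v) (Cof S * v + Gof S * d) = ?low (- P0) S" .
    have c: "Cof S * J1 + Gof S * adj v \<in> carrier_mat n r" "Cof S * v + Gof S * d \<in> carrier_mat n n"
      using Cof[OF S] Gof[OF S] J1c dc v vc by (auto intro!: add_carrier_mat mult_carrier_mat[of "Gof S" n n])
    show "Cof S * J1 + Gof S * adj v = - P0" "Cof S * v + Gof S * d = S"
      using four_block_eqD(3,4)[OF e zero_carrier_mat zero_carrier_mat c zero_carrier_mat zero_carrier_mat _ S] P0 by simp_all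
  qed
  have forth: "C = Cof (C * v + G * d)" "G = Gof (C * v + G * d)"
    if c: "C \<in> carrier_mat n r" "G \<in> carrier_mat n n" "C * J1 + G * adj v = - P0" for C G
  proof -
    have S: "C * v + G * d \<in> carrier_mat n n" using c dc by (auto intro!: add_carrier_mat mult_carrier_mat[of G n n])
    have "?low C G = ?low C G * (?J * ?H)" unfolding JH by (rule right_mult_one_mat[OF lc[OF c(2)], symmetric])
    also have "\<dots> = ?low C G * ?J * ?H" by (rule assoc_mult_mat[OF lc[OF c(2)] Jc, symmetric])
    also have "\<dots> = ?low (Cof (C * v + G * d)) (Gof (C * v + G * d))"
      unfolding lowJ[OF c(1,2)] c(3) by (rule lowH[OF S])
    finally have e: "?low C G = ?low (Cof (C * v + G * d)) (Gof (C * v + G * d))" .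
    show "C = Cof (C * v + G * d)" "G = Gof (C * v + G * d)"
      using four_block_eqD(3,4)[OF e zero_carrier_mat zero_carrier_mat c(1,2) zero_carrier_mat zero_carrier_mat Cof[OF S] Gof[OF S]]
      by simp_all
  qed
  show "S \<in> Skew n \<Longrightarrow> four_block_mat B1 (0\<^sub>m r n) (Cof S) (Gof S) * ?J \<in> Skew (r + n)"
    using mem[OF Cof Gof] recover Skew_carrier by simp
  show "card ?E = card ?S"
  proof (rule card_eq_by_inverse[where f = "\<lambda>(C, G). C * v + G * d" and g = "\<lambda>S. (Cof S, Gof S)"])
    fix x assume x: "x \<in> ?E"
    obtain C G where xc: "x = (C, G)" by (cases x)
    have c: "C \<in> carrier_mat n r" "G \<in> carrier_mat n n" "C * J1 + G * adj v = - P0" "C * v + G * d \<in> Skew n" "\<Phi> G"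
      using x mem unfolding xc by auto
    show "(\<lambda>(C, G). C * v + G * d) x \<in> ?S \<and> (Cof ((\<lambda>(C, G). C * v + G * d) x), Gof ((\<lambda>(C, G). C * v + G * d) x)) = x"
      unfolding xc using c(4,5) forth[OF c(1-3)] by auto
  next
    fix S assume S: "S \<in> ?S"
    then have Sc: "S \<in> carrier_mat n n" "S \<in> Skew n" "\<Phi> (Gof S)" by (auto simp: Skew_carrier)
    show "(Cof S, Gof S) \<in> ?E \<and> (\<lambda>(C, G). C * v + G * d) (Cof S, Gof S) = S"
      using mem[OF Cof[OF Sc(1)] Gof[OF Sc(1)]] recover[OF Sc(1)] Sc Cof[OF Sc(1)] Gof[OF Sc(1)] by simp
  qed
qed

text \<open>In coordinates where the form on the quotient is \<open>diag_one m c\<close>, the quotient operator is block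
  triangular: skew on the nondegenerate part and, on the radical, dual to the nilpotent \<open>B1\<close>.\<close>

lemma quotient_operator_structure:
  assumes J: "J1 \<in> Herm r" "v \<in> carrier_mat r n" "d \<in> Herm n"
    and H: "H1 \<in> carrier_mat r r" "u \<in> carrier_mat r n" "f \<in> carrier_mat n n"
    and HH: "four_block_mat H1 u (adj u) f \<in> Herm (r + n)"
    and JH: "four_block_mat J1 v (adj v) d * four_block_mat H1 u (adj u) f = 1\<^sub>m (r + n)"
    and B1: "B1 \<in> carrier_mat r r" "nilpotent_mat B1"
    and C0: "C0 \<in> carrier_mat n r" and G0: "G0 \<in> carrier_mat n n"
    and sk: "four_block_mat B1 (0\<^sub>m r n) C0 G0 * four_block_mat J1 v (adj v) d \<in> Skew (r + n)"
    and n: "n = m + c" and y: "y \<in> carrier_mat n n" "yi \<in> carrier_mat n n" "y * yi = 1\<^sub>m n" "yi * y = 1\<^sub>m n"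
    and f: "f = adj y * diag_one m c * y"
  shows "\<exists>K11 K21 K22. y * G0 * yi = four_block_mat K11 (0\<^sub>m m c) K21 K22 \<and> K11 \<in> Skew m \<and> K21 \<in> carrier_mat c m \<and>
    K22 \<in> carrier_mat c c \<and> nilpotent_mat K22"
proof -
  let ?J = "four_block_mat J1 v (adj v) d" and ?H = "four_block_mat H1 u (adj u) f"
  let ?B = "four_block_mat B1 (0\<^sub>m r n) C0 G0" and ?D = "diag_one m c :: 'a mat"
  have D: "?D \<in> carrier_mat n n" unfolding n by simp
  note Jc = Herm_carrier[OF J(1)] and dc = Herm_carrier[OF J(3)] and Hc = Herm_carrier[OF HH]
  have Jc': "?J \<in> carrier_mat (r + n) (r + n)" and Bc: "?B \<in> carrier_mat (r + n) (r + n)" using Jc dc B1 G0 by simp_all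
  \<comment> \<open>As \<open>?H\<close> is Hermitian and inverse to \<open>?J\<close>,
    \<open>?H * ?B\<close> is the congruence of \<open>?B * ?J\<close> by \<open>?H\<close>.
    Skewness thus passes to the inverse form, whose block \<open>f\<close> is the form belonging to
    \<open>G0\<close>.\<close>
  have "?H * ?B = ?H * (?B * (?J * ?H))" unfolding JH right_mult_one_mat[OF Bc] ..
  also have "\<dots> = ?H * (?B * ?J) * ?H"
    unfolding assoc_mult_mat[OF Bc Jc' Hc, symmetric]
    by (rule assoc_mult_mat[OF Hc mult_carrier_mat[OF Bc Jc'] Hc, symmetric])
  also have "\<dots> = ?H * (?B * ?J) * adj ?H" using HH by (simp add: Herm_def)
  finally have "?H * ?B \<in> Skew (r + n)" using Skew_conj[OF sk Hc] by simp
  moreover have "?H * ?B = four_block_mat (H1 * B1 + u * C0) (u * G0) (adj u * B1 + f * C0) (f * G0)"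
    by (subst mult_four_block_mat[of _ r r _ n _ n _ _ r _ n]) (use H B1 C0 G0 in auto)
  moreover have "H1 * B1 + u * C0 \<in> carrier_mat r r" "u * G0 \<in> carrier_mat r n" "adj u * B1 + f * C0 \<in> carrier_mat n r" "f * G0 \<in> carrier_mat n n"
    using H B1 C0 G0 by (auto intro!: add_carrier_mat mult_carrier_mat[of f n n] mult_carrier_mat[of u r n])
  ultimately have fG: "f * G0 \<in> Skew n" and uG: "adj u * B1 + f * C0 = - adj (u * G0)"
    using Skew_four_block[of "H1 * B1 + u * C0" r "u * G0" n "adj u * B1 + f * C0" "f * G0"] by auto
  have "f \<in> Herm n" using HH Herm_four_block[of H1 r u n "adj u" f] H by simp
  then have fadj: "adj f = f" by (simp add: Herm_def)
  have uG': "u * G0 = - (adj B1 * u + adj C0 * f)"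
  proof -
    have "adj (adj u * B1 + f * C0) = - (u * G0)" unfolding uG by simp
    then have "adj B1 * u + adj C0 * f = - (u * G0)" using H B1 C0 by (simp add: adj_add adj_mult fadj)
    then show ?thesis by simp
  qed
  let ?G = "y * G0 * yi"
  have ayi: "adj yi * (adj y * X) = X" if "dim_row X = n" for X
  proof (rule mat_cancel[of _ _ n])
    show "adj yi * adj y = 1\<^sub>m n" using y by (simp flip: adj_mult)
  qed (use y that in auto)
  have G: "?G \<in> carrier_mat n n" using y G0 by simp
  \<comment> \<open>Congruence by \<open>adj yi\<close> turns \<open>f\<close> into the normal form
    and \<open>G0\<close> into its conjugate \<open>?G\<close>.\<close>
  have "adj yi * (f * G0) * adj (adj yi) = ?D * ?G"
    unfolding f using y G0 by (simp add: mat_assoc ayi n[symmetric])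
  then have DG: "?D * ?G \<in> Skew n" using Skew_conj[OF fG, of "adj yi"] y by simp
  obtain K11 K12 K21 K22 where K: "?G = four_block_mat K11 K12 K21 K22" "K11 \<in> carrier_mat m m" "K12 \<in> carrier_mat m c"
    "K21 \<in> carrier_mat c m" "K22 \<in> carrier_mat c c" using four_block_cases[OF G[unfolded n]] by metis
  \<comment> \<open>Multiplying by \<open>?D\<close> on the left erases the lower rows, so skewness
    of the result makes \<open>K11\<close> skew and \<open>K12\<close> zero.\<close>
  have "?D * ?G = four_block_mat K11 K12 (0\<^sub>m c m) (0\<^sub>m c c)"
    unfolding K(1) diag_one_def by (subst mult_four_block_mat[of _ m m _ c _ c _ _ m _ c]) (use K in auto)
  then have K11: "K11 \<in> Skew m" and "0\<^sub>m c m = - adj K12"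
    using DG[unfolded n] Skew_four_block[OF K(2,3), of "0\<^sub>m c m" "0\<^sub>m c c"] by auto
  then have "adj (- adj K12) = 0\<^sub>m m c" using adj_zero by metis
  then have "- K12 = 0\<^sub>m m c" by simp
  then have "- (- K12) = 0\<^sub>m m c" by simp
  then have K12: "K12 = 0\<^sub>m m c" by simp
  \<comment> \<open>\<open>P\<close> projects onto the radical of the normal form and
    \<open>Z\<close> is the part of \<open>?G\<close> acting there; the matrix \<open>yi * P\<close>
    below maps into the kernel of \<open>f\<close>.\<close>
  define P where "P = (four_block_mat (0\<^sub>m m m) (0\<^sub>m m c) (0\<^sub>m c m) (1\<^sub>m c) :: 'a mat)"
  define Z where "Z = four_block_mat (0\<^sub>m m m) (0\<^sub>m m c) (0\<^sub>m c m) K22"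
  have P: "P \<in> carrier_mat n n" and Z: "Z \<in> carrier_mat n n" unfolding n P_def Z_def using K by simp_all
  have GP: "?G * P = Z" unfolding K(1) K12 P_def Z_def
    by (subst mult_four_block_mat[of _ m m _ c _ c _ _ m _ c]) (use K in auto)
  have PZ: "P * Z = Z" unfolding P_def Z_def
    by (subst mult_four_block_mat[of _ m m _ c _ c _ _ m _ c]) (use K in auto)
  have DP: "?D * P = 0\<^sub>m n n" unfolding diag_one_def n P_def
    by (subst mult_four_block_mat[of _ m m _ c _ c _ _ m _ c]) auto
  define X where "X = yi * P"
  have X: "X \<in> carrier_mat n n" unfolding X_def using y P by simp
  have yX: "y * X = P" unfolding X_def by (rule mat_cancel[OF y(3,1,2)]) (use P in auto)
  have fX: "f * X = 0\<^sub>m n n"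
  proof -
    have "f * X = adj y * (?D * (y * X))" unfolding f using y X by (simp add: mat_assoc n[symmetric])
    then show ?thesis unfolding yX DP using y by simp
  qed
  define w where "w = u * X"
  have w: "w \<in> carrier_mat r n" unfolding w_def by (rule mult_carrier_mat[OF H(2) X])
  have XZ: "X * Z = G0 * X"
  proof -
    have "X * Z = yi * (P * Z)" unfolding X_def using y P Z by (simp add: mat_assoc)
    also have "P * Z = ?G * P" unfolding PZ GP ..
    also have "yi * (?G * P) = yi * (y * (G0 * X))" unfolding X_def using y P G0 by (simp add: mat_assoc)
    finally show ?thesis using mat_cancel[OF y(4,2,1), of "G0 * X"] G0 by simp
  qed
  \<comment> \<open>On the kernel of \<open>f\<close> the second term of \<open>uG'\<close>
    disappears, so \<open>u\<close> intertwines the action on the radical with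
    \<open>- adj B1\<close>.\<close>
  have wZ: "w * Z = - adj B1 * w"
  proof -
    have "w * Z = u * (X * Z)" unfolding w_def using H X Z by (simp add: mat_assoc)
    then have "w * Z = (u * G0) * X" unfolding XZ using H X G0 by (simp add: mat_assoc)
    then have "w * Z = - (adj B1 * (u * X) + adj C0 * (f * X))"
      unfolding uG' using H X B1 C0 by (simp add: mat_assoc mat_add_distrib_right)
    then show ?thesis unfolding fX w_def[symmetric] using w B1 C0 by simp
  qed
  have nB: "nilpotent_mat (- adj B1)"
    unfolding uminus_eq_smult using nilpotent_adj[OF B1] nilpotent_smult_iff[of "-1" "adj B1" r] B1 by simp
  have mB: "- adj B1 \<in> carrier_mat r r" using B1 by simp
  obtain N where N: "(- adj B1) ^\<^sub>m N = 0\<^sub>m r r" using nB nilpotent_mat_iff[OF mB] by blast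
  have wN: "w * Z ^\<^sub>m N = 0\<^sub>m r n"
    unfolding nilpotent_intertwine[OF wZ w Z mB] N using w by simp
  \<comment> \<open>A block of the equation \<open>J * H = 1\<close>. On the kernel of
    \<open>f\<close> it makes \<open>adj v\<close> a left inverse of \<open>u\<close>, so the
    intertwining map is injective there and \<open>K22\<close> inherits nilpotency from
    \<open>- adj B1\<close>.\<close>
  have v4: "adj v * u + d * f = 1\<^sub>m n"
    using four_block_mult_eq_one(4)[OF Jc J(2) _ dc H(1,2) _ H(3) JH] J(2) H(2) by simp
  have yv: "y * (adj v * w) = P"
  proof -
    have "(adj v * u + d * f) * X = X" unfolding v4 using X by simp
    then have "adj v * w + d * (f * X) = X"
      unfolding w_def using J(2) H dc X by (simp add: mat_assoc mat_add_distrib_right)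
    moreover have "d * (f * X) = 0\<^sub>m n n" unfolding fX using dc by simp
    moreover have "adj v * w \<in> carrier_mat n n" by (rule mult_carrier_mat[of _ n r]) (use J(2) w in auto)
    ultimately have "adj v * w = X" by (rule mat_add_zero_cancel)
    then show ?thesis using yX by simp
  qed
  have ZN: "Z ^\<^sub>m N \<in> carrier_mat n n" using Z by simp
  have "P * Z ^\<^sub>m N = y * (adj v * (w * Z ^\<^sub>m N))"
    unfolding yv[symmetric] using y(1) J(2) w Z by (simp add: mat_assoc)
  then have PN: "P * Z ^\<^sub>m N = 0\<^sub>m n n" unfolding wN using y J(2) by simp
  have "Z ^\<^sub>m N = four_block_mat (0\<^sub>m m m ^\<^sub>m N) (0\<^sub>m m c) (0\<^sub>m c m) (K22 ^\<^sub>m N)"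
    unfolding Z_def by (rule pow_four_block_mat) (use K in auto)
  then have "P * Z ^\<^sub>m N = four_block_mat (0\<^sub>m m m) (0\<^sub>m m c) (0\<^sub>m c m) (K22 ^\<^sub>m N)"
    unfolding P_def by (simp only:) (subst mult_four_block_mat[of _ m m _ c _ c _ _ m _ c], use K in auto)
  then have e: "four_block_mat (0\<^sub>m m m) (0\<^sub>m m c) (0\<^sub>m c m) (K22 ^\<^sub>m N) = four_block_mat (0\<^sub>m m m) (0\<^sub>m m c) (0\<^sub>m c m) (0\<^sub>m c c)"
    using PN by (simp add: n)
  have "K22 ^\<^sub>m N = 0\<^sub>m c c"
    by (rule four_block_eqD(4)[OF e, of m m c c]) (use K(5) in simp_all)
  then have "nilpotent_mat K22" using nilpotent_mat_iff[OF K(5)] by blast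
  then show ?thesis using K K11 K12 by blast
qed

text \<open>In coordinates that normalise \<open>f\<close>, the free skew parameter \<open>S\<close>
  enters the lifted block through \<open>S * diag_one m c\<close>, hence only by its first block
  column. The lift becomes block triangular with diagonal blocks \<open>K11 + s\<close> and
  \<open>K22\<close>. The latter is nilpotent already, so nilpotency restricts only the upper left
  block \<open>s\<close> of \<open>S\<close>.\<close>

lemma card_nilpotent_skew_extensions:
  assumes J: "J1 \<in> Herm r" "(v, d) \<in> completions k J1" "card (ker_mat J1) = (q ^ 2) ^ c"
    and B1: "B1 \<in> carrier_mat r r" "B1 * J1 \<in> Skew r" "nilpotent_mat B1"
  shows "c \<le> k" and "card {(C, G). C \<in> carrier_mat k r \<and> G \<in> carrier_mat k k \<and>
      four_block_mat B1 (0\<^sub>m r k) C G * four_block_mat J1 v (adj v) d \<in> Skew (r + k) \<and> nilpotent_mat G} =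
    card (nil_skew (k - c)) * ((q ^ 2) ^ ((k - c) * c) * q ^ (c ^ 2))" (is "card ?E = _")
proof -
  note J1c = Herm_carrier[OF J(1)]
  have vd: "v \<in> carrier_mat r k" "d \<in> Herm k" "four_block_mat J1 v (adj v) d \<in> GL (r + k)"
    using J(2) in_completions[OF J1c] by auto
  note dc = Herm_carrier[OF vd(2)]
  let ?J = "four_block_mat J1 v (adj v) d"
  have va: "adj v \<in> carrier_mat k r" using vd by simp
  have JH: "?J \<in> Herm (r + k)" using Herm_four_block[OF J1c vd(1) va dc] J(1) vd(2) by simp
  have Hi: "mat_inv ?J \<in> Herm (r + k)" by (rule mat_inv_Herm[OF vd(3) JH])
  obtain H1 u w f where H: "mat_inv ?J = four_block_mat H1 u w f" "H1 \<in> carrier_mat r r" "u \<in> carrier_mat r k"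
    "w \<in> carrier_mat k r" "f \<in> carrier_mat k k" using four_block_cases[OF Herm_carrier[OF Hi]] by metis
  have w: "w = adj u" and fH: "f \<in> Herm k" using Hi Herm_four_block[OF H(2-5)] unfolding H(1) by auto
  have 1: "?J * four_block_mat H1 u w f = 1\<^sub>m (r + k)" "four_block_mat H1 u w f * ?J = 1\<^sub>m (r + k)"
    using mat_inv(2,3)[OF vd(3)] unfolding H(1) by auto
  \<comment> \<open>\<open>f\<close> and \<open>J1\<close> are complementary blocks of inverse
    matrices and share their corank, so \<open>k = m + c\<close> with \<open>m\<close> the rank of
    \<open>f\<close>.\<close>
  have "card (ker_mat f) = (q ^ 2) ^ c"
    using card_ker_inverse_block[OF J1c vd(1) va dc H(2-5) 1] J(3) by simp
  moreover obtain m k' Y where Y: "k = m + k'" "Y \<in> GL k" "f = Y * diag_one m k' * adj Y" "card (ker_mat f) = (q ^ 2) ^ k'"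
    using Herm_cases_rank[OF fH] by metis
  ultimately have k: "k = m + c" and f: "f = Y * diag_one m c * adj Y" using q2_power_inject by auto
  show "c \<le> k" using k by simp
  define y where "y = adj Y"
  have yG: "y \<in> GL k" unfolding y_def by (rule adj_GL[OF Y(2)])
  obtain yi where yi: "yi \<in> GL k" "y * yi = 1\<^sub>m k" "yi * y = 1\<^sub>m k" using GL_inverse[OF yG] .
  note yc = GL_carrier[OF yG] GL_carrier[OF yi(1)]
  have f': "f = adj y * diag_one m c * y" unfolding f y_def by simp
  let ?P0 = "adj (B1 * v)"
  let ?Gof = "\<lambda>S. - ?P0 * u + S * f" and ?Cof = "\<lambda>S. - ?P0 * H1 + S * w"
  note param = skew_extension_param[OF J(1) vd(1,2) H(2-5) 1 B1(1,2)]
  have z: "(0\<^sub>m k k :: 'a mat) \<in> Skew k" by (simp add: Skew_iff)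
  have P0: "?P0 \<in> carrier_mat k r" using B1 vd by simp
  define G0 where "G0 = - ?P0 * u"
  have G0: "G0 \<in> carrier_mat k k" unfolding G0_def using P0 H(3) by simp
  have C0: "- ?P0 * H1 \<in> carrier_mat k r" using P0 H(2) by simp
  \<comment> \<open>The lift with \<open>S = 0\<close> serves as base point; all lifts form an
    affine family around it.\<close>
  have "?Gof (0\<^sub>m k k) = G0" "?Cof (0\<^sub>m k k) = - ?P0 * H1"
    using G0 C0 H(4,5) unfolding G0_def by simp_all
  then have sk: "four_block_mat B1 (0\<^sub>m r k) (- ?P0 * H1) G0 * ?J \<in> Skew (r + k)"
    using param(2)[OF z] by simp
  obtain K11 K21 K22 where K: "y * G0 * yi = four_block_mat K11 (0\<^sub>m m c) K21 K22" "K11 \<in> Skew m" "K21 \<in> carrier_mat c m"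
    "K22 \<in> carrier_mat c c" "nilpotent_mat K22"
    using quotient_operator_structure[OF J(1) vd(1,2) H(2,3,5) Hi[unfolded H(1) w] 1(1)[unfolded w] B1(1,3) C0 G0 sk k yc yi(2,3) f']
    by blast
  note K11 = Skew_carrier[OF K(2)]
  let ?D = "diag_one m c :: 'a mat"
  have D: "?D \<in> carrier_mat k k" unfolding k by simp
  have conjG: "y * ?Gof S * yi = y * G0 * yi + (y * S * adj y) * ?D" if S: "S \<in> carrier_mat k k" for S
  proof -
    have "y * (?Gof S) * yi = y * (G0 * yi) + y * (S * (adj y * (?D * (y * yi))))"
      unfolding G0_def[symmetric] f' using yc S G0 by (simp add: mat_assoc mat_add_distrib_left mat_add_distrib_right k[symmetric])
    then show ?thesis using yc S G0 yi(2) by (simp add: mat_assoc k[symmetric])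
  qed
  have nil: "nilpotent_mat (y * G0 * yi + S * ?D) \<longleftrightarrow> nilpotent_mat (K11 + s)"
    if S: "S = four_block_mat s b (- adj b) t" "s \<in> carrier_mat m m" "b \<in> carrier_mat m c" "t \<in> carrier_mat c c" for S s b t
  proof -
    have "S * ?D = four_block_mat s (0\<^sub>m m c) (- adj b) (0\<^sub>m c c)"
      unfolding S(1) diag_one_def by (subst mult_four_block_mat[of _ m m _ c _ c _ _ m _ c]) (use S in auto)
    then have "y * G0 * yi + S * ?D = four_block_mat (K11 + s) (0\<^sub>m m c) (K21 + - adj b) K22"
      unfolding K(1) by (simp only:) (subst add_four_block_mat[of _ m m _ c _ c], use S K K11 in auto)
    moreover have "K11 + s \<in> carrier_mat m m" "K21 + - adj b \<in> carrier_mat c m" using S by auto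
    ultimately show ?thesis using nilpotent_four_block_lower[of "K11 + s" m "K21 + - adj b" c K22] K by simp
  qed
  have "card ?E = card {S \<in> Skew k. nilpotent_mat (?Gof S)}" by (rule param(1))
  \<comment> \<open>The lift is conjugated by \<open>y\<close> while \<open>y * S * adj y\<close>
    replaces \<open>S\<close>; the former keeps nilpotency and the latter skewness.\<close>
  also have "\<dots> = card {S \<in> Skew k. nilpotent_mat (y * G0 * yi + S * ?D)}"
  proof (rule card_eq_by_inverse[where f = "\<lambda>S. y * S * adj y" and g = "\<lambda>S. yi * S * adj yi"])
    have ay: "adj y * adj yi = 1\<^sub>m k" "adj yi * adj y = 1\<^sub>m k" using yi yc by (simp_all flip: adj_mult)
    have canc: "yi * (y * S * adj y) * adj yi = S" "y * (yi * S * adj yi) * adj y = S" if S: "S \<in> carrier_mat k k" for S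
    proof -
      have "yi * (y * S * adj y) * adj yi = yi * (y * (S * (adj y * adj yi)))" using yc S by (simp add: mat_assoc)
      then show "yi * (y * S * adj y) * adj yi = S" unfolding ay using mat_cancel[OF yi(3) yc(2,1), of S] S by simp
      have "y * (yi * S * adj yi) * adj y = y * (yi * (S * (adj yi * adj y)))" using yc S by (simp add: mat_assoc)
      then show "y * (yi * S * adj yi) * adj y = S" unfolding ay using mat_cancel[OF yi(2) yc, of S] S by simp
    qed
    have nilc: "nilpotent_mat (?Gof S) \<longleftrightarrow> nilpotent_mat (y * G0 * yi + (y * S * adj y) * ?D)" if S: "S \<in> carrier_mat k k" for S
    proof -
      have "?Gof S \<in> carrier_mat k k" using S H(5) by (intro add_carrier_mat) simp
      then show ?thesis unfolding conjG[OF S, symmetric] using nilpotent_conj[OF yi(2,3) yc] by blast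
    qed
    fix S
    show "S \<in> {S \<in> Skew k. nilpotent_mat (?Gof S)} \<Longrightarrow>
      y * S * adj y \<in> {S \<in> Skew k. nilpotent_mat (y * G0 * yi + S * ?D)} \<and> yi * (y * S * adj y) * adj yi = S"
      using Skew_conj[OF _ yc(1), of S] nilc[of S] canc(1)[of S] Skew_carrier[of S k] by blast
    assume S: "S \<in> {S \<in> Skew k. nilpotent_mat (y * G0 * yi + S * ?D)}"
    then have S': "yi * S * adj yi \<in> Skew k" using Skew_conj[OF _ yc(2), of S] by blast
    have Sc: "S \<in> carrier_mat k k" using S Skew_carrier by blast
    have "nilpotent_mat (?Gof (yi * S * adj yi))"
      using nilc[OF Skew_carrier[OF S']] S unfolding canc(2)[OF Sc] by blast
    then show "yi * S * adj yi \<in> {S \<in> Skew k. nilpotent_mat (?Gof S)} \<and> y * (yi * S * adj yi) * adj y = S"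
      using S' canc(2)[OF Sc] by blast
  qed
  also have "{S \<in> Skew k. nilpotent_mat (y * G0 * yi + S * ?D)} =
    {S \<in> Skew (m + c). \<exists>s \<in> carrier_mat m m. \<exists>b \<in> carrier_mat m c. \<exists>t \<in> carrier_mat c c.
      S = four_block_mat s b (- adj b) t \<and> nilpotent_mat (K11 + s)}" (is "?L = ?R")
  proof (intro equalityI subsetI)
    fix S assume "S \<in> ?L"
    then have S: "S \<in> Skew (m + c)" "nilpotent_mat (y * G0 * yi + S * ?D)" using k by auto
    obtain s b x t where bl: "S = four_block_mat s b x t" "s \<in> carrier_mat m m" "b \<in> carrier_mat m c" "x \<in> carrier_mat c m"
      "t \<in> carrier_mat c c" using four_block_cases[OF Skew_carrier[OF S(1)]] by metis
    have "x = - adj b" using S(1) Skew_four_block[OF bl(2-5)] unfolding bl(1) by simp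
    then show "S \<in> ?R" using S nil bl by blast
  next
    fix S assume "S \<in> ?R"
    then show "S \<in> ?L" using nil k by blast
  qed
  also have "card ?R = card {s \<in> Skew m. nilpotent_mat (K11 + s)} * ((q ^ 2) ^ (m * c) * q ^ (c ^ 2))"
    by (rule card_Skew_top_left)
  also have "card {s \<in> Skew m. nilpotent_mat (K11 + s)} = card (nil_skew m)"
    unfolding nil_skew_def by (rule card_translate_skew[OF K(2)])
  also have "m = k - c" using k by simp
  finally show "card ?E = card (nil_skew (k - c)) * ((q ^ 2) ^ ((k - c) * c) * q ^ (c ^ 2))" .
qed

end

subsection \<open>Recursion for commuting nilpotent pairs\<close>

lemma nilpotent_zero [simp]: "nilpotent_mat (0\<^sub>m n n :: 'a::field mat)"
  unfolding nilpotent_mat_def by (intro exI[of _ 1]) simp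

lemma smult_eq_iff:
  assumes "c \<noteq> 0"
  shows "c \<cdot>\<^sub>m A = c \<cdot>\<^sub>m B \<longleftrightarrow> A = (B :: 'a::field mat)"
  using assms by (metis left_inverse mat_smult_one mat_smult_smult)

text \<open>Powers of an invertible matrix are invertible, whereas the zero matrix of positive size
  is not.\<close>

lemma nilpotent_not_GL:
  assumes A: "A \<in> carrier_mat n n" and "nilpotent_mat (A :: 'a::field mat)" "n > 0"
  shows "A \<notin> GL n"
proof
  assume g: "A \<in> GL n"
  obtain k where k: "A ^\<^sub>m k = 0\<^sub>m n n" using assms nilpotent_mat_iff by blast
  have "A ^\<^sub>m j \<in> GL n" for j
  proof (induction j)
    case 0
    show ?case using A by simp
  next
    case (Suc j)
    show ?case unfolding pow_mat.simps by (rule GL_mult[OF Suc g])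
  qed
  from this[of k] have "(0\<^sub>m n n :: 'a mat) \<in> GL n" unfolding k .
  from GL_D[OF this unit_vec_carrier zero_mult_vec[OF unit_vec_carrier]]
  have "(unit_vec n 0 :: 'a vec) = 0\<^sub>v n" .
  then have "(unit_vec n 0 :: 'a vec) $ 0 = 0\<^sub>v n $ 0" by simp
  then show False using assms(3) by simp
qed

context unitary_field
begin

text \<open>With the flag \<open>z\<close> set, the second component is forced to be zero, so that pairs and single
  nilpotent elements are counted by the same argument.\<close>

definition nil_pairs :: "bool \<Rightarrow> nat \<Rightarrow> ('a mat \<times> 'a mat) set" where
  "nil_pairs z n = {(A, B). A \<in> nil_skew n \<and> B \<in> nil_skew n \<and> A * B = B * A \<and> (z \<longrightarrow> B = 0\<^sub>m n n)}"

definition nil_pairs_corank :: "bool \<Rightarrow> nat \<Rightarrow> nat \<Rightarrow> ('a mat \<times> 'a mat) set" where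
  "nil_pairs_corank z n k = {(A, B) \<in> nil_pairs z n. card (ker_mat A) = (q ^ 2) ^ k}"

definition Skew_rank :: "nat \<Rightarrow> nat \<Rightarrow> 'a mat set" where
  "Skew_rank r k = {N \<in> Skew (r + k). card (ker_mat N) = (q ^ 2) ^ k}"

text \<open>Triples \<open>(J, N, B)\<close>: a Hermitian form \<open>J\<close> on the dual space, a skew form \<open>N\<close>, and an operator \<open>B\<close>
  that is skew for \<open>J\<close> and commutes with \<open>J * N\<close>.\<close>

definition form_triples :: "bool \<Rightarrow> nat \<Rightarrow> nat \<Rightarrow> ('a mat \<times> 'a mat \<times> 'a mat) set" where
  "form_triples z r k = {(J, N, B). J \<in> Herm (r + k) \<and> J \<in> GL (r + k) \<and> N \<in> Skew_rank r k \<and>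
     B \<in> carrier_mat (r + k) (r + k) \<and> nilpotent_mat (J * N) \<and> nilpotent_mat B \<and> B * J \<in> Skew (r + k) \<and>
     (J * N) * B = B * (J * N) \<and> (z \<longrightarrow> B = 0\<^sub>m (r + k) (r + k))}"

text \<open>Change of coordinates by \<open>g\<close>, with \<open>h\<close> meant to be its
  inverse: \<open>J\<close> transforms as a form on the dual space, \<open>N\<close> as a form on
  the space and \<open>B\<close> as an operator, so \<open>J * N\<close> is conjugated together with
  \<open>B\<close>.\<close>

definition act :: "'a mat \<Rightarrow> 'a mat \<Rightarrow> 'a mat \<times> 'a mat \<times> 'a mat \<Rightarrow> 'a mat \<times> 'a mat \<times> 'a mat" where
  "act g h = (\<lambda>(J, N, B). (g * J * adj g, adj h * N * h, g * B * h))"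

lemma Skew_rank_carrier: "N \<in> Skew_rank r k \<Longrightarrow> N \<in> carrier_mat (r + k) (r + k)"
  by (simp add: Skew_rank_def Skew_carrier)

lemma finite_form_triples [simp]: "finite (form_triples z r k)"
  by (rule finite_subset[of _ "carrier_mat (r + k) (r + k) \<times> carrier_mat (r + k) (r + k) \<times> carrier_mat (r + k) (r + k)"])
    (auto simp: form_triples_def Herm_carrier Skew_rank_carrier)

lemma act_form_triples:
  assumes gh: "g * h = 1\<^sub>m (r + k)" "h * g = 1\<^sub>m (r + k)" "g \<in> carrier_mat (r + k) (r + k)" "h \<in> carrier_mat (r + k) (r + k)"
    and x: "x \<in> form_triples z r k"
  shows "act g h x \<in> form_triples z r k" "act h g (act g h x) = x"
proof -
  define n where "n = r + k"
  obtain J N B where xJ: "x = (J, N, B)" by (cases x)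
  have J: "J \<in> Herm n" "J \<in> GL n" and N: "N \<in> Skew_rank r k" and B: "B \<in> carrier_mat n n"
    and nil: "nilpotent_mat (J * N)" "nilpotent_mat B" and BJ: "B * J \<in> Skew n" and cm: "(J * N) * B = B * (J * N)"
    and z: "z \<longrightarrow> B = 0\<^sub>m n n" using x unfolding xJ form_triples_def n_def by auto
  note gh = gh[folded n_def]
  have Jc: "J \<in> carrier_mat n n" and Nc: "N \<in> carrier_mat n n"
    using Herm_carrier[OF J(1)] Skew_rank_carrier[OF N] n_def by auto
  have JN: "J * N \<in> carrier_mat n n" using Jc Nc by simp
  have g: "g \<in> GL n" "h \<in> GL n" using GL_if_inverse[OF gh(3,4,1)] GL_if_inverse[OF gh(4,3,2)] by auto
  have agh: "adj g * adj h = 1\<^sub>m n" "adj h * adj g = 1\<^sub>m n" using gh by (simp_all flip: adj_mult)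
  have ac: "adj g \<in> carrier_mat n n" "adj h \<in> carrier_mat n n" using gh by simp_all
  have hg: "h * (g * X) = X" and gh': "g * (h * X) = X" and agh': "adj g * (adj h * X) = X" and ahg': "adj h * (adj g * X) = X"
    if "dim_row X = n" for X
    using mat_cancel[OF gh(2,4,3) that] mat_cancel[OF gh(1,3,4) that] mat_cancel[OF agh(1) ac that] mat_cancel[OF agh(2) ac(2,1) that] by auto
  let ?J = "g * J * adj g" and ?N = "adj h * N * h" and ?B = "g * B * h"
  have J': "?J \<in> Herm n" "?J \<in> GL n" using Herm_conj[OF J(1) gh(3)] GL_mult[OF GL_mult[OF g(1) J(2)] adj_GL[OF g(1)]] by auto
  have N': "?N \<in> Skew_rank r k"
    using N Skew_conj[of N n "adj h"] card_ker_conj[OF adj_GL[OF g(2)] g(2) Nc] ac unfolding Skew_rank_def n_def by simp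
  have B': "?B \<in> carrier_mat n n" using gh B by simp
  have JN': "?J * ?N = g * (J * N) * h" using gh Jc Nc by (simp add: mat_assoc agh')
  have BJ': "?B * ?J = g * (B * J) * adj g" using gh Jc B by (simp add: mat_assoc hg)
  have n': "nilpotent_mat (?J * ?N)" "nilpotent_mat ?B"
    unfolding JN' using nilpotent_conj[OF gh JN] nilpotent_conj[OF gh B] nil by blast+
  have BJs: "?B * ?J \<in> Skew n" unfolding BJ' by (rule Skew_conj[OF BJ gh(3)])
  have "(?J * ?N) * ?B = g * ((J * N) * B) * h" unfolding JN' using gh Jc Nc B by (simp add: mat_assoc hg)
  also have "\<dots> = g * (B * (J * N)) * h" unfolding cm ..
  also have "\<dots> = ?B * (?J * ?N)" unfolding JN' using gh Jc Nc B by (simp add: mat_assoc hg)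
  finally have cm': "(?J * ?N) * ?B = ?B * (?J * ?N)" .
  have z': "z \<longrightarrow> ?B = 0\<^sub>m n n" using z gh by auto
  show "act g h x \<in> form_triples z r k"
    unfolding xJ act_def form_triples_def split mem_Collect_eq n_def[symmetric] using J' N' B' n' BJs cm' z' by blast
  have "h * ?J * adj h = J" using gh Jc ac agh by (simp add: mat_assoc hg)
  moreover have "adj g * ?N * g = N" using gh Nc by (simp add: mat_assoc agh')
  moreover have "h * ?B * g = B" using gh B by (simp add: mat_assoc hg)
  ultimately show "act h g (act g h x) = x" unfolding xJ act_def by simp
qed

lemma card_act_fibre:
  assumes gh: "g * h = 1\<^sub>m (r + k)" "h * g = 1\<^sub>m (r + k)" "g \<in> carrier_mat (r + k) (r + k)" "h \<in> carrier_mat (r + k) (r + k)"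
    and P: "\<And>x. x \<in> form_triples z r k \<Longrightarrow> P x \<Longrightarrow> P' (act g h x)"
    and P': "\<And>x. x \<in> form_triples z r k \<Longrightarrow> P' x \<Longrightarrow> P (act h g x)"
  shows "card {x \<in> form_triples z r k. P' x} = card {x \<in> form_triples z r k. P x}"
  by (rule card_eq_by_inverse[where f = "act h g" and g = "act g h"])
    (use act_form_triples[OF gh] act_form_triples[OF gh(2,1,4,3)] P P' in blast)+

text \<open>The nondegenerate Hermitian forms are a single orbit, so every \<open>J\<close> occurs
  equally often. For \<open>J = 1\<close> the operator \<open>J * N\<close> is \<open>N\<close>
  itself and the remaining conditions are those of a pair.\<close>

lemma card_form_triples_J:
  "card (form_triples z r k) = card (Herm_rank (r + k) 0) * card (nil_pairs_corank z (r + k) k)"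
proof -
  define n where "n = r + k"
  let ?T = "form_triples z r k"
  have D1: "diag_one n 0 = (1\<^sub>m n :: 'a mat)" by (rule eq_matI) (auto simp: diag_one_def)
  have F1: "card {x \<in> ?T. fst x = 1\<^sub>m n} = card (nil_pairs_corank z n k)"
  proof (rule card_eq_by_inverse[where f = snd and g = "\<lambda>(N, B). (1\<^sub>m n, N, B)"])
    fix x assume "x \<in> {x \<in> ?T. fst x = 1\<^sub>m n}"
    then obtain N B where x: "x = (1\<^sub>m n, N, B)" "(1\<^sub>m n, N, B) \<in> ?T" by (cases x) auto
    then have N: "N \<in> Skew n" "card (ker_mat N) = (q ^ 2) ^ k" and B: "B \<in> carrier_mat n n"
      and *: "nilpotent_mat (1\<^sub>m n * N)" "nilpotent_mat B" "B * 1\<^sub>m n \<in> Skew n"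
        "(1\<^sub>m n * N) * B = B * (1\<^sub>m n * N)" "z \<longrightarrow> B = 0\<^sub>m n n"
      unfolding form_triples_def Skew_rank_def n_def[symmetric] by blast+
    have e: "1\<^sub>m n * N = N" "B * 1\<^sub>m n = B" using Skew_carrier[OF N(1)] B by auto
    show "snd x \<in> nil_pairs_corank z n k \<and> (\<lambda>(N, B). (1\<^sub>m n, N, B)) (snd x) = x"
      unfolding x(1) nil_pairs_corank_def nil_pairs_def nil_skew_def using N *[unfolded e] by simp
  next
    fix x assume x: "x \<in> nil_pairs_corank z n k"
    obtain A B where xA: "x = (A, B)" by (cases x)
    have A: "A \<in> Skew n" "nilpotent_mat A" "B \<in> Skew n" "nilpotent_mat B" "A * B = B * A" "z \<longrightarrow> B = 0\<^sub>m n n"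
      "card (ker_mat A) = (q ^ 2) ^ k"
      using x unfolding xA nil_pairs_corank_def nil_pairs_def nil_skew_def by auto
    have c: "A \<in> carrier_mat n n" "B \<in> carrier_mat n n" using A Skew_carrier by auto
    have e: "1\<^sub>m n * A = A" "B * 1\<^sub>m n = B" "1\<^sub>m n \<in> Herm n" using c by (auto simp: Herm_def)
    show "(\<lambda>(N, B). (1\<^sub>m n, N, B)) x \<in> {x \<in> ?T. fst x = 1\<^sub>m n} \<and> snd ((\<lambda>(N, B). (1\<^sub>m n, N, B)) x) = x"
      unfolding xA form_triples_def split n_def[symmetric] Skew_rank_def mem_Collect_eq e fst_conv snd_conv
      using A c e GL_one by blast
  qed
  have "card ?T = (\<Sum>J\<in>Herm_rank n 0. card (nil_pairs_corank z n k))"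
  proof (rule card_by_fibres[where f = fst])
    show "finite ?T" "finite (Herm_rank n 0)" by simp_all
    show "fst x \<in> Herm_rank n 0" if "x \<in> ?T" for x
      using that GL_iff_card_ker[of "fst x" n] by (cases x) (auto simp: form_triples_def Herm_rank_def n_def Herm_carrier)
    fix J assume "J \<in> Herm_rank n 0"
    then obtain g where g: "g \<in> GL (n + 0)" "J = g * diag_one n 0 * adj g" by (rule Herm_rankE)
    obtain h where h: "h \<in> GL n" "g * h = 1\<^sub>m n" "h * g = 1\<^sub>m n" using GL_inverse g(1) by (metis add_0_right)
    have gc: "g \<in> carrier_mat n n" "h \<in> carrier_mat n n" using g(1) h(1) GL_carrier by auto
    have J: "J = g * 1\<^sub>m n * adj g" using g(2) unfolding D1 .
    have ahg: "adj g * adj h = 1\<^sub>m n" using h(3) gc by (simp flip: adj_mult)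
    have hJ: "h * J * adj h = 1\<^sub>m n" unfolding J using gc ahg h(3) by (simp add: mat_assoc)
    have "card {x \<in> ?T. fst x = J} = card {x \<in> ?T. fst x = 1\<^sub>m n}"
      by (rule card_act_fibre[where g = g and h = h]) (use h gc J hJ in \<open>auto simp: n_def act_def\<close>)
    then show "card {x \<in> ?T. fst x = J} = card (nil_pairs_corank z n k)" using F1 by simp
  qed
  then show ?thesis by (simp add: n_def)
qed

section \<open>Triples with the skew form in normal position\<close>

definition top_left :: "nat \<Rightarrow> 'a mat \<Rightarrow> 'a mat" where
  "top_left r M = mat r r (\<lambda>ij. M $$ ij)"

lemma top_left_four_block: "A \<in> carrier_mat r r \<Longrightarrow> D \<in> carrier_mat k k \<Longrightarrow> top_left r (four_block_mat A B C D) = A"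
  unfolding top_left_def by (rule eq_matI) auto

lemma card_Skew_rank: "card (Skew_rank r k) = card (Herm_rank r k)"
proof -
  obtain \<theta> :: 'a where t: "\<theta> \<noteq> 0" "\<theta> ^ q = - \<theta>" using exists_skew_scalar by blast
  have i: "inverse \<theta> \<noteq> 0" "\<theta> * inverse \<theta> = 1" "inverse \<theta> * \<theta> = 1" using t by auto
  show ?thesis
  proof (rule card_eq_by_inverse[where f = "\<lambda>A. inverse \<theta> \<cdot>\<^sub>m A" and g = "\<lambda>A. \<theta> \<cdot>\<^sub>m A"])
    fix A assume A: "A \<in> Skew_rank r k"
    have e: "\<theta> \<cdot>\<^sub>m (inverse \<theta> \<cdot>\<^sub>m A) = A" by (simp add: mat_smult_smult i)
    then have "inverse \<theta> \<cdot>\<^sub>m A \<in> Herm (r + k)" using Skew_smult_iff(1)[OF t, of "inverse \<theta> \<cdot>\<^sub>m A"] A by (simp add: Skew_rank_def)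
    then show "inverse \<theta> \<cdot>\<^sub>m A \<in> Herm_rank r k \<and> \<theta> \<cdot>\<^sub>m (inverse \<theta> \<cdot>\<^sub>m A) = A"
      using A e card_ker_smult[OF i(1), of A] by (simp add: Skew_rank_def Herm_rank_def)
  next
    fix A assume A: "A \<in> Herm_rank r k"
    then show "\<theta> \<cdot>\<^sub>m A \<in> Skew_rank r k \<and> inverse \<theta> \<cdot>\<^sub>m (\<theta> \<cdot>\<^sub>m A) = A"
      using Skew_smult_iff(1)[OF t, of A] card_ker_smult[OF t(1), of A] i by (simp add: Skew_rank_def Herm_rank_def mat_smult_smult)
  qed
qed

text \<open>The same triples sorted by \<open>N\<close>: the scalar \<open>\<theta>\<close> carries
  the Hermitian normal form to skew forms, so those of corank \<open>k\<close> are again a single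
  orbit and all fibres are equal.\<close>

lemma card_form_triples_N:
  assumes t: "\<theta> \<noteq> 0" "\<theta> ^ q = - \<theta>"
  shows "card (form_triples z r k) =
    card (Herm_rank r k) * card {x \<in> form_triples z r k. fst (snd x) = \<theta> \<cdot>\<^sub>m diag_one r k}"
proof -
  define n where "n = r + k"
  let ?T = "form_triples z r k" and ?N = "\<theta> \<cdot>\<^sub>m diag_one r k"
  have "card ?T = (\<Sum>N\<in>Skew_rank r k. card {x \<in> ?T. fst (snd x) = ?N})"
  proof (rule card_by_fibres[where f = "\<lambda>x. fst (snd x)"])
    show "finite ?T" by simp
    show "finite (Skew_rank r k)" by (rule finite_subset[OF _ finite_Skew[of "r + k"]]) (auto simp: Skew_rank_def)
    show "fst (snd x) \<in> Skew_rank r k" if "x \<in> ?T" for x using that by (cases x) (auto simp: form_triples_def)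
    fix N assume N: "N \<in> Skew_rank r k"
    have e: "\<theta> \<cdot>\<^sub>m (inverse \<theta> \<cdot>\<^sub>m N) = N" using t by (simp add: mat_smult_smult)
    then have "inverse \<theta> \<cdot>\<^sub>m N \<in> Herm_rank r k"
      using N Skew_smult_iff(1)[OF t, of "inverse \<theta> \<cdot>\<^sub>m N"] card_ker_smult[of "inverse \<theta>" N] t
      by (simp add: Skew_rank_def Herm_rank_def)
    then obtain g0 where g0: "g0 \<in> GL n" "inverse \<theta> \<cdot>\<^sub>m N = g0 * diag_one r k * adj g0" unfolding n_def by (rule Herm_rankE)
    define h where "h = adj g0"
    have h: "h \<in> GL n" unfolding h_def by (rule adj_GL[OF g0(1)])
    obtain g where g: "g \<in> GL n" "h * g = 1\<^sub>m n" "g * h = 1\<^sub>m n" using GL_inverse[OF h] .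
    have c: "h \<in> carrier_mat n n" "g \<in> carrier_mat n n" using GL_carrier h g(1) by auto
    have "N = \<theta> \<cdot>\<^sub>m (g0 * diag_one r k * adj g0)" using e g0(2) by simp
    then have Nh: "N = adj h * ?N * h"
      unfolding h_def using GL_carrier[OF g0(1)] by (simp add: mat_mult_smult_left mat_mult_smult_right n_def)
    have agh: "adj g * adj h = 1\<^sub>m n" using g c by (simp flip: adj_mult)
    have gN: "adj g * N * g = ?N"
      unfolding Nh using c g(2) mat_cancel[OF agh, of "?N * (h * g)"]
      by (simp add: mat_assoc n_def mat_mult_smult_left)
    show "card {x \<in> ?T. fst (snd x) = N} = card {x \<in> ?T. fst (snd x) = ?N}"
      by (rule card_act_fibre[where g = g and h = h]) (use g c Nh gN in \<open>auto simp: n_def act_def\<close>)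
  qed
  then show ?thesis using card_Skew_rank by simp
qed


text \<open>The number of lifts of the second operator over a fixed completion, where
  \<open>c\<close> is the corank of the smaller first operator; the zero operator has a single lift,
  again zero.\<close>

definition ext_count :: "bool \<Rightarrow> nat \<Rightarrow> nat \<Rightarrow> nat" where
  "ext_count z k c = (if z then 1 else card (nil_skew (k - c)) * ((q ^ 2) ^ ((k - c) * c) * q ^ (c ^ 2)))"

lemma adj_smult_form_mult:
  assumes "X \<in> carrier_mat n m" "Y \<in> carrier_mat m l"
  shows "(c \<cdot>\<^sub>m X) * Y = c \<cdot>\<^sub>m (X * Y)" "X * (c \<cdot>\<^sub>m Y) = c \<cdot>\<^sub>m (X * Y :: 'a mat)"
  using assms by (simp_all add: mat_mult_smult_left mat_mult_smult_right)

text \<open>Up to \<open>\<theta>\<close>, the product \<open>J * N\<close> has \<open>J1\<close>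
  and \<open>adj v\<close> as its first block column and zeros elsewhere. Its kernel consists of the
  last \<open>k\<close> coordinates and is preserved by any commuting operator, which gives
  \<open>E = 0\<close>. Of the other commutation relations one says that the smaller operators
  commute, and one coincides with a skewness relation as soon as \<open>B1\<close> is skew.\<close>

lemma form_triple_normalised_iff:
  assumes t: "\<theta> \<noteq> 0" "\<theta> ^ q = - \<theta>"
    and J: "J1 \<in> Herm r" "v \<in> carrier_mat r k" "d \<in> Herm k" "four_block_mat J1 v (adj v) d \<in> GL (r + k)"
    and B: "B1 \<in> carrier_mat r r" "E \<in> carrier_mat r k" "C \<in> carrier_mat k r" "G \<in> carrier_mat k k"
  shows "(four_block_mat J1 v (adj v) d, \<theta> \<cdot>\<^sub>m diag_one r k, four_block_mat B1 E C G) \<in> form_triples z r k \<longleftrightarrow>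
    E = 0\<^sub>m r k \<and> (\<theta> \<cdot>\<^sub>m J1, B1) \<in> nil_pairs z r \<and>
    four_block_mat B1 (0\<^sub>m r k) C G * four_block_mat J1 v (adj v) d \<in> Skew (r + k) \<and> nilpotent_mat G \<and>
    (z \<longrightarrow> C = 0\<^sub>m k r \<and> G = 0\<^sub>m k k)" (is "?L \<longleftrightarrow> ?R")
proof -
  let ?J = "four_block_mat J1 v (adj v) d" and ?D = "diag_one r k :: 'a mat" and ?B = "four_block_mat B1 E C G"
  note J1c = Herm_carrier[OF J(1)] and dc = Herm_carrier[OF J(3)]
  have va: "adj v \<in> carrier_mat k r" using J by simp
  have Jc: "?J \<in> carrier_mat (r + k) (r + k)" and Bc: "?B \<in> carrier_mat (r + k) (r + k)" using J1c dc B by simp_all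
  have JH: "?J \<in> Herm (r + k)" using Herm_four_block[OF J1c J(2) va dc] J by simp
  have tD: "\<theta> \<cdot>\<^sub>m ?D \<in> Skew_rank r k"
    unfolding Skew_rank_def using Skew_smult_iff(1)[OF t, of ?D "r + k"] card_ker_smult[OF t(1), of ?D] card_ker_diag_one'
    by simp
  have JD: "?J * ?D = four_block_mat J1 (0\<^sub>m r k) (adj v) (0\<^sub>m k k)"
    unfolding diag_one_def by (subst mult_four_block_mat[of _ r r _ k _ k _ _ r _ k]) (use J1c dc J va in auto)
  have JDc: "?J * ?D \<in> carrier_mat (r + k) (r + k)" using Jc by simp
  have JN: "?J * (\<theta> \<cdot>\<^sub>m ?D) = \<theta> \<cdot>\<^sub>m (?J * ?D)" by (rule adj_smult_form_mult[OF Jc diag_one_carrier])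
  have nJN: "nilpotent_mat (?J * (\<theta> \<cdot>\<^sub>m ?D)) \<longleftrightarrow> nilpotent_mat J1"
    unfolding JN nilpotent_smult_iff[OF t(1) JDc] unfolding JD
    using nilpotent_four_block_lower[OF J1c va, of "0\<^sub>m k k"] by simp
  have comm: "(?J * (\<theta> \<cdot>\<^sub>m ?D)) * ?B = ?B * (?J * (\<theta> \<cdot>\<^sub>m ?D)) \<longleftrightarrow> (?J * ?D) * ?B = ?B * (?J * ?D)"
    unfolding JN adj_smult_form_mult[OF JDc Bc] adj_smult_form_mult(2)[OF Bc JDc] by (rule smult_eq_iff[OF t(1)])
  have JDB: "(?J * ?D) * ?B = four_block_mat (J1 * B1) (J1 * E) (adj v * B1) (adj v * E)"
    unfolding JD by (subst mult_four_block_mat[of _ r r _ k _ k _ _ r _ k]) (use J1c dc J va B in auto)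
  have BJD: "?B * (?J * ?D) = four_block_mat (B1 * J1 + E * adj v) (0\<^sub>m r k) (C * J1 + G * adj v) (0\<^sub>m k k)"
    unfolding JD by (subst mult_four_block_mat[of _ r r _ k _ k _ _ r _ k]) (use J1c dc J va B in auto)
  have BJ: "four_block_mat B1 (0\<^sub>m r k) C G * ?J = four_block_mat (B1 * J1) (B1 * v) (C * J1 + G * adj v) (C * v + G * d)"
    by (subst mult_four_block_mat[of _ r r _ k _ k _ _ r _ k]) (use J1c dc J va B in auto)
  have c: "J1 * B1 \<in> carrier_mat r r" "J1 * E \<in> carrier_mat r k" "adj v * B1 \<in> carrier_mat k r" "adj v * E \<in> carrier_mat k k"
    "B1 * J1 + E * adj v \<in> carrier_mat r r" "C * J1 + G * adj v \<in> carrier_mat k r" "B1 * J1 \<in> carrier_mat r r" "B1 * v \<in> carrier_mat r k"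
    "C * v + G * d \<in> carrier_mat k k"
    using J1c dc J(2) va B by (auto intro!: add_carrier_mat mult_carrier_mat[of G k k] mult_carrier_mat[of E r k] mult_carrier_mat[of "adj v" k r]
      mult_carrier_mat[of B1 r r] mult_carrier_mat[of J1 r r])
  \<comment> \<open>\<open>J1\<close> and \<open>adj v\<close> form the first block column of the
    nonsingular \<open>J\<close>, so together they are injective. This yields \<open>E = 0\<close>
    and, below, the skewness of \<open>B1\<close>.\<close>
  have inj: "X = 0\<^sub>m r l" if "J1 * X = 0\<^sub>m r l" "adj v * X = 0\<^sub>m k l" "X \<in> carrier_mat r l" for X l
  proof -
    have "?J * four_block_mat X (0\<^sub>m r 0) (0\<^sub>m k l) (0\<^sub>m k 0) = ?J * four_block_mat (0\<^sub>m r l) (0\<^sub>m r 0) (0\<^sub>m k l) (0\<^sub>m k 0)"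
      using J1c J(2) va dc that by (simp add: mult_four_block_mat[of _ r r _ k _ k _ _ l _ 0])
    from GL_cancel_left[OF J(4) _ _ this, of "l + 0"]
    have e: "four_block_mat X (0\<^sub>m r 0) (0\<^sub>m k l) (0\<^sub>m k 0) = four_block_mat (0\<^sub>m r l) (0\<^sub>m r 0) (0\<^sub>m k l) (0\<^sub>m k 0)"
      using that(3) four_block_carrier_mat[OF that(3) zero_carrier_mat[of k 0]]
        four_block_carrier_mat[OF zero_carrier_mat[of r l] zero_carrier_mat[of k 0]] by blast
    show ?thesis by (rule four_block_eqD(1)[OF e that(3), of 0 k]) simp_all
  qed
  have J1n: "nilpotent_mat (\<theta> \<cdot>\<^sub>m J1) \<longleftrightarrow> nilpotent_mat J1" by (rule nilpotent_smult_iff[OF t(1) J1c])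
  have J1S: "\<theta> \<cdot>\<^sub>m J1 \<in> Skew r" using Skew_smult_iff(1)[OF t] J(1) by blast
  have J1B: "(\<theta> \<cdot>\<^sub>m J1) * B1 = B1 * (\<theta> \<cdot>\<^sub>m J1) \<longleftrightarrow> J1 * B1 = B1 * J1"
    unfolding adj_smult_form_mult[OF J1c B(1)] adj_smult_form_mult(2)[OF B(1) J1c] by (rule smult_eq_iff[OF t(1)])
  show ?thesis
  proof
    assume ?L
    then have L: "nilpotent_mat J1" "nilpotent_mat ?B" "?B * ?J \<in> Skew (r + k)" "(?J * ?D) * ?B = ?B * (?J * ?D)"
      "z \<longrightarrow> ?B = 0\<^sub>m (r + k) (r + k)"
      unfolding form_triples_def split mem_Collect_eq nJN comm by blast+
    note e = four_block_eqD[OF L(4)[unfolded JDB BJD] c(1-5) zero_carrier_mat c(6) zero_carrier_mat]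
    have E: "E = 0\<^sub>m r k" by (rule inj[OF e(2,4) B(2)])
    have e1: "J1 * B1 = B1 * J1" using e(1) c(7) J(2) unfolding E by simp
    note BJs = L(3)[unfolded E]
    have sk: "B1 * J1 \<in> Skew r" "C * J1 + G * adj v = - adj (B1 * v)"
      using BJs Skew_four_block[OF c(7,8,6,9)] unfolding BJ by auto
    \<comment> \<open>Both halves of that block column annihilate \<open>adj B1 + B1\<close>:
      \<open>J1\<close> because \<open>B1 * J1\<close> is skew and \<open>B1\<close> commutes with
      \<open>J1\<close>, and \<open>adj v\<close> because commutation and skewness give two
      expressions for the same lower left block.\<close>
    have "J1 * adj B1 = adj (B1 * J1)" using J(1) B(1) J1c by (simp add: adj_mult Herm_def)
    also have "\<dots> = - (B1 * J1)" using sk(1) by (simp add: Skew_iff)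
    finally have "J1 * adj B1 = - (J1 * B1)" unfolding e1 .
    then have 1: "J1 * (adj B1 + B1) = 0\<^sub>m r r" using J1c B(1) c(1) by (simp add: mat_add_distrib_left)
    have "adj v * B1 = - (adj v * adj B1)" using e(3) sk(2) B(1) J(2) by (simp add: adj_mult)
    moreover have "adj v * (adj B1 + B1) = adj v * adj B1 + adj v * B1"
      using va B(1) J(2) by (simp add: mat_add_distrib_left)
    moreover have "X + - X = 0\<^sub>m k r" if "X \<in> carrier_mat k r" for X :: "'a mat"
      by (rule eq_matI) (use that in auto)
    ultimately have 2: "adj v * (adj B1 + B1) = 0\<^sub>m k r"
      using mult_carrier_mat[OF va, of "adj B1" r] B(1) by simp
    have "adj B1 + B1 = 0\<^sub>m r r" by (rule inj[OF 1 2]) (use B(1) in simp)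
    then have B1a: "adj B1 = - B1"
    proof -
      assume s: "adj B1 + B1 = 0\<^sub>m r r"
      have "adj B1 = (adj B1 + B1) + - B1" by (rule eq_matI) (use B(1) in auto)
      then show ?thesis unfolding s using B(1) by simp
    qed
    then have B1S: "B1 \<in> Skew r" using B(1) by (simp add: Skew_iff)
    have n: "nilpotent_mat B1" "nilpotent_mat G" using L(2) nilpotent_four_block_lower[OF B(1,3,4)] unfolding E by auto
    have z: "B1 = 0\<^sub>m r r \<and> C = 0\<^sub>m k r \<and> G = 0\<^sub>m k k" if z
    proof -
      have "four_block_mat B1 E C G = four_block_mat (0\<^sub>m r r) (0\<^sub>m r k) (0\<^sub>m k r) (0\<^sub>m k k)" using L(5) that by simp
      from four_block_eqD[OF this B zero_carrier_mat zero_carrier_mat zero_carrier_mat zero_carrier_mat] show ?thesis by blast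
    qed
    have "(\<theta> \<cdot>\<^sub>m J1, B1) \<in> nil_pairs z r"
      unfolding nil_pairs_def nil_skew_def split mem_Collect_eq J1n J1B using L(1) J1S B1S n(1) e1 z by blast
    then show ?R using E BJs n(2) z by blast
  next
    assume ?R
    then have E: "E = 0\<^sub>m r k" and np: "(\<theta> \<cdot>\<^sub>m J1, B1) \<in> nil_pairs z r" and BJs: "four_block_mat B1 (0\<^sub>m r k) C G * ?J \<in> Skew (r + k)"
      and G: "nilpotent_mat G" and z: "z \<longrightarrow> C = 0\<^sub>m k r \<and> G = 0\<^sub>m k k" by blast+
    have R: "nilpotent_mat J1" "B1 \<in> Skew r" "nilpotent_mat B1" "J1 * B1 = B1 * J1" "z \<longrightarrow> B1 = 0\<^sub>m r r"
      using np unfolding nil_pairs_def nil_skew_def split mem_Collect_eq J1n J1B by blast+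
    \<comment> \<open>In the converse direction skewness fixes this lower left block, and with
      \<open>B1\<close> skew it becomes exactly what commutation demands.\<close>
    have "C * J1 + G * adj v = - adj (B1 * v)" using BJs Skew_four_block[OF c(7,8,6,9)] unfolding BJ by auto
    also have "\<dots> = adj v * B1" using R(2) B(1) J(2) by (simp add: adj_mult Skew_iff)
    finally have "(?J * ?D) * ?B = ?B * (?J * ?D)"
      unfolding JDB BJD using E R(4) J1c B(1) J(2) va c(7) by simp
    moreover have "nilpotent_mat ?B" unfolding E using nilpotent_four_block_lower[OF B(1,3,4)] R(3) G by simp
    moreover have "z \<longrightarrow> ?B = 0\<^sub>m (r + k) (r + k)" using z R(5) E by auto
    moreover have "?B * ?J \<in> Skew (r + k)" unfolding E by (rule BJs)
    ultimately show ?L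
      unfolding form_triples_def split mem_Collect_eq nJN comm using R(1) Bc JH J(4) tD by blast
  qed
qed

text \<open>A triple over a given smaller pair is a completion of \<open>J1\<close> together with a
  lift of \<open>B1\<close> to the completed form; the number of lifts is the same for all
  completions, so the count is a product.\<close>

lemma card_normalised_fibre:
  assumes t: "\<theta> \<noteq> 0" "\<theta> ^ q = - \<theta>" and J1: "J1 \<in> Herm r" and AB: "(\<theta> \<cdot>\<^sub>m J1, B1) \<in> nil_pairs z r"
    and c: "card (ker_mat J1) = (q ^ 2) ^ c"
  shows "card {x \<in> form_triples z r k. fst (snd x) = \<theta> \<cdot>\<^sub>m diag_one r k \<and> \<theta> \<cdot>\<^sub>m top_left r (fst x) = \<theta> \<cdot>\<^sub>m J1 \<and>
      top_left r (snd (snd x)) = B1} = card (completions k J1) * ext_count z k c" (is "card ?F = _")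
proof -
  let ?D = "diag_one r k :: 'a mat"
  note J1c = Herm_carrier[OF J1]
  have B1: "B1 \<in> Skew r" "nilpotent_mat B1" "z \<longrightarrow> B1 = 0\<^sub>m r r" and cm: "(\<theta> \<cdot>\<^sub>m J1) * B1 = B1 * (\<theta> \<cdot>\<^sub>m J1)"
    using AB by (auto simp: nil_pairs_def nil_skew_def)
  note B1c = Skew_carrier[OF B1(1)]
  have cm': "J1 * B1 = B1 * J1"
    using cm unfolding adj_smult_form_mult[OF J1c B1c] adj_smult_form_mult(2)[OF B1c J1c] smult_eq_iff[OF t(1)] .
  have BJ1: "B1 * J1 \<in> Skew r"
    using B1(1) J1 cm' B1c J1c by (simp add: Skew_iff Herm_def adj_mult)
  let ?E = "\<lambda>(v, d). {(C, G). C \<in> carrier_mat k r \<and> G \<in> carrier_mat k k \<and>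
      four_block_mat B1 (0\<^sub>m r k) C G * four_block_mat J1 v (adj v) d \<in> Skew (r + k) \<and> nilpotent_mat G \<and>
      (z \<longrightarrow> C = 0\<^sub>m k r \<and> G = 0\<^sub>m k k)}"
  let ?f = "\<lambda>((v, d), (C, G)). (four_block_mat J1 v (adj v) d, \<theta> \<cdot>\<^sub>m ?D, four_block_mat B1 (0\<^sub>m r k) C G)"
  have E: "card (?E vd) = ext_count z k c" if vd: "vd \<in> completions k J1" for vd
  proof -
    obtain v d where p: "vd = (v, d)" by (cases vd)
    have vdc: "v \<in> carrier_mat r k" "d \<in> Herm k" using vd in_completions[OF J1c] unfolding p by auto
    show ?thesis
    proof (cases z)
      case True
      have "0\<^sub>m (r + k) (r + k) * four_block_mat J1 v (adj v) d = 0\<^sub>m (r + k) (r + k)"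
        by (rule left_mult_zero_mat) (use J1c Herm_carrier[OF vdc(2)] in simp)
      moreover have "(0\<^sub>m (r + k) (r + k) :: 'a mat) \<in> Skew (r + k)" by (simp add: Skew_iff)
      ultimately have "?E vd = {(0\<^sub>m k r, 0\<^sub>m k k)}" unfolding p using True B1(3) by auto
      then show ?thesis using True by (simp add: ext_count_def)
    next
      case False
      then show ?thesis
        using card_nilpotent_skew_extensions(2)[OF J1 vd[unfolded p] c B1c BJ1 B1(2)] unfolding p by (simp add: ext_count_def)
    qed
  qed
  have "bij_betw ?f (SIGMA vd:completions k J1. ?E vd) ?F"
  proof (rule bij_betw_imageI)
    show "inj_on ?f (SIGMA vd:completions k J1. ?E vd)"
    proof (rule inj_onI)
      fix x y assume xy: "x \<in> (SIGMA vd:completions k J1. ?E vd)" "y \<in> (SIGMA vd:completions k J1. ?E vd)" "?f x = ?f y"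
      obtain v d C G where x: "x = ((v, d), (C, G))" by (cases x) auto
      obtain v' d' C' G' where y: "y = ((v', d'), (C', G'))" by (cases y) auto
      have c: "v \<in> carrier_mat r k" "d \<in> carrier_mat k k" "C \<in> carrier_mat k r" "G \<in> carrier_mat k k"
        "v' \<in> carrier_mat r k" "d' \<in> carrier_mat k k" "C' \<in> carrier_mat k r" "G' \<in> carrier_mat k k"
        using xy(1,2) in_completions[OF J1c] unfolding x y by (auto simp: Herm_carrier)
      have e: "four_block_mat J1 v (adj v) d = four_block_mat J1 v' (adj v') d'"
        "four_block_mat B1 (0\<^sub>m r k) C G = four_block_mat B1 (0\<^sub>m r k) C' G'" using xy(3) unfolding x y by auto
      have va: "adj v \<in> carrier_mat k r" "adj v' \<in> carrier_mat k r" using c by auto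
      show "x = y" unfolding x y
        using four_block_eqD(2,4)[OF e(1) J1c c(1) va(1) c(2) J1c c(5) va(2) c(6)]
          four_block_eqD(3,4)[OF e(2) B1c zero_carrier_mat c(3,4) B1c zero_carrier_mat c(7,8)] by simp
    qed
    show "?f ` (SIGMA vd:completions k J1. ?E vd) = ?F"
    proof (intro equalityI subsetI)
      fix w assume "w \<in> ?f ` (SIGMA vd:completions k J1. ?E vd)"
      then obtain x where x: "x \<in> (SIGMA vd:completions k J1. ?E vd)" "w = ?f x" by blast
      obtain v d C G where p: "x = ((v, d), (C, G))" by (cases x) auto
      have vd: "v \<in> carrier_mat r k" "d \<in> Herm k" "four_block_mat J1 v (adj v) d \<in> GL (r + k)"
        and CG: "C \<in> carrier_mat k r" "G \<in> carrier_mat k k"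
        "four_block_mat B1 (0\<^sub>m r k) C G * four_block_mat J1 v (adj v) d \<in> Skew (r + k)" "nilpotent_mat G"
        "z \<longrightarrow> C = 0\<^sub>m k r \<and> G = 0\<^sub>m k k"
        using x(1) in_completions[OF J1c] unfolding p by auto
      have w: "w = (four_block_mat J1 v (adj v) d, \<theta> \<cdot>\<^sub>m ?D, four_block_mat B1 (0\<^sub>m r k) C G)" using x(2) unfolding p by simp
      have "w \<in> form_triples z r k"
        unfolding w form_triple_normalised_iff[OF t J1 vd B1c zero_carrier_mat CG(1,2)] using AB CG by blast
      then show "w \<in> ?F"
        unfolding w using top_left_four_block[OF J1c Herm_carrier[OF vd(2)]] top_left_four_block[OF B1c CG(2)] by simp
    next
      fix w assume w: "w \<in> ?F"
      obtain J N B where wJ: "w = (J, N, B)" by (cases w)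
      have N: "N = \<theta> \<cdot>\<^sub>m ?D" and T: "(J, N, B) \<in> form_triples z r k" and tl: "top_left r J = J1" "top_left r B = B1"
        using w unfolding wJ smult_eq_iff[OF t(1)] by auto
      have J: "J \<in> Herm (r + k)" "J \<in> GL (r + k)" and Bc: "B \<in> carrier_mat (r + k) (r + k)"
        using T by (auto simp: form_triples_def)
      obtain J1' v v' d where Jb: "J = four_block_mat J1' v v' d" "J1' \<in> carrier_mat r r" "v \<in> carrier_mat r k"
        "v' \<in> carrier_mat k r" "d \<in> carrier_mat k k" using four_block_cases[OF Herm_carrier[OF J(1)]] by metis
      have J1': "J1' = J1" using tl(1) top_left_four_block[OF Jb(2,5)] unfolding Jb(1) by simp
      have v': "v' = adj v" and d: "d \<in> Herm k" using J(1) Herm_four_block[OF Jb(2-5)] unfolding Jb(1) by auto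
      obtain B1' E C G where Bb: "B = four_block_mat B1' E C G" "B1' \<in> carrier_mat r r" "E \<in> carrier_mat r k"
        "C \<in> carrier_mat k r" "G \<in> carrier_mat k k" using four_block_cases[OF Bc] by metis
      have B1': "B1' = B1" using tl(2) top_left_four_block[OF Bb(2,5)] unfolding Bb(1) by simp
      have J': "J = four_block_mat J1 v (adj v) d" unfolding Jb(1) J1' v' ..
      have B': "B = four_block_mat B1 E C G" unfolding Bb(1) B1' ..
      have R: "E = 0\<^sub>m r k" "four_block_mat B1 (0\<^sub>m r k) C G * four_block_mat J1 v (adj v) d \<in> Skew (r + k)" "nilpotent_mat G"
        "z \<longrightarrow> C = 0\<^sub>m k r \<and> G = 0\<^sub>m k k"
        using T form_triple_normalised_iff[OF t J1 Jb(3) d J(2)[unfolded J'] B1c Bb(3-5), of z] unfolding J' N B' by blast+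
      have "(v, d) \<in> completions k J1" using in_completions[OF J1c] Jb(3) d J(2) unfolding J' by blast
      then show "w \<in> ?f ` (SIGMA vd:completions k J1. ?E vd)"
        by (intro image_eqI[of _ _ "((v, d), (C, G))"]) (use R Bb in \<open>simp_all add: wJ J' N B'\<close>)
    qed
  qed
  from bij_betw_same_card[OF this]
  have "card ?F = card (SIGMA vd:completions k J1. ?E vd)" by simp
  also have "\<dots> = (\<Sum>vd\<in>completions k J1. card (?E vd))"
  proof (rule card_SigmaI)
    show "\<forall>vd\<in>completions k J1. finite (?E vd)"
      by (auto intro: finite_subset[of _ "carrier_mat k r \<times> carrier_mat k k"])
  qed simp
  also have "\<dots> = card (completions k J1) * ext_count z k c" using E by simp
  finally show ?thesis .
qed

section \<open>Summation over coranks and the recursion\<close>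

lemma finite_nil_pairs [simp]: "finite (nil_pairs z n)"
  by (rule finite_subset[of _ "Skew n \<times> Skew n"]) (auto simp: nil_pairs_def nil_skew_def)

lemma nil_pairs_corank_subset: "nil_pairs_corank z n k \<subseteq> nil_pairs z n"
  by (auto simp: nil_pairs_corank_def)

lemma finite_nil_pairs_corank [simp]: "finite (nil_pairs_corank z n k)"
  by (rule finite_subset[OF nil_pairs_corank_subset]) simp

text \<open>The Hermitian normal form of \<open>\<theta>\<close> times the first component shows
  that its kernel has \<open>(q ^ 2) ^ c\<close> elements for some \<open>c \<le> n\<close>.\<close>

lemma nil_pairs_disjoint_union: "nil_pairs z n = (\<Union>c\<in>{..n}. nil_pairs_corank z n c)"
proof (intro equalityI subsetI)
  fix x assume x: "x \<in> nil_pairs z n"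
  obtain A B where xA: "x = (A, B)" by (cases x)
  obtain \<theta> :: 'a where t: "\<theta> \<noteq> 0" "\<theta> ^ q = - \<theta>" using exists_skew_scalar by blast
  have "A \<in> Skew n" using x unfolding xA by (simp add: nil_pairs_def nil_skew_def)
  then have "\<theta> \<cdot>\<^sub>m A \<in> Herm n" using Skew_smult_iff(2)[OF t] by blast
  then obtain r k g where "n = r + k" "card (ker_mat (\<theta> \<cdot>\<^sub>m A)) = (q ^ 2) ^ k" by (rule Herm_cases_rank)
  then have "k \<le> n" "x \<in> nil_pairs_corank z n k" using x card_ker_smult[OF t(1), of A] unfolding xA by (auto simp: nil_pairs_corank_def)
  then show "x \<in> (\<Union>c\<in>{..n}. nil_pairs_corank z n c)" by blast
qed (auto simp: nil_pairs_corank_def)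

lemma sum_nil_pairs: "(\<Sum>x\<in>nil_pairs z n. f x) = (\<Sum>c\<le>n. \<Sum>x\<in>nil_pairs_corank z n c. f x)"
  unfolding nil_pairs_disjoint_union
proof (rule sum.UNION_disjoint)
  show "\<forall>i\<in>{..n}. \<forall>j\<in>{..n}. i \<noteq> j \<longrightarrow> nil_pairs_corank z n i \<inter> nil_pairs_corank z n j = {}"
    by (auto simp: nil_pairs_corank_def q2_power_inject)
qed simp_all

lemma card_nil_pairs: "card (nil_pairs z n) = (\<Sum>c\<le>n. card (nil_pairs_corank z n c))"
  using sum_nil_pairs[of "\<lambda>_. 1::nat"] by simp

text \<open>The two counts of \<open>form_triples\<close> are equated. On the side with normalised
  \<open>N\<close>, the fibre over a smaller pair is governed by the Hermitian matrix
  \<open>inverse \<theta>\<close> times its first component, and its size depends only on the corank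
  \<open>c\<close>.\<close>

lemma nil_pairs_recursion:
  "card (Herm_rank (r + k) 0) * card (nil_pairs_corank z (r + k) k) = card (Herm_rank r k) *
    (\<Sum>c\<le>r. card (nil_pairs_corank z r c) * ((q ^ 2) ^ ((r - c) * k) * card (completions k (0\<^sub>m c c)) * ext_count z k c))"
proof -
  obtain \<theta> :: 'a where t: "\<theta> \<noteq> 0" "\<theta> ^ q = - \<theta>" using exists_skew_scalar by blast
  let ?F = "{x \<in> form_triples z r k. fst (snd x) = \<theta> \<cdot>\<^sub>m diag_one r k}"
  let ?p = "\<lambda>x. (\<theta> \<cdot>\<^sub>m top_left r (fst x), top_left r (snd (snd x)))"
  let ?J = "\<lambda>A :: 'a mat. inverse \<theta> \<cdot>\<^sub>m A"
  let ?c = "\<lambda>y. card {x \<in> ?F. ?p x = y}"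
  have "card ?F = (\<Sum>y\<in>nil_pairs z r. ?c y)"
  proof (rule card_by_fibres)
    show "finite ?F" "finite (nil_pairs z r)" by simp_all
    fix x assume x: "x \<in> ?F"
    obtain J N B where xJ: "x = (J, N, B)" by (cases x)
    have N: "N = \<theta> \<cdot>\<^sub>m diag_one r k" and T: "(J, N, B) \<in> form_triples z r k" using x unfolding xJ by auto
    have J: "J \<in> Herm (r + k)" "J \<in> GL (r + k)" and Bc: "B \<in> carrier_mat (r + k) (r + k)" using T by (auto simp: form_triples_def)
    obtain J1 v v' d where Jb: "J = four_block_mat J1 v v' d" "J1 \<in> carrier_mat r r" "v \<in> carrier_mat r k"
      "v' \<in> carrier_mat k r" "d \<in> carrier_mat k k" using four_block_cases[OF Herm_carrier[OF J(1)]] by metis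
    have J1: "J1 \<in> Herm r" and v': "v' = adj v" and d: "d \<in> Herm k" using J(1) Herm_four_block[OF Jb(2-5)] unfolding Jb(1) by auto
    obtain B1 E C G where Bb: "B = four_block_mat B1 E C G" "B1 \<in> carrier_mat r r" "E \<in> carrier_mat r k"
      "C \<in> carrier_mat k r" "G \<in> carrier_mat k k" using four_block_cases[OF Bc] by metis
    have "(\<theta> \<cdot>\<^sub>m J1, B1) \<in> nil_pairs z r"
      using form_triple_normalised_iff[OF t J1 Jb(3) d J(2)[unfolded Jb(1) v'] Bb(2-5)] T
      unfolding Jb(1) v' N Bb(1) by blast
    then show "?p x \<in> nil_pairs z r"
      unfolding xJ fst_conv snd_conv Jb(1) Bb(1) top_left_four_block[OF Jb(2,5)] top_left_four_block[OF Bb(2,5)] .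
  qed simp
  also have "\<dots> = (\<Sum>c\<le>r. \<Sum>y\<in>nil_pairs_corank z r c. ?c y)" by (rule sum_nil_pairs)
  also have "\<dots> = (\<Sum>c\<le>r. \<Sum>y\<in>nil_pairs_corank z r c. (q ^ 2) ^ ((r - c) * k) * card (completions k (0\<^sub>m c c)) * ext_count z k c)"
  proof (intro sum.cong refl)
    fix c y assume c: "c \<in> {..r}" and y: "y \<in> nil_pairs_corank z r c"
    obtain A B1 where yA: "y = (A, B1)" by (cases y)
    have AB: "(A, B1) \<in> nil_pairs z r" "card (ker_mat A) = (q ^ 2) ^ c" using y unfolding yA by (auto simp: nil_pairs_corank_def)
    have A: "\<theta> \<cdot>\<^sub>m ?J A = A" using t by (simp add: mat_smult_smult)
    have "A \<in> Skew r" using AB by (simp add: nil_pairs_def nil_skew_def)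
    then have JH: "?J A \<in> Herm r" using Skew_smult_iff(1)[OF t, of "?J A"] A by simp
    have k: "card (ker_mat (?J A)) = (q ^ 2) ^ c" using card_ker_smult[of "inverse \<theta>" A] t AB(2) by simp
    have "?J A \<in> Herm_rank (r - c) c" using JH k c by (simp add: Herm_rank_def)
    then have M: "card (completions k (?J A)) = (q ^ 2) ^ ((r - c) * k) * card (completions k (0\<^sub>m c c))"
      by (rule card_completions_Herm_rank)
    have "(\<theta> \<cdot>\<^sub>m ?J A, B1) \<in> nil_pairs z r" unfolding A by (rule AB(1))
    from card_normalised_fibre[OF t JH this k, of k]
    have "card {x \<in> form_triples z r k. fst (snd x) = \<theta> \<cdot>\<^sub>m diag_one r k \<and> \<theta> \<cdot>\<^sub>m top_left r (fst x) = A \<and> top_left r (snd (snd x)) = B1} =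
      (q ^ 2) ^ ((r - c) * k) * card (completions k (0\<^sub>m c c)) * ext_count z k c" unfolding A M .
    moreover have "{x \<in> ?F. ?p x = y} = {x \<in> form_triples z r k. fst (snd x) = \<theta> \<cdot>\<^sub>m diag_one r k \<and> \<theta> \<cdot>\<^sub>m top_left r (fst x) = A \<and> top_left r (snd (snd x)) = B1}"
      unfolding yA by blast
    ultimately show "?c y = (q ^ 2) ^ ((r - c) * k) * card (completions k (0\<^sub>m c c)) * ext_count z k c" by simp
  qed
  finally have "card ?F = (\<Sum>c\<le>r. card (nil_pairs_corank z r c) * ((q ^ 2) ^ ((r - c) * k) * card (completions k (0\<^sub>m c c)) * ext_count z k c))"
    by simp
  then show ?thesis using card_form_triples_J[of z r k] card_form_triples_N[OF t, of z r k] by simp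
qed

end

subsection \<open>Identities for q-binomial coefficients and power series\<close>

text \<open>The q-Pochhammer symbol (t; t)_n.\<close>

definition qpoch :: "real \<Rightarrow> nat \<Rightarrow> real" where
  "qpoch t n = (\<Prod>i=1..n. 1 - t ^ i)"

lemma qpoch_0 [simp]: "qpoch t 0 = 1"
  by (simp add: qpoch_def)

lemma qpoch_Suc: "qpoch t (Suc n) = qpoch t n * (1 - t ^ Suc n)"
  by (simp add: qpoch_def)

text \<open>Gaussian binomial coefficients, introduced by Pascal's rule; this builds in the value 0
  for \<open>k\<close> above \<open>n\<close>, so sums need no cut-off.\<close>

fun qbinom :: "real \<Rightarrow> nat \<Rightarrow> nat \<Rightarrow> real" where
  "qbinom t n 0 = 1"
| "qbinom t 0 (Suc k) = 0"
| "qbinom t (Suc n) (Suc k) = t ^ Suc k * qbinom t n (Suc k) + qbinom t n k"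

lemma qbinom_eq_0: "n < k \<Longrightarrow> qbinom t n k = 0"
  by (induction t n k rule: qbinom.induct) auto

lemma qbinom_self [simp]: "qbinom t n n = 1"
  by (induction n) (auto simp: qbinom_eq_0)

context
  fixes t :: real
  assumes t: "\<bar>t\<bar> < 1"
begin

lemma one_minus_power_pos: "n > 0 \<Longrightarrow> 1 - t ^ n > 0"
proof -
  assume "n > 0"
  then have "\<bar>t\<bar> ^ n < 1" using t by (intro power_less_one_iff[THEN iffD2]) auto
  then show ?thesis by (simp add: power_abs abs_less_iff flip: power_abs)
qed

lemma qpoch_pos: "qpoch t n > 0"
proof (induction n)
  case (Suc n)
  then show ?case unfolding qpoch_Suc using one_minus_power_pos[of "Suc n"] by (intro mult_pos_pos) simp_all
qed simp

text \<open>The limit of the q-Vandermonde identity as its second upper index grows. The shift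
  \<open>i\<close> is kept general because Pascal's rule merges neighbouring terms for
  \<open>Suc n\<close> into terms for \<open>n\<close> with shift \<open>i + 1\<close>.\<close>

lemma sum_qbinom_qpoch:
  "(\<Sum>j\<le>n. qbinom t n j * t ^ (j * (j + i)) / qpoch t (j + i)) = 1 / qpoch t (n + i)"
proof (induction n arbitrary: i)
  case (Suc n)
  let ?a = "\<lambda>j. t ^ (j * (j + i)) / qpoch t (j + i)"
  have 1: "(\<Sum>j\<le>Suc n. qbinom t (Suc n) j * ?a j) =
      (\<Sum>j\<le>Suc n. t ^ j * qbinom t n j * ?a j) + (\<Sum>j\<le>n. qbinom t n j * ?a (Suc j))"
    by (subst (1 2) sum.atMost_Suc_shift) (simp add: algebra_simps sum.distrib add_divide_distrib del: power_Suc)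
  have "(\<Sum>j\<le>Suc n. t ^ j * qbinom t n j * ?a j) = (\<Sum>j\<le>n. t ^ j * qbinom t n j * ?a j)"
    by (simp add: qbinom_eq_0)
  then have "(\<Sum>j\<le>Suc n. qbinom t (Suc n) j * ?a j) =
      (\<Sum>j\<le>n. qbinom t n j * (t ^ j * ?a j + ?a (Suc j)))"
    unfolding 1 by (simp add: sum.distrib algebra_simps)
  also have "\<dots> = (\<Sum>j\<le>n. qbinom t n j * (t ^ (j * (j + Suc i)) / qpoch t (j + Suc i)))"
  proof (intro sum.cong refl arg_cong2[where f = "(*)"])
    fix j
    let ?p = "qpoch t (j + i)" and ?x = "t ^ (j * (j + i + 1))" and ?y = "t ^ (j + i + 1)"
    have p: "?p \<noteq> 0" "1 - ?y \<noteq> 0" using qpoch_pos[of "j + i"] one_minus_power_pos[of "j + i + 1"] by auto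
    have q: "qpoch t (Suc j + i) = ?p * (1 - ?y)" "qpoch t (j + Suc i) = ?p * (1 - ?y)"
      using qpoch_Suc[of t "j + i"] by simp_all
    have "t ^ j * t ^ (j * (j + i)) = ?x" by (simp flip: power_add add: algebra_simps)
    moreover have "t ^ (Suc j * (Suc j + i)) = ?x * ?y" by (simp flip: power_add add: algebra_simps)
    ultimately have "t ^ j * ?a j + ?a (Suc j) = ?x / ?p + ?x * ?y / (?p * (1 - ?y))"
      unfolding q by simp
    also have "\<dots> = ?x / (?p * (1 - ?y))" using p by (simp add: divide_simps) (simp add: algebra_simps)
    finally show "t ^ j * ?a j + ?a (Suc j) = t ^ (j * (j + Suc i)) / qpoch t (j + Suc i)" unfolding q by simp
  qed
  also have "\<dots> = 1 / qpoch t (n + Suc i)" using Suc.IH[of "Suc i"] by simp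
  finally show ?case by simp
qed simp

text \<open>The q-Vandermonde identity. The induction moves one unit from \<open>a\<close> to
  \<open>b\<close>: Pascal's rule splits \<open>qbinom t (Suc a)\<close>, and used backwards it
  joins the pieces to \<open>qbinom t (Suc b)\<close> with the shift raised by one.\<close>

lemma qbinom_vandermonde:
  "(\<Sum>j\<le>a. t ^ (j * (j + i)) * qbinom t a j * qbinom t b (j + i)) = qbinom t (a + b) (a + i)"
proof (induction a arbitrary: b i)
  case (Suc a)
  let ?f = "\<lambda>j. t ^ (j * (j + i)) * qbinom t b (j + i)"
  have 1: "(\<Sum>j\<le>Suc a. qbinom t (Suc a) j * ?f j) =
      (\<Sum>j\<le>Suc a. t ^ j * qbinom t a j * ?f j) + (\<Sum>j\<le>a. qbinom t a j * ?f (Suc j))"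
    by (subst (1 2) sum.atMost_Suc_shift) (simp add: algebra_simps sum.distrib del: power_Suc)
  have "(\<Sum>j\<le>Suc a. t ^ j * qbinom t a j * ?f j) = (\<Sum>j\<le>a. t ^ j * qbinom t a j * ?f j)"
    by (simp add: qbinom_eq_0)
  then have "(\<Sum>j\<le>Suc a. qbinom t (Suc a) j * ?f j) = (\<Sum>j\<le>a. qbinom t a j * (t ^ j * ?f j + ?f (Suc j)))"
    unfolding 1 by (simp add: sum.distrib algebra_simps)
  also have "\<dots> = (\<Sum>j\<le>a. t ^ (j * (j + Suc i)) * qbinom t a j * qbinom t (Suc b) (j + Suc i))"
  proof (intro sum.cong refl)
    fix j
    let ?x = "t ^ (j * (j + i + 1))" and ?y = "t ^ (j + i + 1)"
    have 1: "t ^ j * t ^ (j * (j + i)) = ?x" by (simp flip: power_add add: algebra_simps)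
    have 2: "t ^ (Suc j * (Suc j + i)) = ?x * ?y" by (simp flip: power_add add: algebra_simps)
    have "t ^ j * ?f j = ?x * qbinom t b (j + i)" unfolding 1[symmetric] by (simp only: mult.assoc)
    moreover have "?f (Suc j) = ?x * (?y * qbinom t b (Suc (j + i)))" unfolding 2 by (simp only: mult.assoc add_Suc)
    ultimately have "t ^ j * ?f j + ?f (Suc j) = ?x * (qbinom t b (j + i) + ?y * qbinom t b (Suc (j + i)))"
      by (simp only: distrib_left)
    then show "qbinom t a j * (t ^ j * ?f j + ?f (Suc j)) = t ^ (j * (j + Suc i)) * qbinom t a j * qbinom t (Suc b) (j + Suc i)"
      by (simp add: algebra_simps)
  qed
  also have "\<dots> = qbinom t (a + Suc b) (a + Suc i)" by (rule Suc.IH)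
  finally show ?case by (simp add: mult_ac)
qed simp

lemma qbinom_mult_qpoch: "k \<le> n \<Longrightarrow> qbinom t n k * (qpoch t k * qpoch t (n - k)) = qpoch t n"
proof (induction t n k rule: qbinom.induct)
  case (3 t n k)
  show ?case
  proof (cases "k = n")
    case False
    then have k: "Suc k \<le> n" using 3 by simp
    then obtain m where m: "n = Suc k + m" using le_Suc_ex by blast
    have 1: "qbinom t n (Suc k) * (qpoch t (Suc k) * qpoch t m) = qpoch t n" using "3.IH"(1) k m by simp
    have 2: "qbinom t n k * (qpoch t k * qpoch t (Suc m)) = qpoch t n" using "3.IH"(2) k m by simp
    have "qbinom t (Suc n) (Suc k) * (qpoch t (Suc k) * qpoch t (Suc n - Suc k)) =
      t ^ Suc k * (1 - t ^ Suc m) * (qbinom t n (Suc k) * (qpoch t (Suc k) * qpoch t m)) +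
      (1 - t ^ Suc k) * (qbinom t n k * (qpoch t k * qpoch t (Suc m)))"
      using m by (simp add: qpoch_Suc algebra_simps del: power_Suc)
    also have "\<dots> = qpoch t n * (1 - t ^ Suc k * t ^ Suc m)" unfolding 1 2 by (simp add: algebra_simps)
    also have "t ^ Suc k * t ^ Suc m = t ^ Suc n" using m by (simp flip: power_add)
    finally show ?thesis by (simp add: qpoch_Suc)
  qed simp
qed auto

end

section \<open>The substitutions of c u and of u^i for u in power series\<close>

definition fps_dilate :: "real \<Rightarrow> real fps \<Rightarrow> real fps" where
  "fps_dilate c F = Abs_fps (\<lambda>n. c ^ n * fps_nth F n)"

lemma fps_dilate_nth [simp]: "fps_nth (fps_dilate c F) n = c ^ n * fps_nth F n"
  by (simp add: fps_dilate_def)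

lemma fps_dilate_mult: "fps_dilate c (F * G) = fps_dilate c F * fps_dilate c G"
proof (rule fps_ext)
  fix n
  have "c ^ n * (\<Sum>i=0..n. fps_nth F i * fps_nth G (n - i)) = (\<Sum>i=0..n. (c ^ i * fps_nth F i) * (c ^ (n - i) * fps_nth G (n - i)))"
    unfolding sum_distrib_left
  proof (rule sum.cong)
    fix i assume "i \<in> {0..n}"
    then have "c ^ n = c ^ i * c ^ (n - i)" by (simp flip: power_add)
    then show "c ^ n * (fps_nth F i * fps_nth G (n - i)) = (c ^ i * fps_nth F i) * (c ^ (n - i) * fps_nth G (n - i))" by simp
  qed simp
  then show "fps_nth (fps_dilate c (F * G)) n = fps_nth (fps_dilate c F * fps_dilate c G) n" by (simp add: fps_mult_nth)
qed

lemma fps_dilate_dilate: "fps_dilate a (fps_dilate b F) = fps_dilate (a * b) F"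
  by (rule fps_ext) (simp add: power_mult_distrib)

lemma fps_dilate_linear: "fps_dilate c (1 + fps_const a * fps_X) = 1 + fps_const (c * a) * fps_X"
  by (rule fps_ext) (simp add: fps_X_def)

lemma fps_dilate_one [simp]: "fps_dilate c 1 = 1"
  by (rule fps_ext) simp

lemma fps_linear_mult_nth: "fps_nth ((1 + fps_const (a :: real) * fps_X) * F) n = fps_nth F n + a * (if n = 0 then 0 else fps_nth F (n - 1))"
proof -
  have "(1 + fps_const a * fps_X) * F = F + fps_const a * (fps_X * F)" by (simp only: distrib_right mult_1 mult.assoc)
  then show ?thesis by (simp only: fps_add_nth fps_mult_left_const_nth fps_X_mult_nth)
qed

definition fps_subst_power :: "nat \<Rightarrow> real fps \<Rightarrow> real fps" where
  "fps_subst_power i F = Abs_fps (\<lambda>n. if i dvd n then fps_nth F (n div i) else 0)"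

lemma fps_subst_power_nth: "fps_nth (fps_subst_power i F) n = (if i dvd n then fps_nth F (n div i) else 0)"
  by (simp add: fps_subst_power_def)

lemma fps_subst_power_mult:
  assumes "i > 0"
  shows "fps_subst_power i (F * G) = fps_subst_power i F * fps_subst_power i G"
proof (rule fps_ext)
  fix n
  let ?f = "\<lambda>j. fps_nth (fps_subst_power i F) j * fps_nth (fps_subst_power i G) (n - j)"
  show "fps_nth (fps_subst_power i (F * G)) n = fps_nth (fps_subst_power i F * fps_subst_power i G) n"
  proof (cases "i dvd n")
    case True
    then obtain m where m: "n = i * m" by blast
    have "(\<Sum>j=0..n. ?f j) = (\<Sum>j\<in>(\<lambda>j. i * j) ` {0..m}. ?f j)"
    proof (rule sum.mono_neutral_right)
      show "\<forall>j\<in>{0..n} - (\<lambda>j. i * j) ` {0..m}. ?f j = 0"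
      proof
        fix j assume "j \<in> {0..n} - (\<lambda>j. i * j) ` {0..m}"
        then have "\<not> i dvd j" using assms unfolding m by (auto elim!: dvdE)
        then show "?f j = 0" by (simp add: fps_subst_power_nth)
      qed
    qed (auto simp: m)
    also have "\<dots> = (\<Sum>j=0..m. ?f (i * j))" using assms by (subst sum.reindex) (auto simp: inj_on_def)
    also have "\<dots> = (\<Sum>j=0..m. fps_nth F j * fps_nth G (m - j))"
      using assms by (intro sum.cong refl) (simp add: fps_subst_power_nth m flip: right_diff_distrib')
    finally show ?thesis using assms by (simp add: fps_mult_nth fps_subst_power_nth m)
  next
    case False
    have "?f j = 0" if "j \<le> n" for j
    proof (cases "i dvd j")
      case True
      then have "\<not> i dvd n - j" using False that by (metis dvd_diffD)
      then show ?thesis by (simp add: fps_subst_power_nth)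
    qed (simp add: fps_subst_power_nth)
    then have "(\<Sum>j=0..n. ?f j) = 0" by (intro sum.neutral) auto
    then show ?thesis using False by (simp add: fps_mult_nth fps_subst_power_nth)
  qed
qed

lemma fps_subst_power_one [simp]: "i > 0 \<Longrightarrow> fps_subst_power i 1 = 1"
  by (rule fps_ext) (auto simp: fps_subst_power_nth elim!: dvdE)

lemma fps_subst_power_linear:
  assumes "i > 0"
  shows "fps_subst_power i (1 + fps_const a * fps_X) = 1 + fps_const a * fps_X ^ i"
proof (rule fps_ext)
  fix n
  have "i dvd n \<and> n div i = 1 \<longleftrightarrow> n = i" "i dvd n \<and> n div i = 0 \<longleftrightarrow> n = 0" using assms by (auto elim!: dvdE)
  then show "fps_nth (fps_subst_power i (1 + fps_const a * fps_X)) n = fps_nth (1 + fps_const a * fps_X ^ i) n"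
    unfolding fps_subst_power_nth using assms by (cases "n = 0"; cases "n = i") auto
qed

lemma fps_subst_power_inverse:
  assumes "i > 0"
  shows "fps_subst_power i (1 / (1 + fps_const a * fps_X)) = 1 / (1 + fps_const a * fps_X ^ i)"
proof -
  let ?g = "1 + fps_const a * fps_X :: real fps" and ?h = "1 + fps_const a * fps_X ^ i :: real fps"
  have g0: "fps_nth ?g 0 \<noteq> 0" and h0: "fps_nth ?h 0 \<noteq> 0" using assms by (simp_all add: fps_X_power_nth)
  have "fps_subst_power i (1 / ?g) * ?h = fps_subst_power i (1 / ?g * ?g)"
    unfolding fps_subst_power_linear[OF assms, symmetric] by (rule fps_subst_power_mult[OF assms, symmetric])
  also have "1 / ?g * ?g = 1" using g0 by (simp add: fps_divide_unit inverse_mult_eq_1)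
  finally have e: "fps_subst_power i (1 / ?g) * ?h = 1" using assms by simp
  have "fps_subst_power i (1 / ?g) = fps_subst_power i (1 / ?g) * (?h * inverse ?h)"
    using inverse_mult_eq_1'[OF h0] by simp
  also have "\<dots> = inverse ?h" unfolding mult.assoc[symmetric] e by simp
  finally show ?thesis using h0 by (simp add: fps_divide_unit)
qed

lemma fps_subst_power_prod:
  assumes "i > 0"
  shows "fps_subst_power i (\<Prod>l\<in>A. F l) = (\<Prod>l\<in>A. fps_subst_power i (F l))"
  using assms by (induction A rule: infinite_finite_induct) (auto simp: fps_subst_power_mult)

section \<open>The inner product over l and a convolution identity\<close>

context
  fixes t :: real
  assumes t: "\<bar>t\<bar> < 1"
begin

lemma qpoch_nonzero: "qpoch t n \<noteq> 0"
  using qpoch_pos[OF t, of n] by simp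

text \<open>The series W. By Euler's identity for the sum of x^n / (t; t)_n at x = - t u it should
  be the product of 1 / (1 + t^l u) over l from 1 on.\<close>

definition nil_series :: "real fps" where
  "nil_series = Abs_fps (\<lambda>n. (- t) ^ n / qpoch t n)"

lemma nil_series_dilate: "fps_dilate t nil_series = (1 + fps_const t * fps_X) * nil_series"
proof (rule fps_ext)
  fix n
  show "fps_nth (fps_dilate t nil_series) n = fps_nth ((1 + fps_const t * fps_X) * nil_series) n"
  proof (cases n)
    case (Suc m)
    have p: "qpoch t m \<noteq> 0" "1 - t ^ Suc m \<noteq> 0"
      using qpoch_nonzero one_minus_power_pos[OF t, of "Suc m"] by auto
    show ?thesis
      unfolding fps_linear_mult_nth Suc using p
      by (simp add: nil_series_def qpoch_Suc divide_simps) (simp add: algebra_simps)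
  qed (simp add: fps_linear_mult_nth nil_series_def)
qed

text \<open>Iterating the functional equation \<open>N\<close> times: each dilation by
  \<open>t\<close> splits off one more linear factor.\<close>

lemma nil_series_partial_product:
  "(\<Prod>l=1..N. 1 / (1 + fps_const (t ^ l) * fps_X)) * fps_dilate (t ^ N) nil_series = nil_series"
proof (induction N)
  case 0
  show ?case by (simp add: fps_ext)
next
  case (Suc N)
  let ?g = "1 + fps_const (t ^ Suc N) * fps_X :: real fps"
  have "fps_dilate (t ^ Suc N) nil_series = fps_dilate (t ^ N) (fps_dilate t nil_series)"
    by (simp add: fps_dilate_dilate mult.commute)
  also have "\<dots> = ?g * fps_dilate (t ^ N) nil_series"
    unfolding nil_series_dilate fps_dilate_mult fps_dilate_linear by (simp add: mult.commute)
  finally have d: "fps_dilate (t ^ Suc N) nil_series = ?g * fps_dilate (t ^ N) nil_series" .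
  have "1 / ?g * ?g = 1" by (subst fps_divide_unit) (simp_all add: inverse_mult_eq_1)
  then have "(1 / ?g) * fps_dilate (t ^ Suc N) nil_series = fps_dilate (t ^ N) nil_series"
    unfolding d by (simp only: mult.assoc[symmetric] mult_1)
  moreover have "(\<Prod>l=1..Suc N. 1 / (1 + fps_const (t ^ l) * fps_X)) = (\<Prod>l=1..N. 1 / (1 + fps_const (t ^ l) * fps_X)) * (1 / ?g)"
    by simp
  ultimately show ?case using Suc by (simp only: mult.assoc)
qed

text \<open>The partial product is W(u) divided by W(t^N u). The powers of \<open>t\<close> kill
  every coefficient of the divisor except the constant one, which is 1.\<close>

lemma partial_product_tendsto:
  "(\<lambda>N. fps_nth (\<Prod>l=1..N. 1 / (1 + fps_const (t ^ l) * fps_X)) n) \<longlonglongrightarrow> fps_nth nil_series n"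
proof -
  let ?P = "\<lambda>N. \<Prod>l=1..N. 1 / (1 + fps_const (t ^ l) * fps_X) :: real fps"
  let ?V = "inverse nil_series"
  have W0: "fps_nth nil_series 0 \<noteq> 0" by (simp add: nil_series_def)
  have P: "?P N = nil_series * fps_dilate (t ^ N) ?V" for N
  proof -
    have "fps_dilate (t ^ N) nil_series * fps_dilate (t ^ N) ?V = 1"
      unfolding fps_dilate_mult[symmetric] inverse_mult_eq_1'[OF W0] by simp
    then have "?P N = ?P N * (fps_dilate (t ^ N) nil_series * fps_dilate (t ^ N) ?V)" by simp
    also have "\<dots> = nil_series * fps_dilate (t ^ N) ?V"
      unfolding mult.assoc[symmetric] nil_series_partial_product ..
    finally show ?thesis .
  qed
  have "(\<lambda>N. \<Sum>i=0..n. fps_nth nil_series i * ((t ^ N) ^ (n - i) * fps_nth ?V (n - i))) \<longlonglongrightarrow>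
      (\<Sum>i=0..n. fps_nth nil_series i * (if i = n then 1 else 0))"
    (is "_ \<longlonglongrightarrow> ?L")
  proof (rule tendsto_sum)
    fix i assume "i \<in> {0..n}"
    show "(\<lambda>N. fps_nth nil_series i * ((t ^ N) ^ (n - i) * fps_nth ?V (n - i))) \<longlonglongrightarrow> fps_nth nil_series i * (if i = n then 1 else 0)"
    proof (cases "i = n")
      case True
      then show ?thesis using W0 by (simp add: nil_series_def)
    next
      case False
      then have "n - i > 0" using \<open>i \<in> {0..n}\<close> by auto
      have "(\<lambda>N. t ^ N) \<longlonglongrightarrow> 0" using t by (intro LIMSEQ_power_zero) simp
      then have "(\<lambda>N. (t ^ N) ^ (n - i)) \<longlonglongrightarrow> 0 ^ (n - i)" by (rule tendsto_power)
      then have "(\<lambda>N. fps_nth nil_series i * ((t ^ N) ^ (n - i) * fps_nth ?V (n - i))) \<longlonglongrightarrow>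
        fps_nth nil_series i * (0 ^ (n - i) * fps_nth ?V (n - i))"
        by (intro tendsto_mult tendsto_const)
      moreover have "(0 :: real) ^ (n - i) = 0" using \<open>n - i > 0\<close> by simp
      ultimately show ?thesis using False by simp
    qed
  qed
  moreover have "?L = fps_nth nil_series n"
    by (subst sum.mono_neutral_right[of _ "{n}"]) auto
  ultimately show ?thesis unfolding P fps_mult_nth fps_dilate_nth by simp
qed

text \<open>Replacing u by u^i commutes with finite products and inverses and only relocates
  coefficients, so coefficientwise limits are preserved.\<close>

lemma inner_product:
  assumes "i \<ge> 1"
  shows "fps_prod_convergent (\<lambda>l. 1 / (1 + fps_const (t ^ l) * fps_X ^ i))"
    and "fps_prodinf (\<lambda>l. 1 / (1 + fps_const (t ^ l) * fps_X ^ i)) = fps_subst_power i nil_series"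
proof -
  have i: "i > 0" using assms by simp
  have "(\<Prod>l=1..N. 1 / (1 + fps_const (t ^ l) * fps_X ^ i)) = fps_subst_power i (\<Prod>l=1..N. 1 / (1 + fps_const (t ^ l) * fps_X))" for N
    using i by (simp add: fps_subst_power_prod fps_subst_power_inverse)
  then have lim: "(\<lambda>N. fps_nth (\<Prod>l=1..N. 1 / (1 + fps_const (t ^ l) * fps_X ^ i)) n) \<longlonglongrightarrow> fps_nth (fps_subst_power i nil_series) n" for n
    using partial_product_tendsto[of "n div i"] by (simp add: fps_subst_power_nth)
  show "fps_prod_convergent (\<lambda>l. 1 / (1 + fps_const (t ^ l) * fps_X ^ i))"
    unfolding fps_prod_convergent_def using lim convergentI by blast
  show "fps_prodinf (\<lambda>l. 1 / (1 + fps_const (t ^ l) * fps_X ^ i)) = fps_subst_power i nil_series"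
    unfolding fps_prodinf_def by (rule fps_ext) (simp only: fps_nth_Abs_fps limI[OF lim])
qed

text \<open>Both sides satisfy the functional equation \<open>P(t\<^sup>2 u) = (1 - u) P(u)\<close>.\<close>

lemma qpoch_square_convolution:
  "(\<Sum>j=0..n. (- t) ^ (j ^ 2) / qpoch (t ^ 2) j * (1 / qpoch t (n - j))) = 1 / qpoch (t ^ 2) n"
proof -
  have t2: "\<bar>t ^ 2\<bar> < 1" using t by (simp add: abs_square_less_1)
  have q2: "qpoch (t ^ 2) n \<noteq> 0" "1 - (t ^ 2) ^ Suc n \<noteq> 0" for n
    using qpoch_pos[OF t2, of n] one_minus_power_pos[OF t2, of "Suc n"] by auto
  \<comment> \<open>Behind these series stand Euler's products: \<open>C\<close> is that of 1 -
    t^(2i+1) u and \<open>E\<close> that of 1 / (1 - t^i u), for i from 0 on. The odd factors cancel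
    in \<open>C * E\<close>, which leaves the series of \<open>1 / qpoch (t ^ 2) n\<close>.\<close>
  define C E where "C = Abs_fps (\<lambda>j. (- t) ^ (j ^ 2) / qpoch (t ^ 2) j)" and "E = Abs_fps (\<lambda>n. 1 / qpoch t n)"
  have C: "C = (1 + fps_const (- t) * fps_X) * fps_dilate (t ^ 2) C"
  proof (rule fps_ext)
    fix n
    show "fps_nth C n = fps_nth ((1 + fps_const (- t) * fps_X) * fps_dilate (t ^ 2) C) n"
    proof (cases n)
      case (Suc m)
      have "(Suc m) ^ 2 = m ^ 2 + Suc (2 * m)" by (simp add: power2_eq_square)
      then have e: "(- t) ^ ((Suc m) ^ 2) = (- t) ^ (m ^ 2) * (- t * (t ^ 2) ^ m)"
        by (simp add: power_add power_mult)
      show ?thesis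
        unfolding fps_linear_mult_nth Suc using q2[of m]
        by (simp add: C_def e qpoch_Suc divide_simps del: power_Suc) (simp add: algebra_simps)
    qed (simp add: fps_linear_mult_nth C_def)
  qed
  have E1: "fps_dilate t E = (1 + fps_const (- 1) * fps_X) * E"
  proof (rule fps_ext)
    fix n
    show "fps_nth (fps_dilate t E) n = fps_nth ((1 + fps_const (- 1) * fps_X) * E) n"
    proof (cases n)
      case (Suc m)
      have p: "qpoch t m \<noteq> 0" "1 - t ^ Suc m \<noteq> 0"
        using qpoch_nonzero one_minus_power_pos[OF t, of "Suc m"] by auto
      show ?thesis
        unfolding fps_linear_mult_nth Suc using p
        by (simp add: E_def qpoch_Suc divide_simps del: power_Suc)
    qed (simp add: fps_linear_mult_nth E_def)
  qed
  have "fps_dilate (t ^ 2) E = fps_dilate t (fps_dilate t E)" by (simp add: fps_dilate_dilate power2_eq_square)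
  also have "\<dots> = (1 + fps_const (- t) * fps_X) * ((1 + fps_const (- 1) * fps_X) * E)"
    unfolding E1 fps_dilate_mult fps_dilate_linear by simp
  finally have E2: "fps_dilate (t ^ 2) E = (1 + fps_const (- t) * fps_X) * ((1 + fps_const (- 1) * fps_X) * E)" .
  have "fps_dilate (t ^ 2) (C * E) = (1 + fps_const (- 1) * fps_X) * (((1 + fps_const (- t) * fps_X) * fps_dilate (t ^ 2) C) * E)"
    unfolding fps_dilate_mult E2 by (simp only: ac_simps)
  then have P: "fps_dilate (t ^ 2) (C * E) = (1 + fps_const (- 1) * fps_X) * (C * E)" using C by simp
  have "fps_nth (C * E) n = 1 / qpoch (t ^ 2) n" for n
  proof (induction n)
    case 0
    show ?case by (simp add: C_def E_def)
  next
    case (Suc n)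
    have "(t ^ 2) ^ Suc n * fps_nth (C * E) (Suc n) = fps_nth (C * E) (Suc n) - fps_nth (C * E) n"
      using arg_cong[OF P, of "\<lambda>F. fps_nth F (Suc n)"] unfolding fps_linear_mult_nth fps_dilate_nth by simp
    then have "fps_nth (C * E) (Suc n) * (1 - (t ^ 2) ^ Suc n) = fps_nth (C * E) n" by (simp only: algebra_simps)
    then show ?case using Suc q2[of n] unfolding qpoch_Suc by (simp add: field_simps del: power_Suc)
  qed
  from this[of n] show ?thesis by (simp add: C_def E_def fps_mult_nth)
qed

end

text \<open>\<open>F s\<close> is the bivariate series \<open>\<Sum> a n k u\<^sup>n z\<^sup>k\<close> at \<open>z = u\<^sup>s\<close>; the recursion reads \<open>F(u, z) = W(u z) F(u, u z)\<close>.\<close>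

lemma product_from_recursion:
  fixes a :: "nat \<Rightarrow> nat \<Rightarrow> real" and w :: "nat \<Rightarrow> real"
  assumes rec: "\<And>r k. a (r + k) k = (\<Sum>c\<le>r. if c \<le> k then a r c * w (k - c) else 0)"
    and a0: "\<And>n. a n 0 = (if n = 0 then 1 else 0)" and above: "\<And>n k. n < k \<Longrightarrow> a n k = 0"
    and Nn: "N \<ge> n"
  shows "fps_nth (\<Prod>i=1..N. fps_subst_power i (Abs_fps w)) n = (\<Sum>k\<le>n. a n k)"
proof -
  define F where "F s = Abs_fps (\<lambda>m. \<Sum>k\<le>m. if s * k \<le> m then a (m - s * k) k else 0)" for s
  have step: "F s = fps_subst_power p (Abs_fps w) * F p" if p: "p = Suc s" for s p
  proof (rule fps_ext)
    fix m
    let ?g = "\<lambda>k c. if p * k \<le> m \<and> c \<le> k then a (m - p * k) c * w (k - c) else 0"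
    let ?h = "\<lambda>b c. if p * (b + c) \<le> m then a (m - p * (b + c)) c * w b else 0"
    have p0: "p > 0" and pk: "p * k = k + s * k" for k using p by simp_all
    have big: "k \<le> m'" if "p * k \<le> m'" for k m' using that unfolding pk by simp
    have "fps_nth (F s) m = (\<Sum>k\<le>m. \<Sum>c\<le>m. ?g k c)"
      unfolding F_def fps_nth_Abs_fps
    proof (intro sum.cong refl)
      fix k assume "k \<in> {..m}"
      \<comment> \<open>If \<open>p * k\<close> fits into \<open>m\<close>, the recursion applies to
        \<open>m - s * k = (m - p * k) + k\<close>. Otherwise the size \<open>m - s * k\<close> is
        smaller than the corank \<open>k\<close>, and the coefficient is zero.\<close>
      show "(if s * k \<le> m then a (m - s * k) k else 0) = (\<Sum>c\<le>m. ?g k c)"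
      proof (cases "p * k \<le> m")
        case True
        define r where "r = m - p * k"
        have r: "m - s * k = r + k" "r \<le> m" "s * k \<le> m" using True pk[of k] by (auto simp: r_def)
        have "a (m - s * k) k = (\<Sum>c\<le>r. if c \<le> k then a r c * w (k - c) else 0)" unfolding r(1) by (rule rec)
        also have "\<dots> = (\<Sum>c\<le>m. if c \<le> k then a r c * w (k - c) else 0)"
          by (rule sum.mono_neutral_left) (use r(2) above in auto)
        finally show ?thesis using True r(3) unfolding r_def by simp
      next
        case False
        then have "s * k \<le> m \<Longrightarrow> m - s * k < k" using pk[of k] by auto
        then show ?thesis using False above by auto
      qed
    qed
    also have "\<dots> = (\<Sum>c\<le>m. \<Sum>k\<le>m. ?g k c)" by (rule sum.swap)
    also have "\<dots> = (\<Sum>c\<le>m. \<Sum>b\<le>m. ?h b c)"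
    proof (rule sum.cong[OF refl])
      fix c assume c: "c \<in> {..m}"
      have "(\<Sum>k\<le>m. ?g k c) = (\<Sum>k\<in>{c..m}. ?g k c)"
        by (rule sum.mono_neutral_right) auto
      \<comment> \<open>The substitution \<open>k = b + c\<close> separates the exponent
        \<open>p * b\<close> of the factor in \<open>w\<close> from the exponent
        \<open>p * c\<close> that belongs to \<open>F p\<close>.\<close>
      also have "\<dots> = (\<Sum>b\<le>m - c. ?h b c)"
        by (rule sum.reindex_bij_witness[of _ "\<lambda>b. b + c" "\<lambda>k. k - c"]) (use c in auto)
      also have "\<dots> = (\<Sum>b\<le>m. ?h b c)"
      proof (rule sum.mono_neutral_left)
        have "\<not> p * (b + c) \<le> m" if "b \<in> {..m} - {..m - c}" for b using big[of "b + c" m] that by auto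
        then show "\<forall>b\<in>{..m} - {..m - c}. ?h b c = 0" by simp
      qed auto
      finally show "(\<Sum>k\<le>m. ?g k c) = (\<Sum>b\<le>m. ?h b c)" .
    qed
    also have "\<dots> = (\<Sum>b\<le>m. \<Sum>c\<le>m. ?h b c)" by (rule sum.swap)
    also have "\<dots> = (\<Sum>b\<le>m. if p * b \<le> m then w b * fps_nth (F p) (m - p * b) else 0)"
    proof (intro sum.cong refl)
      fix b assume "b \<in> {..m}"
      show "(\<Sum>c\<le>m. ?h b c) = (if p * b \<le> m then w b * fps_nth (F p) (m - p * b) else 0)"
      proof (cases "p * b \<le> m")
        case True
        define m' where "m' = m - p * b"
        have m': "m = p * b + m'" using True by (simp add: m'_def)
        have "(\<Sum>c\<le>m. ?h b c) = (\<Sum>c\<le>m. w b * (if p * c \<le> m' then a (m' - p * c) c else 0))"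
          by (intro sum.cong refl) (simp add: distrib_left m')
        also have "\<dots> = (\<Sum>c\<le>m'. w b * (if p * c \<le> m' then a (m' - p * c) c else 0))"
        proof (rule sum.mono_neutral_right)
          have "\<not> p * c \<le> m'" if "c > m'" for c using big[of c m'] that by auto
          then show "\<forall>c\<in>{..m} - {..m'}. w b * (if p * c \<le> m' then a (m' - p * c) c else 0) = 0" by auto
        qed (auto simp: m'_def)
        also have "\<dots> = w b * fps_nth (F p) m'" by (simp add: F_def sum_distrib_left)
        finally show ?thesis using True by (simp add: m'_def)
      next
        case False
        then have "\<not> p * (b + c) \<le> m" for c by (auto simp: distrib_left)
        then show ?thesis using False by simp
      qed
    qed
    also have "\<dots> = (\<Sum>b\<in>{b. p * b \<le> m}. w b * fps_nth (F p) (m - p * b))"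
      by (rule sum.mono_neutral_cong_right) (use big in auto)
    also have "\<dots> = (\<Sum>j\<in>(\<lambda>b. p * b) ` {b. p * b \<le> m}. fps_nth (fps_subst_power p (Abs_fps w)) j * fps_nth (F p) (m - j))"
      using p0 by (subst sum.reindex) (auto simp: inj_on_def fps_subst_power_nth)
    also have "\<dots> = (\<Sum>j=0..m. fps_nth (fps_subst_power p (Abs_fps w)) j * fps_nth (F p) (m - j))"
    proof (rule sum.mono_neutral_left)
      have "\<not> p dvd j" if "j \<in> {0..m} - (\<lambda>b. p * b) ` {b. p * b \<le> m}" for j using that by (auto elim!: dvdE)
      then show "\<forall>j\<in>{0..m} - (\<lambda>b. p * b) ` {b. p * b \<le> m}. fps_nth (fps_subst_power p (Abs_fps w)) j * fps_nth (F p) (m - j) = 0"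
        by (simp add: fps_subst_power_nth)
    qed auto
    finally show "fps_nth (F s) m = fps_nth (fps_subst_power p (Abs_fps w) * F p) m" by (simp add: fps_mult_nth)
  qed
  have prod: "F 0 = (\<Prod>i=1..M. fps_subst_power i (Abs_fps w)) * F M" for M
  proof (induction M)
    case (Suc M)
    have "(\<Prod>i=1..Suc M. fps_subst_power i (Abs_fps w)) = (\<Prod>i=1..M. fps_subst_power i (Abs_fps w)) * fps_subst_power (Suc M) (Abs_fps w)"
      by simp
    then show ?case using Suc step[OF refl, of M] by (simp only: mult.assoc)
  qed simp
  \<comment> \<open>A term with \<open>k > 0\<close> starts at order \<open>N\<close>, and even at
    \<open>m = N\<close> it would need a positive corank in size 0; so up to order \<open>N\<close>
    the remaining factor is 1.\<close>
  have low: "fps_nth (F N) m = (if m = 0 then 1 else 0)" if "m \<le> N" for m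
  proof -
    have "(if N * k \<le> m then a (m - N * k) k else 0) = 0" if "k > 0" for k
    proof (cases "N * k \<le> m")
      case True
      have "N * 1 \<le> N * k" using that by (intro mult_le_mono2) simp
      then have "m - N * k = 0" using True \<open>m \<le> N\<close> by linarith
      then show ?thesis using above that by simp
    qed simp
    then have "(\<Sum>k\<le>m. if N * k \<le> m then a (m - N * k) k else 0) = (\<Sum>k\<in>{0}. if N * k \<le> m then a (m - N * k) k else 0)"
      by (intro sum.mono_neutral_right) auto
    then show ?thesis by (simp add: F_def a0)
  qed
  have "fps_nth (F 0) n = (\<Sum>j=0..n. fps_nth (\<Prod>i=1..N. fps_subst_power i (Abs_fps w)) j * fps_nth (F N) (n - j))"
    unfolding prod[of N] by (rule fps_mult_nth)
  also have "\<dots> = (\<Sum>j=0..n. if j = n then fps_nth (\<Prod>i=1..N. fps_subst_power i (Abs_fps w)) j else 0)"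
    using Nn by (intro sum.cong refl) (auto simp: low)
  also have "\<dots> = fps_nth (\<Prod>i=1..N. fps_subst_power i (Abs_fps w)) n" by simp
  finally show ?thesis by (simp add: F_def)
qed

subsection \<open>Evaluation of the generating function\<close>

lemma qbinom_symmetric:
  assumes t: "\<bar>t\<bar> < 1" and k: "k \<le> n"
  shows "qbinom t n k = qbinom t n (n - k)"
proof -
  have "qbinom t n k * (qpoch t k * qpoch t (n - k)) = qbinom t n (n - k) * (qpoch t k * qpoch t (n - k))"
    using qbinom_mult_qpoch[OF t k] qbinom_mult_qpoch[OF t, of "n - k" n] k by (simp add: mult.commute)
  moreover have "qpoch t k * qpoch t (n - k) \<noteq> 0" using qpoch_nonzero[OF t] by simp
  ultimately show ?thesis using mult_right_cancel by blast
qed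

text \<open>The closed form reproduces itself under the recursion: after inserting it for size
  \<open>r\<close>, the sum over coranks is a q-Vandermonde sum with shift 1.\<close>

lemma nilpotent_corank_solution:
  fixes g :: "nat \<Rightarrow> nat \<Rightarrow> real"
  assumes t: "\<bar>t\<bar> < 1"
    and rec: "\<And>r k. g (r + k) k = (\<Sum>c\<le>r. if c \<le> k then g r c * ((- t) ^ (k ^ 2) / qpoch t (k - c)) else 0)"
    and g0: "\<And>n. g n 0 = (if n = 0 then 1 else 0)"
    and k: "1 \<le> k" "k \<le> n"
  shows "g n k = (- t) ^ n * t ^ (k * (k - 1)) * qbinom t (n - 1) (k - 1) / qpoch t k"
  using k
proof (induction n arbitrary: k rule: less_induct)
  case (less n)
  obtain r where n: "n = r + k" using less.prems le_Suc_ex by (metis add.commute)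
  \<comment> \<open>The exponent is split as \<open>k + k * (k - 1)\<close>; the second part is
    even, so its sign disappears.\<close>
  have par: "(- t) ^ (k ^ 2) = (- t) ^ k * t ^ (k * (k - 1))"
  proof -
    have "k ^ 2 = k + k * (k - 1)" using less.prems(1) by (cases k) (simp_all add: power2_eq_square)
    moreover have "even (k * (k - 1))" by (cases "even k") auto
    ultimately show ?thesis by (simp only: power_add power_minus_even)
  qed
  show ?case
  proof (cases r)
    case 0
    then have "g n k = (- t) ^ (k ^ 2) / qpoch t k" using rec[of 0 k] g0[of 0] unfolding n by simp
    then show ?thesis unfolding par n 0 by simp
  next
    case (Suc r')
    have IH: "g r (Suc j) = (- t) ^ r * t ^ (j * (j + 1)) * qbinom t r' j / qpoch t (Suc j)" if "j \<le> r'" for j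
      using less.IH[of r "Suc j"] less.prems(1) that n Suc by (simp add: mult.commute)
    \<comment> \<open>The two Pochhammer factors combine to a Gaussian binomial over
      \<open>qpoch t k\<close>, which also vanishes exactly where the condition
      \<open>Suc j \<le> k\<close> cuts the sum off.\<close>
    have quot: "(if Suc j \<le> k then 1 / (qpoch t (Suc j) * qpoch t (k - Suc j)) else 0) = qbinom t k (j + 1) / qpoch t k" for j
    proof (cases "Suc j \<le> k")
      case True
      then show ?thesis using qbinom_mult_qpoch[OF t True] qpoch_nonzero[OF t] by (simp add: field_simps)
    next
      case False
      then show ?thesis by (simp add: qbinom_eq_0)
    qed
    have "g n k = (\<Sum>c\<le>Suc r'. if c \<le> k then g r c * ((- t) ^ (k ^ 2) / qpoch t (k - c)) else 0)"
      unfolding n rec Suc ..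
    also have "\<dots> = (\<Sum>j\<le>r'. if Suc j \<le> k then g r (Suc j) * ((- t) ^ (k ^ 2) / qpoch t (k - Suc j)) else 0)"
      unfolding sum.atMost_Suc_shift using g0[of r] Suc by simp
    also have "\<dots> = (\<Sum>j\<le>r'. ((- t) ^ r * (- t) ^ (k ^ 2)) * (t ^ (j * (j + 1)) * qbinom t r' j *
        (if Suc j \<le> k then 1 / (qpoch t (Suc j) * qpoch t (k - Suc j)) else 0)))"
      by (rule sum.cong[OF refl]) (simp add: IH)
    also have "\<dots> = ((- t) ^ r * (- t) ^ (k ^ 2)) * ((\<Sum>j\<le>r'. t ^ (j * (j + 1)) * qbinom t r' j * qbinom t k (j + 1)) / qpoch t k)"
      unfolding quot by (simp add: sum_distrib_left sum_divide_distrib)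
    \<comment> \<open>Vandermonde gives the lower index \<open>r' + 1\<close>. Since
      \<open>n - 1 = r' + k\<close>, symmetry turns it into \<open>k - 1\<close>.\<close>
    also have "(\<Sum>j\<le>r'. t ^ (j * (j + 1)) * qbinom t r' j * qbinom t k (j + 1)) = qbinom t (r' + k) (r' + 1)"
      by (rule qbinom_vandermonde[OF t])
    also have "\<dots> = qbinom t (n - 1) (k - 1)"
      using qbinom_symmetric[OF t, of "r' + 1" "r' + k"] less.prems(1) n Suc by simp
    also have "(- t) ^ r * (- t) ^ (k ^ 2) = (- t) ^ n * t ^ (k * (k - 1))" unfolding par n by (simp add: power_add)
    finally show ?thesis by simp
  qed
qed

text \<open>Corank 0 contributes nothing in positive size, and over the others the closed form is
  summed by the limiting Vandermonde identity with shift 1.\<close>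

lemma nilpotent_corank_sum:
  fixes g :: "nat \<Rightarrow> nat \<Rightarrow> real"
  assumes t: "\<bar>t\<bar> < 1"
    and rec: "\<And>r k. g (r + k) k = (\<Sum>c\<le>r. if c \<le> k then g r c * ((- t) ^ (k ^ 2) / qpoch t (k - c)) else 0)"
    and g0: "\<And>n. g n 0 = (if n = 0 then 1 else 0)"
  shows "(\<Sum>k\<le>n. g n k) = (- t) ^ n / qpoch t n"
proof (cases n)
  case 0
  then show ?thesis using g0 by simp
next
  case (Suc m)
  have "(\<Sum>k\<le>n. g n k) = (\<Sum>j\<le>m. g n (Suc j))" unfolding Suc sum.atMost_Suc_shift using g0 by simp
  also have "\<dots> = (\<Sum>j\<le>m. (- t) ^ n * (qbinom t m j * t ^ (j * (j + 1)) / qpoch t (j + 1)))"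
    by (rule sum.cong[OF refl]) (simp add: nilpotent_corank_solution[OF t rec g0] Suc mult_ac)
  also have "\<dots> = (- t) ^ n * (1 / qpoch t (m + 1))"
    unfolding sum_distrib_left[symmetric] sum_qbinom_qpoch[OF t] ..
  finally show ?thesis using Suc by simp
qed

section \<open>Group orders, normalised weights and the final product\<close>

context unitary_field
begin

definition tq :: real where "tq = - 1 / real q"

definition gu :: "nat \<Rightarrow> real" where "gu n = real (card (GU n q :: 'a mat set))"

definition gl :: "nat \<Rightarrow> real" where "gl n = real (card (GL n :: 'a mat set))"

lemma tq_lt_1: "\<bar>tq\<bar> < 1"
  using q_gt_1 by (simp add: tq_def)

lemma gl_pos: "gl n > 0"
proof -
  have "GL n \<noteq> ({} :: 'a mat set)" using GL_one by blast
  then show ?thesis by (simp add: gl_def card_gt_0_iff)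
qed

lemma gu_pos: "gu n > 0"
proof -
  have "finite (GU n q :: 'a mat set)" by (rule finite_subset[OF _ finite_GL[of n]]) (auto intro: GU_GL)
  moreover have "1\<^sub>m n \<in> (GU n q :: 'a mat set)" by (simp add: GU_iff)
  ultimately show ?thesis by (auto simp: gu_def card_gt_0_iff)
qed

lemma gl_0: "gl 0 = 1"
proof -
  have "GL 0 = {1\<^sub>m 0 :: 'a mat}" by (auto dest: GL_carrier intro!: mat_0_0_eq)
  then show ?thesis by (simp add: gl_def)
qed

lemma real_Herm_rank: "real (card (Herm_rank r k)) = gl (r + k) / (gu r * (real q ^ 2) ^ (r * k) * gl k)"
proof -
  have "gl (r + k) = real (card (Herm_rank r k)) * (gu r * (real q ^ 2) ^ (r * k) * gl k)"
    unfolding gl_def gu_def card_GL_rank by simp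
  then show ?thesis using gu_pos[of r] gl_pos[of k] by (simp add: field_simps)
qed

text \<open>Inserting the orbit size of \<open>Herm_rank (k - c) c\<close> cancels
  \<open>gl c\<close> and the power with exponent \<open>(k - c) * c\<close>.\<close>

lemma real_completions_zero:
  "real (card (completions k (0\<^sub>m c c))) = (if c \<le> k then gl k * real q ^ (c ^ 2) / gu (k - c) else 0)"
proof (cases "c \<le> k")
  case True
  have "real (card (completions k (0\<^sub>m c c))) =
      real (card (Herm_rank (k - c) c)) * ((real q ^ 2) ^ ((k - c) * c) * (gl c * real q ^ (c ^ 2)))"
    unfolding card_completions_zero gl_def using True by simp
  then show ?thesis using True gl_pos[of c] unfolding real_Herm_rank by simp
qed (simp add: card_completions_zero)

text \<open>The numbers a(n, k): those of pairs and, with the flag set, the analogous numbers for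
  single nilpotent elements.\<close>

definition pair_weight :: "bool \<Rightarrow> nat \<Rightarrow> nat \<Rightarrow> real" where
  "pair_weight z n k = real (card (nil_pairs_corank z n k)) / gu n"

text \<open>What remains of the fibre size after division by the group orders: the contribution of
  passing from corank \<open>c\<close> in size \<open>r\<close> to corank \<open>k\<close> in size
  \<open>r + k\<close>.\<close>

definition layer_weight :: "bool \<Rightarrow> nat \<Rightarrow> nat \<Rightarrow> real" where
  "layer_weight z k c = real q ^ (c ^ 2) * real (ext_count z k c) / (gu (k - c) * (real q ^ 2) ^ (c * k))"

text \<open>The orders of the general linear groups cancel: that of size \<open>r + k\<close> occurs
  on both sides, and that of size \<open>k\<close> occurs in the orbit size of \<open>N\<close> and
  in the number of completions.\<close>

lemma pair_weight_recursion:
  "pair_weight z (r + k) k = (\<Sum>c\<le>r. if c \<le> k then pair_weight z r c * layer_weight z k c else 0)"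
proof -
  let ?n = "r + k" and ?Q = "real q ^ 2"
  let ?t = "\<lambda>c. real (card (nil_pairs_corank z r c)) * (?Q ^ ((r - c) * k) * real (card (completions k (0\<^sub>m c c))) * real (ext_count z k c))"
  have n0: "gl ?n \<noteq> 0" "gu ?n \<noteq> 0" "gl k \<noteq> 0" "gu r \<noteq> 0" using gl_pos gu_pos by (metis less_irrefl)+
  have "real (card (Herm_rank ?n 0)) * real (card (nil_pairs_corank z ?n k)) = real (card (Herm_rank r k)) * (\<Sum>c\<le>r. ?t c)"
    using arg_cong[OF nil_pairs_recursion[of r k z], of real] by simp
  then have "gl ?n * pair_weight z ?n k = gl ?n / (gu r * ?Q ^ (r * k) * gl k) * (\<Sum>c\<le>r. ?t c)"
    unfolding real_Herm_rank pair_weight_def by (simp add: gl_0)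
  then have "gl ?n * pair_weight z ?n k = gl ?n * ((\<Sum>c\<le>r. ?t c) / (gu r * ?Q ^ (r * k) * gl k))" by simp
  then have "pair_weight z ?n k = (\<Sum>c\<le>r. ?t c) / (gu r * ?Q ^ (r * k) * gl k)"
    by (simp only: mult_left_cancel[OF n0(1)])
  also have "\<dots> = (\<Sum>c\<le>r. ?t c / (gu r * ?Q ^ (r * k) * gl k))" by (rule sum_divide_distrib)
  also have "\<dots> = (\<Sum>c\<le>r. if c \<le> k then pair_weight z r c * layer_weight z k c else 0)"
  proof (rule sum.cong[OF refl])
    fix c assume "c \<in> {..r}"
    \<comment> \<open>The part \<open>(r - c) * k\<close> of the exponent is cancelled by the free
      rows of the completions; only \<open>c * k\<close> survives in
      \<open>layer_weight\<close>.\<close>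
    then have "r * k = (r - c) * k + c * k" by (simp flip: distrib_right)
    then have Q: "?Q ^ (r * k) = ?Q ^ ((r - c) * k) * ?Q ^ (c * k)" by (simp add: power_add)
    show "?t c / (gu r * ?Q ^ (r * k) * gl k) = (if c \<le> k then pair_weight z r c * layer_weight z k c else 0)"
      unfolding Q real_completions_zero using n0 by (simp add: pair_weight_def layer_weight_def)
  qed
  finally show ?thesis .
qed

text \<open>The free parameters of completion and lift contribute the exponents \<open>c ^ 2\<close>
  and \<open>2 * (k - c) * c + c ^ 2\<close>, which add up to the exponent \<open>2 * c * k\<close>
  of the denominator.\<close>

lemma layer_weight_False:
  assumes "c \<le> k"
  shows "layer_weight False k c = real (card (nil_skew (k - c))) / gu (k - c)"
proof -
  obtain m where m: "k = c + m" using assms le_Suc_ex by blast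
  have "c ^ 2 + (2 * (m * c) + c ^ 2) = 2 * (c * k)" unfolding m by (simp add: power2_eq_square algebra_simps)
  then have "real q ^ (c ^ 2) * ((real q ^ 2) ^ (m * c) * real q ^ (c ^ 2)) = (real q ^ 2) ^ (c * k)"
    by (simp only: power_mult[symmetric] power_add[symmetric])
  then have "real q ^ (c ^ 2) * real (ext_count False k c) = real (card (nil_skew m)) * (real q ^ 2) ^ (c * k)"
    unfolding ext_count_def m by (simp add: mult_ac)
  then show ?thesis unfolding layer_weight_def using m by simp
qed

text \<open>A nilpotent matrix of positive size is singular, so corank 0 occurs only in size 0,
  where there is a single pair.\<close>

lemma pair_weight_zero: "pair_weight z n 0 = (if n = 0 then 1 else 0)"
proof (cases "n = 0")
  case True
  have "nil_pairs_corank z 0 0 = {(0\<^sub>m 0 0, 0\<^sub>m 0 0)}"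
  proof (intro equalityI subsetI)
    fix x assume "x \<in> nil_pairs_corank z 0 0"
    then obtain A B where x: "x = (A, B)" "A \<in> Skew 0" "B \<in> Skew 0"
      unfolding nil_pairs_corank_def nil_pairs_def nil_skew_def by blast
    have "A = 0\<^sub>m 0 0" "B = 0\<^sub>m 0 0" using x(2,3) Skew_carrier by (auto intro!: mat_0_0_eq)
    then show "x \<in> {(0\<^sub>m 0 0, 0\<^sub>m 0 0)}" using x(1) by simp
  next
    fix x :: "'a mat \<times> 'a mat" assume x: "x \<in> {(0\<^sub>m 0 0, 0\<^sub>m 0 0)}"
    have "ker_mat (0\<^sub>m 0 0 :: 'a mat) = carrier_vec 0"
      using in_ker_mat[OF zero_carrier_mat[of 0 0]] zero_mult_vec[of _ 0 0] by blast
    then have "card (ker_mat (0\<^sub>m 0 0 :: 'a mat)) = 1" by (simp add: card_carrier_vec)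
    then show "x \<in> nil_pairs_corank z 0 0"
      using x by (simp add: nil_pairs_corank_def nil_pairs_def nil_skew_def Skew_iff)
  qed
  moreover have "gu 0 = 1" unfolding gu_def card_GU_0 by simp
  ultimately show ?thesis using True by (simp add: pair_weight_def)
next
  case False
  have "nil_pairs_corank z n 0 = {}"
  proof (intro equals0I)
    fix x assume "x \<in> nil_pairs_corank z n 0"
    then obtain A B where A: "A \<in> Skew n" "nilpotent_mat A" "card (ker_mat A) = 1"
      unfolding nil_pairs_corank_def nil_pairs_def nil_skew_def by auto
    show False
      using nilpotent_not_GL[OF Skew_carrier[OF A(1)] A(2)] GL_iff_card_ker[OF Skew_carrier[OF A(1)]] A(3) False by simp
  qed
  then show ?thesis using False by (simp add: pair_weight_def)
qed

lemma pair_weight_above: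
  assumes "n < k"
  shows "pair_weight z n k = 0"
proof -
  have "nil_pairs_corank z n k = {}"
  proof (intro equals0I)
    fix x assume x: "x \<in> nil_pairs_corank z n k"
    then obtain c where "c \<le> n" "x \<in> nil_pairs_corank z n c"
      using nil_pairs_corank_subset nil_pairs_disjoint_union[of z n] by fastforce
    then have "c = k" using x by (auto simp: nil_pairs_corank_def q2_power_inject)
    then show False using assms \<open>c \<le> n\<close> by simp
  qed
  then show ?thesis by (simp add: pair_weight_def)
qed

lemma sum_pair_weight: "(\<Sum>k\<le>n. pair_weight z n k) = real (card (nil_pairs z n)) / gu n"
  unfolding pair_weight_def card_nil_pairs by (simp add: sum_divide_distrib)

text \<open>The usual order of GL over the field with q^2 elements, written with
  \<open>tq ^ 2 = 1 / q ^ 2\<close> so that it matches the convolution identity in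
  \<open>tq\<close>.\<close>

lemma gl_formula: "gl n = (real q ^ 2) ^ (n ^ 2) * qpoch (tq ^ 2) n"
proof (induction n)
  case 0
  show ?case by (simp add: gl_0)
next
  case (Suc n)
  let ?Q = "real q ^ 2"
  have Q1: "q ^ 2 \<ge> 1" using q_gt_1 by simp
  have "real ((q ^ 2) ^ Suc n - 1) = ?Q ^ Suc n - 1" using Q1 by (simp add: of_nat_diff one_le_power del: power_Suc)
  then have "gl (Suc n) = (?Q ^ Suc n - 1) * (?Q ^ n * gl n)"
    unfolding gl_def card_GL_Suc card_UNIV by simp
  also have "\<dots> = (?Q ^ Suc n - 1) * (?Q ^ n * ?Q ^ (n ^ 2)) * qpoch (tq ^ 2) n" unfolding Suc by simp
  also have "?Q ^ Suc n - 1 = ?Q ^ Suc n * (1 - (tq ^ 2) ^ Suc n)"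
  proof -
    have "?Q ^ Suc n * (tq ^ 2) ^ Suc n = (?Q * tq ^ 2) ^ Suc n" by (simp only: power_mult_distrib)
    also have "?Q * tq ^ 2 = 1" by (simp add: tq_def power_divide)
    finally show ?thesis by (simp add: algebra_simps del: power_Suc)
  qed
  also have "?Q ^ Suc n * (1 - (tq ^ 2) ^ Suc n) * (?Q ^ n * ?Q ^ (n ^ 2)) * qpoch (tq ^ 2) n =
      (?Q ^ Suc n * ?Q ^ n * ?Q ^ (n ^ 2)) * (qpoch (tq ^ 2) n * (1 - (tq ^ 2) ^ Suc n))" by (simp only: mult_ac)
  also have "?Q ^ Suc n * ?Q ^ n * ?Q ^ (n ^ 2) = ?Q ^ ((Suc n) ^ 2)"
  proof -
    have "Suc n + n + n ^ 2 = (Suc n) ^ 2" by (simp add: power2_eq_square)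
    then show ?thesis by (simp only: power_add[symmetric])
  qed
  finally show ?case unfolding qpoch_Suc .
qed

lemma sum_Herm_rank: "(\<Sum>r\<le>n. card (Herm_rank r (n - r))) = q ^ (n ^ 2)"
proof -
  have eq: "Herm n = (\<Union>r\<in>{..n}. Herm_rank r (n - r))"
  proof (intro equalityI subsetI)
    fix H assume H: "H \<in> Herm n"
    obtain r k g where "n = r + k" "card (ker_mat H) = (q ^ 2) ^ k" using Herm_cases_rank[OF H] by metis
    then have "H \<in> Herm_rank r (n - r)" "r \<le> n" using H by (auto simp: Herm_rank_def)
    then show "H \<in> (\<Union>r\<in>{..n}. Herm_rank r (n - r))" by blast
  qed (auto simp: Herm_rank_def)
  have "q ^ (n ^ 2) = card (\<Union>r\<in>{..n}. Herm_rank r (n - r))" unfolding eq[symmetric] by (rule card_Herm[symmetric])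
  also have "card (\<Union>r\<in>{..n}. Herm_rank r (n - r)) = (\<Sum>r\<le>n. card (Herm_rank r (n - r)))"
    by (rule card_UN_disjoint) (auto simp: Herm_rank_def q2_power_inject)
  finally show ?thesis by (rule sym)
qed

text \<open>Counting all Hermitian matrices by rank, with the orbit sizes inserted, gives a
  convolution equation for \<open>q ^ (n ^ 2) / gu n\<close>. The numbers
  \<open>1 / qpoch tq n\<close> satisfy the same equation, and since its leading coefficient is 1 it
  has only one solution.\<close>

lemma gu_formula: "gu n = real q ^ (n ^ 2) * qpoch tq n"
proof -
  note tt = tq_lt_1
  have t2: "\<bar>tq ^ 2\<bar> < 1" using tt by (simp add: abs_square_less_1)
  have q2: "qpoch (tq ^ 2) n \<noteq> 0" for n using qpoch_pos[OF t2, of n] by simp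
  define A where "A n = real q ^ (n ^ 2) / gu n" for n
  let ?c = "\<lambda>j. (- tq) ^ (j ^ 2) / qpoch (tq ^ 2) j"
  have conv: "(\<Sum>j=0..n. ?c j * A (n - j)) = 1 / qpoch (tq ^ 2) n" for n
  proof -
    have "real (q ^ (n ^ 2)) = (\<Sum>r\<le>n. real (card (Herm_rank r (n - r))))" unfolding sum_Herm_rank[symmetric] by simp
    also have "\<dots> = (\<Sum>j=0..n. real (card (Herm_rank (n - j) j)))"
      by (rule sum.reindex_bij_witness[of _ "\<lambda>j. n - j" "\<lambda>r. n - r"]) auto
    also have "\<dots> = (\<Sum>j=0..n. (real q ^ (n ^ 2) * qpoch (tq ^ 2) n) * (?c j * A (n - j)))"
    proof (rule sum.cong[OF refl])
      fix j assume "j \<in> {0..n}"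
      then obtain m where m: "n = m + j" by (metis atLeastAtMost_iff le_Suc_ex add.commute)
      \<comment> \<open>The exponents of \<open>q\<close> in an orbit size: \<open>2 * n ^ 2\<close>
        comes from GL of size \<open>n\<close>, \<open>2 * (m * j)\<close> and
        \<open>2 * j ^ 2\<close> from the stabiliser. The leftover \<open>m ^ 2\<close> goes into
        \<open>A m\<close> and \<open>j ^ 2\<close> into the coefficient of the convolution.\<close>
      have e: "2 * n ^ 2 + j ^ 2 = n ^ 2 + m ^ 2 + (2 * (m * j) + 2 * j ^ 2)"
        unfolding m by (simp add: power2_eq_square algebra_simps)
      have "(real q ^ 2) ^ (n ^ 2) * real q ^ (j ^ 2) = real q ^ (n ^ 2) * real q ^ (m ^ 2) * ((real q ^ 2) ^ (m * j) * (real q ^ 2) ^ (j ^ 2))"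
        using arg_cong[OF e, of "\<lambda>i. real q ^ i"] by (simp only: power_add power_mult)
      then have ratio: "(real q ^ 2) ^ (n ^ 2) / ((real q ^ 2) ^ (m * j) * (real q ^ 2) ^ (j ^ 2)) = real q ^ (n ^ 2) * real q ^ (m ^ 2) * (1 / real q ^ (j ^ 2))"
        by (simp add: frac_eq_eq)
      have T: "1 / real q ^ (j ^ 2) = (- tq) ^ (j ^ 2)" by (simp add: tq_def power_divide)
      have "real (card (Herm_rank (n - j) j)) = gl n / (gu m * (real q ^ 2) ^ (m * j) * gl j)"
        using real_Herm_rank[of m j] m by simp
      also have "\<dots> = (real q ^ 2) ^ (n ^ 2) / ((real q ^ 2) ^ (m * j) * (real q ^ 2) ^ (j ^ 2)) * (qpoch (tq ^ 2) n / (gu m * qpoch (tq ^ 2) j))"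
        unfolding gl_formula by (simp add: mult_ac)
      also have "\<dots> = (real q ^ (n ^ 2) * qpoch (tq ^ 2) n) * (?c j * A m)"
        unfolding ratio T A_def by (simp add: mult_ac)
      also have "m = n - j" using m by simp
      finally show "real (card (Herm_rank (n - j) j)) = (real q ^ (n ^ 2) * qpoch (tq ^ 2) n) * (?c j * A (n - j))" .
    qed
    also have "\<dots> = (real q ^ (n ^ 2) * qpoch (tq ^ 2) n) * (\<Sum>j=0..n. ?c j * A (n - j))" by (rule sum_distrib_left[symmetric])
    finally show ?thesis using q2[of n] by (simp add: field_simps)
  qed
  have "A n = 1 / qpoch tq n" for n
  proof (induction n rule: less_induct)
    case (less n)
    have "(\<Sum>j=0..n. ?c j * A (n - j)) = (\<Sum>j=0..n. ?c j * (1 / qpoch tq (n - j)))"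
      unfolding conv qpoch_square_convolution[OF tt] ..
    then have "?c 0 * A n + (\<Sum>j=Suc 0..n. ?c j * A (n - j)) =
        ?c 0 * (1 / qpoch tq n) + (\<Sum>j=Suc 0..n. ?c j * (1 / qpoch tq (n - j)))"
      by (simp add: sum.atLeast_Suc_atMost)
    moreover have "(\<Sum>j=Suc 0..n. ?c j * A (n - j)) = (\<Sum>j=Suc 0..n. ?c j * (1 / qpoch tq (n - j)))"
      by (rule sum.cong[OF refl]) (simp add: less)
    ultimately show ?case by simp
  qed
  from this[of n] show ?thesis unfolding A_def using gu_pos[of n] qpoch_nonzero[OF tt, of n] by (simp add: field_simps)
qed

text \<open>With a single lift the powers of \<open>q\<close> no longer cancel: for
  \<open>m = k - c\<close> the exponent is \<open>c ^ 2 - m ^ 2 - 2 * c * k = - k ^ 2\<close>, and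
  the Pochhammer factor of the order of GU of size \<open>m\<close> stays.\<close>

lemma layer_weight_True:
  assumes "c \<le> k"
  shows "layer_weight True k c = (- tq) ^ (k ^ 2) / qpoch tq (k - c)"
proof -
  obtain m where m: "k = c + m" using assms le_Suc_ex by blast
  have e: "c ^ 2 + k ^ 2 = m ^ 2 + 2 * (c * k)" unfolding m by (simp add: power2_eq_square algebra_simps)
  have "real q ^ (c ^ 2) * real q ^ (k ^ 2) = real q ^ (m ^ 2) * (real q ^ 2) ^ (c * k)"
    using arg_cong[OF e, of "\<lambda>i. real q ^ i"] by (simp only: power_add power_mult)
  then have "real q ^ (c ^ 2) / (real q ^ (m ^ 2) * (real q ^ 2) ^ (c * k)) = 1 / real q ^ (k ^ 2)" by (simp add: frac_eq_eq)
  also have "\<dots> = (- tq) ^ (k ^ 2)" by (simp add: tq_def power_divide)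
  finally have T: "real q ^ (c ^ 2) / (real q ^ (m ^ 2) * (real q ^ 2) ^ (c * k)) = (- tq) ^ (k ^ 2)" .
  have "layer_weight True k c = real q ^ (c ^ 2) / (real q ^ (m ^ 2) * (real q ^ 2) ^ (c * k)) / qpoch tq m"
    unfolding layer_weight_def gu_formula ext_count_def using m by (simp add: mult_ac)
  then show ?thesis unfolding T using m by simp
qed

text \<open>A single nilpotent element is a pair with the flag set, so its weights obey the
  recursion with the explicit layer weight, and summing over coranks gives the value.\<close>

lemma card_nil_skew: "real (card (nil_skew n)) / gu n = (- tq) ^ n / qpoch tq n"
proof -
  have "card (nil_pairs True n) = card (nil_skew n)"
    by (rule card_eq_by_inverse[where f = fst and g = "\<lambda>A. (A, 0\<^sub>m n n)"])
      (auto simp: nil_pairs_def nil_skew_def Skew_iff)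
  then have "real (card (nil_skew n)) / gu n = (\<Sum>k\<le>n. pair_weight True n k)" unfolding sum_pair_weight by simp
  also have "\<dots> = (- tq) ^ n / qpoch tq n"
  proof (rule nilpotent_corank_sum[OF tq_lt_1])
    show "pair_weight True (r + k) k = (\<Sum>c\<le>r. if c \<le> k then pair_weight True r c * ((- tq) ^ (k ^ 2) / qpoch tq (k - c)) else 0)" for r k
      unfolding pair_weight_recursion by (rule sum.cong[OF refl]) (simp add: layer_weight_True)
  qed (rule pair_weight_zero)
  finally show ?thesis .
qed

lemma NU_pairs_eq: "NU_pairs n q = (nil_pairs False n :: ('a mat \<times> 'a mat) set)"
  by (auto simp: NU_pairs_def nil_pairs_def nil_skew_def)

text \<open>Factor \<open>i\<close> of the outer product differs from 1 only from order u^i on, so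
  coefficient \<open>n\<close> has its final value after \<open>n\<close> factors; the value is the
  sum of the weights over all coranks.\<close>

lemma NU_pairs_series:
  assumes "N \<ge> n"
  shows "fps_nth (\<Prod>i=1..N. fps_subst_power i (nil_series tq)) n =
    real (card (NU_pairs n q :: ('a mat \<times> 'a mat) set)) / real (card (GU n q :: 'a mat set))"
proof -
  have "fps_nth (\<Prod>i=1..N. fps_subst_power i (nil_series tq)) n = (\<Sum>k\<le>n. pair_weight False n k)"
    unfolding nil_series_def[OF tq_lt_1]
  proof (rule product_from_recursion[where a = "pair_weight False", OF _ pair_weight_zero pair_weight_above assms])
    show "pair_weight False (r + k) k = (\<Sum>c\<le>r. if c \<le> k then pair_weight False r c * ((- tq) ^ (k - c) / qpoch tq (k - c)) else 0)" for r k
      unfolding pair_weight_recursion by (rule sum.cong[OF refl]) (simp add: layer_weight_False card_nil_skew)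
  qed
  then show ?thesis unfolding sum_pair_weight NU_pairs_eq gu_def .
qed

text \<open>For the outer product every coefficient is eventually constant, while the inner products
  are limits of real sequences, already identified with the substituted
  \<open>nil_series\<close>.\<close>

theorem NU_pairs_product:
  "(\<forall>i\<ge>1. fps_prod_convergent (\<lambda>l. 1 / (1 + fps_const ((-1) ^ l / real q ^ l) * fps_X ^ i)))
    \<and> fps_prod_convergent (\<lambda>i. fps_prodinf (\<lambda>l. 1 / (1 + fps_const ((-1) ^ l / real q ^ l) * fps_X ^ i)))
    \<and> Abs_fps (\<lambda>n. real (card (NU_pairs n q :: ('a mat \<times> 'a mat) set)) / real (card (GU n q :: 'a mat set)))
      = fps_prodinf (\<lambda>i. fps_prodinf (\<lambda>l. 1 / (1 + fps_const ((-1) ^ l / real q ^ l) * fps_X ^ i)))"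
proof -
  have t: "(-1) ^ l / real q ^ l = tq ^ l" for l by (simp only: tq_def power_divide)
  let ?f = "\<lambda>i. fps_prodinf (\<lambda>l. 1 / (1 + fps_const (tq ^ l) * fps_X ^ i))"
  let ?a = "\<lambda>n. real (card (NU_pairs n q :: ('a mat \<times> 'a mat) set)) / real (card (GU n q :: 'a mat set))"
  have "(\<Prod>i=1..N. ?f i) = (\<Prod>i=1..N. fps_subst_power i (nil_series tq))" for N
    by (rule prod.cong[OF refl]) (rule inner_product(2)[OF tq_lt_1], simp)
  then have ev: "fps_nth (\<Prod>i=1..N. ?f i) n = ?a n" if "N \<ge> n" for N n using NU_pairs_series[OF that] by simp
  have lim: "(\<lambda>N. fps_nth (\<Prod>i=1..N. ?f i) n) \<longlonglongrightarrow> ?a n" for n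
    by (rule tendsto_eventually, rule eventually_sequentiallyI[of n], rule ev)
  have "fps_prod_convergent ?f" unfolding fps_prod_convergent_def using lim convergentI by blast
  moreover have "Abs_fps ?a = fps_prodinf ?f"
    unfolding fps_prodinf_def[of ?f] by (rule fps_ext) (simp only: fps_nth_Abs_fps limI[OF lim])
  ultimately show ?thesis unfolding t using inner_product(1)[OF tq_lt_1] by blast
qed

end

theorem theorem3p9:
  fixes q :: nat
  assumes "primepow q"
    and "card (UNIV :: 'a::{finite,field} set) = q ^ 2"
  shows "(\<forall>i\<ge>1. fps_prod_convergent
            (\<lambda>l. 1 / (1 + fps_const ((-1) ^ l / real q ^ l) * fps_X ^ i)))
    \<and> fps_prod_convergent
        (\<lambda>i. fps_prodinf (\<lambda>l. 1 / (1 + fps_const ((-1) ^ l / real q ^ l) * fps_X ^ i)))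
    \<and> Abs_fps (\<lambda>n. real (card (NU_pairs n q :: ('a mat \<times> 'a mat) set))
                      / real (card (GU n q :: 'a mat set)))
      = fps_prodinf
          (\<lambda>i. fps_prodinf (\<lambda>l. 1 / (1 + fps_const ((-1) ^ l / real q ^ l) * fps_X ^ i)))"
proof -
  interpret unitary_field q "TYPE('a)" by unfold_locales (fact assms)+
  show ?thesis by (rule NU_pairs_product)
qed

end
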